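(* Let $d\ge2$, let $\theta\in(0,1)$ and let $u\in C^\theta(\mathbb{T}^d)$ be a vector field $u\colon\mathbb{T}^d\to\mathbb{R}^d$. The unique zero-average solution $p\in C^\theta(\mathbb{T}^d)$ of the problem $$-\Delta p=\operatorname{div}\operatorname{div}(u\otimes u)\quad\text{in }\mathbb{T}^d$$ enjoys the following regularity properties, in which the constants $C>0$ are independent of $u$. (a) If $\theta\in(0,\frac12)$ and $\operatorname{div}u\in L^q(\mathbb{T}^d)$ for some $q\in\left[\frac{2d}{1-2\theta},+\infty\right]$, then $p\in C^{2\theta}(\mathbb{T}^d)$ and there exists a constant $C>0$ such that $$\|p\|_{C^{2\theta}(\mathbb{T}^d)}\leq C\left(\|u\|_{C^\theta(\mathbb{T}^d)}^2+\|\operatorname{div}u\|_{L^q(\mathbb{T}^d)}^2\right).$$ (b) If $\theta\in(\frac12,1)$ and $\operatorname{div}u\in C^{2\theta-1}(\mathbb{T}^d)$, then $p\in C^{1,2\theta-1}(\mathbb{T}^d)$ and there exists a constant $C>0$ such that $$\|p\|_{C^{1,2\theta-1}(\mathbb{T}^d)}\leq C\left(\|u\|_{C^\theta(\mathbb{T}^d)}^2+\|\operatorname{div}u\|_{C^{2\theta-1}(\mathbb{T}^d)}^2\right).$$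
   Context: $\mathbb{T}^d$ is the $d$-dimensional flat torus. The equation and $\operatorname{div}u$ are understood in the sense of distributions; $\operatorname{div}\operatorname{div}(u\otimes u)=\sum_{i,j}\partial_i\partial_j(u_iu_j)$; zero-average means $\int_{\mathbb{T}^d}p\,dx=0$. For $\gamma\in(0,1)$, $\|f\|_{C^\gamma}=\sup|f|+\sup_{x\ne y}\frac{|f(x)-f(y)|}{|x-y|^\gamma}$, and $\|f\|_{C^{1,\gamma}}$ is the sum of the sup norms of $f$ and of its first derivatives and the $\gamma$-Hölder seminorms of its first derivatives. *)

theory Defs
  imports "HOL-Analysis.Analysis" "HOL-Probability.Essential_Supremum"
begin

text \<open>
  The flat torus is R^d / Z^d, with d = CARD('n). A function on the torus is represented by its
  Z^d-periodic lift to R^d, and integration over the torus is integration over the unit cube.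
\<close>

definition periodic :: "(real^'n \<Rightarrow> 'b) \<Rightarrow> bool" where
  "periodic f \<longleftrightarrow> (\<forall>x k. (\<forall>i. k $ i \<in> \<int>) \<longrightarrow> f (x + k) = f x)"

definition torus_measure :: "(real^'n) measure" where
  "torus_measure = lebesgue_on (cbox 0 One)"

definition partial :: "'n \<Rightarrow> (real^'n \<Rightarrow> real) \<Rightarrow> real^'n \<Rightarrow> real" where
  "partial i f x = frechet_derivative f (at x) (axis i 1)"


subsection \<open>Hoelder spaces\<close>

text \<open>
  For periodic functions, the supremum over distinct points of R^d below agrees with the
  supremum over distinct points of the torus with its quotient distance: the quotient distance of
  two points is attained by some pair of lifts, and no pair of lifts is closer. The suprema are
  taken in the type of reals, so they are meaningful only on the spaces
  \<open>holder_space\<close> and \<open>C1_holder_space\<close>, where the sets involved are bounded above.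
\<close>

definition holder_space :: "real \<Rightarrow> (real^'n \<Rightarrow> 'b::real_normed_vector) set" where
  "holder_space \<gamma> = {f. periodic f \<and> (\<exists>M. \<forall>x. norm (f x) \<le> M) \<and>
     (\<exists>K. \<forall>x y. x \<noteq> y \<longrightarrow> norm (f x - f y) / norm (x - y) powr \<gamma> \<le> K)}"

definition sup_norm :: "(real^'n \<Rightarrow> 'b::real_normed_vector) \<Rightarrow> real" where
  "sup_norm f = (SUP x. norm (f x))"

definition holder_seminorm :: "real \<Rightarrow> (real^'n \<Rightarrow> 'b::real_normed_vector) \<Rightarrow> real" where
  "holder_seminorm \<gamma> f =
     (SUP (x, y) \<in> {(x, y). x \<noteq> y}. norm (f x - f y) / norm (x - y) powr \<gamma>)"

definition holder_norm :: "real \<Rightarrow> (real^'n \<Rightarrow> 'b::real_normed_vector) \<Rightarrow> real" where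
  "holder_norm \<gamma> f = sup_norm f + holder_seminorm \<gamma> f"

definition C1_holder_space :: "real \<Rightarrow> (real^'n \<Rightarrow> real) set" where
  "C1_holder_space \<gamma> =
     {f. periodic f \<and> f differentiable_on UNIV \<and> (\<forall>i. partial i f \<in> holder_space \<gamma>)}"

definition C1_holder_norm :: "real \<Rightarrow> (real^'n \<Rightarrow> real) \<Rightarrow> real" where
  "C1_holder_norm \<gamma> f =
     sup_norm f + (\<Sum>i\<in>UNIV. sup_norm (partial i f)) + (\<Sum>i\<in>UNIV. holder_seminorm \<gamma> (partial i f))"


subsection \<open>Lebesgue spaces\<close>

definition Lq_space :: "ereal \<Rightarrow> (real^'n \<Rightarrow> real) set" where
  "Lq_space q = {f. periodic f \<and> f \<in> borel_measurable torus_measure \<and>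
     (if q = \<infinity> then esssup torus_measure (\<lambda>x. ereal \<bar>f x\<bar>) < \<infinity>
      else integrable torus_measure (\<lambda>x. \<bar>f x\<bar> powr real_of_ereal q))}"

definition Lq_norm :: "ereal \<Rightarrow> (real^'n \<Rightarrow> real) \<Rightarrow> real" where
  "Lq_norm q f =
     (if q = \<infinity> then real_of_ereal (esssup torus_measure (\<lambda>x. ereal \<bar>f x\<bar>))
      else (\<integral>x. \<bar>f x\<bar> powr real_of_ereal q \<partial>torus_measure) powr (1 / real_of_ereal q))"


subsection \<open>Distributions\<close>

primrec C_k :: "nat \<Rightarrow> (real^'n \<Rightarrow> real) \<Rightarrow> bool" where
  "C_k 0 f \<longleftrightarrow> continuous_on UNIV f"
| "C_k (Suc k) f \<longleftrightarrow> f differentiable_on UNIV \<and> (\<forall>i. C_k k (partial i f))"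

definition test_function :: "(real^'n \<Rightarrow> real) \<Rightarrow> bool" where
  "test_function \<phi> \<longleftrightarrow> periodic \<phi> \<and> (\<forall>k. C_k k \<phi>)"

text \<open>
  A distribution is represented by a functional whose values matter only on test functions;
  equality of distributions is therefore \<open>dist_eq\<close>, not equality of functionals.
\<close>

type_synonym 'n distribution = "(real^'n \<Rightarrow> real) \<Rightarrow> real"

definition dist_eq :: "'n::finite distribution \<Rightarrow> 'n distribution \<Rightarrow> bool" where
  "dist_eq S T \<longleftrightarrow> (\<forall>\<phi>. test_function \<phi> \<longrightarrow> S \<phi> = T \<phi>)"

definition dist_of :: "(real^'n \<Rightarrow> real) \<Rightarrow> 'n::finite distribution" where
  "dist_of f = (\<lambda>\<phi>. \<integral>x. f x * \<phi> x \<partial>torus_measure)"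

definition dist_partial :: "'n \<Rightarrow> 'n::finite distribution \<Rightarrow> 'n distribution" where
  "dist_partial i T = (\<lambda>\<phi>. - T (partial i \<phi>))"

definition dist_div :: "(real^'n \<Rightarrow> real^'n) \<Rightarrow> 'n::finite distribution" where
  "dist_div u = (\<lambda>\<phi>. \<Sum>i\<in>UNIV. dist_partial i (dist_of (\<lambda>x. u x $ i)) \<phi>)"

definition dist_laplacian :: "'n::finite distribution \<Rightarrow> 'n distribution" where
  "dist_laplacian T = (\<lambda>\<phi>. \<Sum>i\<in>UNIV. dist_partial i (dist_partial i T) \<phi>)"

definition dist_div_div_tensor :: "(real^'n \<Rightarrow> real^'n) \<Rightarrow> 'n::finite distribution" where
  "dist_div_div_tensor u =
     (\<lambda>\<phi>. \<Sum>i\<in>UNIV. \<Sum>j\<in>UNIV. dist_partial i (dist_partial j (dist_of (\<lambda>x. u x $ i * u x $ j))) \<phi>)"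

definition has_divergence :: "(real^'n \<Rightarrow> real^'n) \<Rightarrow> (real^'n \<Rightarrow> real) \<Rightarrow> bool" where
  "has_divergence u g \<longleftrightarrow> dist_eq (dist_div u) (dist_of g)"


subsection \<open>The pressure equation\<close>

definition zero_average_solution ::
    "real \<Rightarrow> (real^'n \<Rightarrow> real^'n) \<Rightarrow> (real^'n \<Rightarrow> real) \<Rightarrow> bool" where
  "zero_average_solution \<theta> u p \<longleftrightarrow>
     p \<in> holder_space \<theta> \<and> (\<integral>x. p x \<partial>torus_measure) = 0 \<and>
     dist_eq (\<lambda>\<phi>. - dist_laplacian (dist_of p) \<phi>) (dist_div_div_tensor u)"

end

theory Submission
  imports Defs
begin

text \<open>
  A compactly supported bump plays the role of the heat kernel. If the gradient of \<open>\<Phi>\<close> is \<open>- z * G z\<close> and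
  \<open>f\<^sub>s\<close> denotes convolution of a periodic function with the kernel \<open>f\<close> rescaled to size \<open>s\<close>, then
  \<open>d/ds (G\<^sub>s \<psi>) = s \<Phi>\<^sub>s (\<Delta> \<psi>)\<close>. Integrating over all \<open>s > 0\<close> inverts the Laplacian on mean-free functions, so
  the pressure is, up to the factor \<open>1 / \<integral> G\<close>, the integral over \<open>s > 0\<close> of
  \<open>s\<^sup>-\<^sup>1 \<Sum>\<^sub>i\<^sub>j (\<partial>\<^sub>i \<partial>\<^sub>j \<Phi>)\<^sub>s (u\<^sub>i u\<^sub>j)\<close>. All kernels have mean zero, so large scales are harmless, and a bound
  \<open>s\<^sup>\<alpha>\<close> on the sum at small scales gives \<open>C\<^sup>\<alpha>\<close> regularity of the integral. Hoelder continuity of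
  \<open>u\<^sub>i u\<^sub>j\<close> gives \<open>\<alpha> = \<theta>\<close>. Replacing \<open>u\<close> by \<open>u - u x\<close> in both factors doubles the exponent, and the
  correction terms are convolutions of the divergence of \<open>u\<close>, which the extra hypotheses control.
  Uniqueness and the passage from the weak divergence to pointwise bounds come from testing with
  the peaked trigonometric polynomials \<open>(\<Prod>\<^sub>i (1 + cos (2 \<pi> y\<^sub>i)) / 2)\<^sup>n\<close>.
\<close>

subsection \<open>Functions of class \<open>C_k\<close>\<close>

text \<open>The equation holds only in the sense of distributions and \<open>u\<close> has no
  derivatives, so a derivative never falls on \<open>u\<close>: it sits on a kernel or on a test
  function, and \<open>conv_partial_swap\<close> moves it between the two at the price of one factor
  \<open>s\<close>. Differentiating a convolution thus costs \<open>1 / s\<close>, and every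
  estimate is a count of powers of \<open>s\<close>. The second derivatives of the Green function
  are not integrable at the origin. Spread over scales, the singular integral becomes a family of
  bounded kernels with compact support; the singularity survives only as a power of \<open>s\<close>
  at 0, and the cancellation of the kernels pays for it. The obstacle to the doubled exponent is
  that a product of two components is no smoother than \<open>u\<close>. The product of their
  increments from \<open>x\<close> is of double order at the single point \<open>x\<close> only,
  which is why \<open>conv_Hoelder\<close> asks for a modulus of continuity at one centre. Since the
  final constants must not depend on \<open>u\<close>, the bounds are stated with the constant
  quantified before \<open>u\<close>.\<close>

lemma has_derivative_partial:
  fixes f :: "real^'n \<Rightarrow> real"
  assumes "f differentiable (at x)"
  shows "(f has_derivative (\<lambda>h. \<Sum>i\<in>UNIV. h $ i * partial i f x)) (at x)"
proof -
  let ?D = "frechet_derivative f (at x)"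
  have D: "(f has_derivative ?D) (at x)"
    using assms frechet_derivative_works by blast
  have lin: "linear ?D"
    using D has_derivative_linear by blast
  have "?D h = (\<Sum>i\<in>UNIV. h $ i * partial i f x)" for h
  proof -
    have "?D h = ?D (\<Sum>i\<in>UNIV. h $ i *\<^sub>R axis i 1)"
      using basis_expansion[of h] by (simp add: scalar_mult_eq_scaleR)
    also have "\<dots> = (\<Sum>i\<in>UNIV. h $ i * partial i f x)"
      using lin by (simp add: linear_sum linear_cmul partial_def)
    finally show ?thesis .
  qed
  then show ?thesis using D by (metis (no_types, lifting) ext)
qed

lemma partial_eq:
  "(f has_derivative f') (at x) \<Longrightarrow> partial i f x = f' (axis i 1)"
  unfolding partial_def using frechet_derivative_at by metis

text \<open>\<open>partial\<close> rests on a choice of derivative, so membership in the class is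
  shown by exhibiting a derivative \<open>f'\<close>; by uniqueness its values on the axes are the
  partial derivatives.\<close>

lemma C_k_SucI:
  assumes "\<And>x. (f has_derivative f' x) (at x)" "\<And>i. C_k k (\<lambda>x. f' x (axis i 1))"
  shows "C_k (Suc k) f"
proof -
  have "f differentiable_on UNIV"
    using assms(1) by (auto simp: differentiable_on_def differentiable_def)
  moreover have "partial i f = (\<lambda>x. f' x (axis i 1))" for i
    using assms(1) partial_eq by blast
  ultimately show ?thesis using assms(2) by simp
qed

lemma C_k_Suc_differentiable: "C_k (Suc k) f \<Longrightarrow> f differentiable (at x)"
  by (simp add: differentiable_on_def)

lemma C_k_Suc_has_derivative:
  "C_k (Suc k) f \<Longrightarrow> (f has_derivative (\<lambda>h. \<Sum>i\<in>UNIV. h $ i * partial i f x)) (at x)"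
  by (intro has_derivative_partial C_k_Suc_differentiable)

lemma C_k_partial: "C_k (Suc k) f \<Longrightarrow> C_k k (partial i f)"
  by simp

lemma C_k_Suc_D: "C_k (Suc k) f \<Longrightarrow> C_k k f"
proof (induction k arbitrary: f)
  case 0
  then show ?case by (simp add: differentiable_imp_continuous_on)
next
  case (Suc k)
  then show ?case by (metis C_k.simps(2))
qed

lemma C_k_mono: "C_k m f \<Longrightarrow> k \<le> m \<Longrightarrow> C_k k f"
  by (induction m) (use C_k_Suc_D le_Suc_eq in blast)+

lemma C_k_continuous: "C_k k f \<Longrightarrow> continuous_on UNIV f"
  using C_k_mono[of k f 0] by simp

text \<open>Derivatives are written as sums over coordinates; evaluating such a sum along an axis
  reads off one partial derivative.\<close>

lemma sum_axis: "(\<Sum>j\<in>UNIV. axis i (1::real) $ j * f j) = f i"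
proof -
  have "(\<Sum>j\<in>UNIV. axis i (1::real) $ j * f j) = (\<Sum>j\<in>UNIV. if j = i then f j else 0)"
    by (rule sum.cong) (auto simp: axis_def)
  then show ?thesis by simp
qed

lemma C_k_const: "C_k k (\<lambda>_::real^'n. c)"
proof (induction k arbitrary: c)
  case (Suc k)
  show ?case
    by (rule C_k_SucI[where f' = "\<lambda>_ _. 0"]) (auto intro: Suc)
qed auto

lemma C_k_add: "C_k k f \<Longrightarrow> C_k k g \<Longrightarrow> C_k k (\<lambda>x. f x + g x)"
proof (induction k arbitrary: f g)
  case 0
  then show ?case by (simp add: continuous_on_add)
next
  case (Suc k)
  show ?case
    by (rule C_k_SucI[OF has_derivative_add[OF C_k_Suc_has_derivative C_k_Suc_has_derivative]])
      (use Suc in \<open>auto simp only: sum_axis intro!: Suc.IH C_k_partial\<close>)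
qed

lemma C_k_mult: "C_k k f \<Longrightarrow> C_k k g \<Longrightarrow> C_k k (\<lambda>x. f x * g x)"
proof (induction k arbitrary: f g)
  case 0
  then show ?case by (simp add: continuous_on_mult)
next
  case (Suc k)
  show ?case
    by (rule C_k_SucI[OF has_derivative_mult[OF C_k_Suc_has_derivative C_k_Suc_has_derivative]])
      (use Suc in \<open>auto simp only: sum_axis intro!: Suc.IH C_k_partial C_k_add dest: C_k_Suc_D\<close>)
qed

lemma C_k_cmult: "C_k k f \<Longrightarrow> C_k k (\<lambda>x. c * f x)"
  by (intro C_k_mult C_k_const)

lemma C_k_sum: "(\<And>i. i \<in> I \<Longrightarrow> C_k k (f i)) \<Longrightarrow> C_k k (\<lambda>x. \<Sum>i\<in>I. f i x)"
  by (induction I rule: infinite_finite_induct) (auto intro: C_k_const C_k_add)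

lemma C_k_coord: "C_k k (\<lambda>x. x $ i)"
proof (cases k)
  case 0
  then show ?thesis by (auto intro!: continuous_intros)
next
  case (Suc n)
  show ?thesis unfolding Suc
    by (rule C_k_SucI[where f' = "\<lambda>_ h. h $ i"])
      (auto intro: C_k_const simp: bounded_linear_imp_has_derivative bounded_linear_vec_nth)
qed

text \<open>The derivative is written as a cosine with phase advanced by \<open>pi/2\<close>, so the
  family is closed under differentiation and \<open>C_k_cos\<close> and \<open>laplacian_cos\<close>
  need no sine.\<close>

lemma has_derivative_cos_inner:
  "((\<lambda>y::real^'n. c * cos (a \<bullet> y + b)) has_derivative (\<lambda>h. c * ((a \<bullet> h) * cos (a \<bullet> y + (b + pi/2))))) (at y)"
proof -
  have e: "cos (a \<bullet> y + (b + pi/2)) = - sin (a \<bullet> y + b)"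
    using minus_sin_cos_eq[of "a \<bullet> y + b"] by (simp add: add.assoc)
  have 1: "((\<lambda>y. a \<bullet> y + b) has_derivative (\<lambda>h. a \<bullet> h)) (at y)"
    by (intro has_derivative_add_const bounded_linear_imp_has_derivative bounded_linear_inner_right)
  have "((\<lambda>y. cos (a \<bullet> y + b)) has_derivative (\<lambda>h. (a \<bullet> h) * (- sin (a \<bullet> y + b)))) (at y)"
    by (rule has_derivative_compose[OF 1])
      (rule has_derivative_eq_rhs[OF DERIV_cos[unfolded has_field_derivative_def]], auto simp: fun_eq_iff)
  then show ?thesis unfolding e by (rule has_derivative_mult_right)
qed

lemma C_k_cos: "C_k k (\<lambda>y::real^'n. c * cos (a \<bullet> y + b))"
proof (induction k arbitrary: b c)
  case 0
  then show ?case by (auto intro!: continuous_intros)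
next
  case (Suc k)
  show ?case
    by (rule C_k_SucI[OF has_derivative_cos_inner]) (use Suc in \<open>simp add: mult.assoc[symmetric]\<close>)
qed

subsection \<open>Symmetry of second derivatives\<close>

lemma has_field_derivative_line:
  fixes f :: "real^'n \<Rightarrow> real"
  assumes "C_k (Suc 0) f"
  shows "((\<lambda>t. f (y + t *\<^sub>R axis i 1)) has_field_derivative partial i f (y + t *\<^sub>R axis i 1)) (at t)"
proof -
  have "((\<lambda>t. f (y + t *\<^sub>R axis i 1)) has_derivative
      (\<lambda>s. \<Sum>j\<in>UNIV. (s *\<^sub>R axis i 1) $ j * partial j f (y + t *\<^sub>R axis i 1))) (at t)"
    by (rule has_derivative_compose[OF _ C_k_Suc_has_derivative[OF assms]])
      (auto intro!: derivative_eq_intros)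
  also have "(\<lambda>s. \<Sum>j\<in>UNIV. (s *\<^sub>R axis i 1) $ j * partial j f (y + t *\<^sub>R axis i 1))
      = (*) (partial i f (y + t *\<^sub>R axis i 1))"
    using sum_axis[of i] by (auto simp: sum_distrib_left[symmetric] mult.assoc)
  finally show ?thesis by (simp add: has_field_derivative_def)
qed

lemma partial_mean_value:
  fixes f :: "real^'n \<Rightarrow> real"
  assumes "C_k (Suc 0) f" "h > 0"
  obtains t where "0 < t" "t < h" "f (x + h *\<^sub>R axis i 1) - f x = h * partial i f (x + t *\<^sub>R axis i 1)"
  using MVT2[of 0 h "\<lambda>t. f (x + t *\<^sub>R axis i 1)" "\<lambda>t. partial i f (x + t *\<^sub>R axis i 1)"]
    has_field_derivative_line[OF assms(1), of x i] assms(2) that by auto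

lemma partial_shift:
  assumes "C_k (Suc 0) f"
  shows "((\<lambda>x. f (x + a)) has_derivative (\<lambda>h. \<Sum>i\<in>UNIV. h $ i * partial i f (x + a))) (at x)"
  by (rule has_derivative_compose[OF _ C_k_Suc_has_derivative[OF assms]])
     (auto intro!: derivative_eq_intros)

lemma C_k_shift: "C_k k f \<Longrightarrow> C_k k (\<lambda>x. f (x + a))"
proof (induction k arbitrary: f)
  case 0
  then show ?case
    by (auto intro!: continuous_intros continuous_on_compose2[of UNIV f])
next
  case (Suc k)
  then have 1: "C_k (Suc 0) f" using C_k_mono[of "Suc k" f "Suc 0"] by auto
  show ?case
    by (rule C_k_SucI[OF partial_shift[OF 1]]) (simp only: sum_axis Suc.IH[OF C_k_partial[OF Suc.prems]])
qed

lemma partial_shift_eq: "C_k (Suc 0) f \<Longrightarrow> partial i (\<lambda>x. f (x + a)) x = partial i f (x + a)"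
  using partial_eq[OF partial_shift] by (simp only: sum_axis)

lemma partial_add:
  "C_k (Suc 0) f \<Longrightarrow> C_k (Suc 0) g \<Longrightarrow> partial i (\<lambda>x. f x + g x) x = partial i f x + partial i g x"
  using partial_eq[OF has_derivative_add[OF C_k_Suc_has_derivative C_k_Suc_has_derivative]] by (simp only: sum_axis)

lemma partial_cmult:
  "C_k (Suc 0) f \<Longrightarrow> partial i (\<lambda>x. c * f x) x = c * partial i f x"
  using partial_eq[OF has_derivative_mult_right[OF C_k_Suc_has_derivative]] by (simp only: sum_axis)

lemma partial_sum:
  "(\<And>j. j \<in> J \<Longrightarrow> C_k (Suc 0) (f j)) \<Longrightarrow> partial i (\<lambda>x. \<Sum>j\<in>J. f j x) x = (\<Sum>j\<in>J. partial i (f j) x)"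
  by (subst partial_eq[OF has_derivative_sum[OF C_k_Suc_has_derivative]]) (simp_all only: sum_axis)

text \<open>The second difference is a first difference in direction \<open>i\<close> of a first
  difference in direction \<open>j\<close>; the mean value theorem is applied to each in
  turn.\<close>

lemma mixed_difference:
  fixes f :: "real^'n \<Rightarrow> real"
  assumes f: "C_k 2 f" and h: "h > 0"
  obtains s t where "0 < s" "s < h" "0 < t" "t < h"
    "f (x + h *\<^sub>R axis i 1 + h *\<^sub>R axis j 1) - f (x + h *\<^sub>R axis i 1) - f (x + h *\<^sub>R axis j 1) + f x
      = h * h * partial j (partial i f) (x + s *\<^sub>R axis i 1 + t *\<^sub>R axis j 1)"
proof -
  have f1: "C_k (Suc 0) f" and f2: "C_k (Suc 0) (partial i f)"
    using f C_k_mono[of 2 f "Suc 0"] C_k_partial[of 1 f i] by (auto simp: numeral_2_eq_2)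
  define g where "g = (\<lambda>x. f (x + h *\<^sub>R axis j 1) + (-1) * f x)"
  have g: "C_k (Suc 0) g"
    unfolding g_def by (intro C_k_add C_k_cmult C_k_shift f1)
  have pg: "partial i g y = partial i f (y + h *\<^sub>R axis j 1) - partial i f y" for y
    unfolding g_def
    using partial_add[OF C_k_shift[OF f1] C_k_cmult[OF f1], of i "h *\<^sub>R axis j 1" "-1" y]
      partial_cmult[OF f1, of i "-1" y] partial_shift_eq[OF f1, of i "h *\<^sub>R axis j 1" y] by simp
  obtain s where s: "0 < s" "s < h" "g (x + h *\<^sub>R axis i 1) - g x = h * partial i g (x + s *\<^sub>R axis i 1)"
    using partial_mean_value[OF g h] by blast
  obtain t where t: "0 < t" "t < h" "partial i f ((x + s *\<^sub>R axis i 1) + h *\<^sub>R axis j 1) - partial i f (x + s *\<^sub>R axis i 1)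
     = h * partial j (partial i f) ((x + s *\<^sub>R axis i 1) + t *\<^sub>R axis j 1)"
    using partial_mean_value[OF f2 h] by blast
  show ?thesis
  proof (rule that[OF s(1,2) t(1,2)])
    have "f (x + h *\<^sub>R axis i 1 + h *\<^sub>R axis j 1) - f (x + h *\<^sub>R axis i 1) - f (x + h *\<^sub>R axis j 1) + f x
      = g (x + h *\<^sub>R axis i 1) - g x" by (simp add: g_def)
    also have "\<dots> = h * h * partial j (partial i f) (x + s *\<^sub>R axis i 1 + t *\<^sub>R axis j 1)"
      using s(3) t(3) pg by simp
    finally show "f (x + h *\<^sub>R axis i 1 + h *\<^sub>R axis j 1) - f (x + h *\<^sub>R axis i 1) - f (x + h *\<^sub>R axis j 1) + f x
      = h * h * partial j (partial i f) (x + s *\<^sub>R axis i 1 + t *\<^sub>R axis j 1)" .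
  qed
qed

text \<open>The second difference does not depend on the order of \<open>i\<close> and
  \<open>j\<close>. Hence the two mixed derivatives take equal values at suitable points, one for
  each, arbitrarily near \<open>x\<close>, and continuity forces equality at
  \<open>x\<close>.\<close>

lemma partial_commute:
  fixes f :: "real^'n \<Rightarrow> real"
  assumes f: "C_k 2 f"
  shows "partial i (partial j f) x = partial j (partial i f) x"
proof (rule ccontr)
  assume ne: "partial i (partial j f) x \<noteq> partial j (partial i f) x"
  define e where "e = \<bar>partial i (partial j f) x - partial j (partial i f) x\<bar> / 2"
  have e: "e > 0" using ne by (simp add: e_def)
  have c: "continuous_on UNIV (partial a (partial b f))" for a b
    using f by (simp add: numeral_2_eq_2)
  have "\<exists>d>0. \<forall>y. dist y x < d \<longrightarrow> dist (partial a (partial b f) y) (partial a (partial b f) x) < e" for a b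
    using c[of a b] e by (metis UNIV_I continuous_on_iff)
  then obtain d1 d2 where d: "d1 > 0" "d2 > 0"
     "\<And>y. dist y x < d1 \<Longrightarrow> dist (partial i (partial j f) y) (partial i (partial j f) x) < e"
     "\<And>y. dist y x < d2 \<Longrightarrow> dist (partial j (partial i f) y) (partial j (partial i f) x) < e" by metis
  \<comment> \<open>Two displacements along axes, each shorter than \<open>h\<close>, stay within
    \<open>min d1 d2\<close> of \<open>x\<close>.\<close>
  define h where "h = min d1 d2 / 2"
  have h: "h > 0" using d by (simp add: h_def)
  have near: "dist (x + s *\<^sub>R axis a 1 + t *\<^sub>R axis b 1) x < min d1 d2" if "0 < s" "s < h" "0 < t" "t < h" for s t a b
  proof -
    have "dist (x + s *\<^sub>R axis a 1 + t *\<^sub>R axis b 1) x = norm (s *\<^sub>R axis a (1::real) + t *\<^sub>R axis b 1)"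
      by (simp add: dist_norm)
    also have "\<dots> \<le> \<bar>s\<bar> + \<bar>t\<bar>"
      by (rule order_trans[OF norm_triangle_ineq]) (simp add: norm_axis_1)
    also have "\<dots> < min d1 d2" using that by (simp add: h_def)
    finally show ?thesis .
  qed
  obtain s t where 1: "0 < s" "s < h" "0 < t" "t < h"
    "f (x + h *\<^sub>R axis i 1 + h *\<^sub>R axis j 1) - f (x + h *\<^sub>R axis i 1) - f (x + h *\<^sub>R axis j 1) + f x
      = h * h * partial j (partial i f) (x + s *\<^sub>R axis i 1 + t *\<^sub>R axis j 1)"
    using mixed_difference[OF f h] by blast
  obtain s' t' where 2: "0 < s'" "s' < h" "0 < t'" "t' < h"
    "f (x + h *\<^sub>R axis j 1 + h *\<^sub>R axis i 1) - f (x + h *\<^sub>R axis j 1) - f (x + h *\<^sub>R axis i 1) + f x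
      = h * h * partial i (partial j f) (x + s' *\<^sub>R axis j 1 + t' *\<^sub>R axis i 1)"
    using mixed_difference[OF f h] by blast
  have c: "x + h *\<^sub>R axis j 1 + h *\<^sub>R axis i 1 = x + h *\<^sub>R axis i 1 + h *\<^sub>R axis j 1"
    by (simp add: algebra_simps)
  have "h * h * partial j (partial i f) (x + s *\<^sub>R axis i 1 + t *\<^sub>R axis j 1)
     = h * h * partial i (partial j f) (x + s' *\<^sub>R axis j 1 + t' *\<^sub>R axis i 1)"
    using 1(5) 2(5)[unfolded c] by linarith
  then have "partial j (partial i f) (x + s *\<^sub>R axis i 1 + t *\<^sub>R axis j 1)
     = partial i (partial j f) (x + s' *\<^sub>R axis j 1 + t' *\<^sub>R axis i 1)" using h by simp
  moreover have "dist (partial j (partial i f) (x + s *\<^sub>R axis i 1 + t *\<^sub>R axis j 1)) (partial j (partial i f) x) < e"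
    using near[OF 1(1-4)] by (intro d) simp
  moreover have "dist (partial i (partial j f) (x + s' *\<^sub>R axis j 1 + t' *\<^sub>R axis i 1)) (partial i (partial j f) x) < e"
    using near[OF 2(1-4)] by (intro d) simp
  ultimately show False
    unfolding e_def dist_real_def by (smt (verit) field_sum_of_halves)
qed

text \<open>The mean value inequality; bounding each component by the norm separately produces the
  factor \<open>CARD('n)\<close>.\<close>

lemma Lipschitz_partial:
  fixes f :: "real^'n \<Rightarrow> real" and B :: real
  assumes f: "C_k (Suc 0) f" and B: "\<And>i x. \<bar>partial i f x\<bar> \<le> (B::real)"
  shows "\<bar>f x - f y\<bar> \<le> CARD('n) * B * norm (x - y)"
proof -
  have "norm (f x - f y) \<le> (CARD('n) * B) * norm (x - y)"
  proof (rule differentiable_bound[of UNIV f])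
    fix z show "(f has_derivative (\<lambda>h. \<Sum>i\<in>UNIV. h $ i * partial i f z)) (at z within UNIV)"
      using C_k_Suc_has_derivative[OF f] by simp
    show "onorm (\<lambda>h. \<Sum>i\<in>UNIV. h $ i * partial i f z) \<le> CARD('n) * B"
    proof (rule onorm_le)
      fix h :: "real^'n"
      have "norm (\<Sum>i\<in>UNIV. h $ i * partial i f z) \<le> (\<Sum>i\<in>(UNIV::'n set). norm h * B)"
        by (rule sum_norm_le)
           (use B component_le_norm_cart in \<open>auto simp: abs_mult intro!: mult_mono\<close>)
      then show "norm (\<Sum>i\<in>UNIV. h $ i * partial i f z) \<le> CARD('n) * B * norm h" by (simp add: algebra_simps)
    qed
  qed auto
  then show ?thesis by simp
qed

subsection \<open>Periodic continuous functions\<close>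

definition pcont :: "(real^'n \<Rightarrow> real) \<Rightarrow> bool" where
  "pcont f \<longleftrightarrow> periodic f \<and> continuous_on UNIV f"

text \<open>The Borel counterpart of \<open>torus_measure\<close>, which is built on the completed
  measure. Continuous functions are integrated with respect to this one, where Borel measurability
  and Fubini apply directly.\<close>

definition cube_measure :: "(real^'n) measure" where
  "cube_measure = restrict_space lborel (cbox 0 One)"

lemma periodicI: "(\<And>x k. (\<And>i. k $ i \<in> \<int>) \<Longrightarrow> f (x + k) = f x) \<Longrightarrow> periodic f"
  by (auto simp: periodic_def)

lemma periodicD: "periodic f \<Longrightarrow> (\<And>i. k $ i \<in> \<int>) \<Longrightarrow> f (x + k) = f x"
  by (auto simp: periodic_def)

lemma pcontD: "pcont f \<Longrightarrow> periodic f" "pcont f \<Longrightarrow> continuous_on UNIV f"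
  by (auto simp: pcont_def)

lemma pcont_measurable [measurable_dest]: "pcont f \<Longrightarrow> f \<in> borel_measurable borel"
  by (auto simp: pcont_def intro: borel_measurable_continuous_onI)

lemma One_inner: "b \<in> Basis \<Longrightarrow> (One :: 'a::euclidean_space) \<bullet> b = 1"
  by (simp add: inner_sum_left inner_Basis)

lemma One_nth: "(One :: real^'n) $ i = 1"
proof -
  have "(One :: real^'n) $ i = One \<bullet> axis i (1::real)" by (rule cart_eq_inner_axis)
  also have "\<dots> = 1" by (rule One_inner) (auto simp: Basis_vec_def)
  finally show ?thesis .
qed

lemma sum_Basis_nth [simp]: "(\<Sum>b\<in>Basis. (b :: real^'n) $ i) = 1"
  using One_nth[of i] by (simp only: sum_component)

lemma mem_cube: "x \<in> cbox 0 (One :: real^'n) \<longleftrightarrow> (\<forall>i. 0 \<le> x $ i \<and> x $ i \<le> 1)"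
  by (simp add: mem_box_cart One_nth)

lemma ex_cube_shift:
  obtains k :: "real^'n" where "\<And>i. k $ i \<in> \<int>" "x + k \<in> cbox 0 One"
proof (rule that[of "\<chi> i. - of_int \<lfloor>x $ i\<rfloor>"])
  show "x + (\<chi> i. - of_int \<lfloor>x $ i\<rfloor>) \<in> cbox 0 One"
    unfolding mem_cube by (auto simp: le_diff_eq) linarith
qed auto

lemma pcont_bounded:
  assumes "pcont (f :: real^'n \<Rightarrow> real)"
  obtains B where "B \<ge> 0" "\<And>x. \<bar>f x\<bar> \<le> B"
proof -
  have "bounded (f ` cbox 0 One)"
    using assms by (auto simp: pcont_def intro!: compact_imp_bounded compact_continuous_image
        continuous_on_subset[of UNIV f])
  then obtain B where B: "\<And>x. x \<in> cbox 0 One \<Longrightarrow> \<bar>f x\<bar> \<le> B"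
    unfolding bounded_iff by auto
  have "\<bar>f x\<bar> \<le> B" for x
  proof -
    obtain k :: "real^'n" where "\<And>i. k $ i \<in> \<int>" "x + k \<in> cbox 0 One" using ex_cube_shift[of x] by metis
    then show ?thesis using B[of "x + k"] periodicD[of f k x] assms by (auto simp: pcont_def)
  qed
  then show ?thesis using that[of B] abs_ge_zero[of "f 0"] order_trans by blast
qed

lemma pcont_const: "pcont (\<lambda>_. c)"
  by (auto simp: pcont_def periodic_def)

lemma pcont_add: "pcont f \<Longrightarrow> pcont g \<Longrightarrow> pcont (\<lambda>x. f x + g x)"
  by (auto simp: pcont_def periodic_def intro!: continuous_intros)

lemma pcont_diff: "pcont f \<Longrightarrow> pcont g \<Longrightarrow> pcont (\<lambda>x. f x - g x)"
  by (auto simp: pcont_def periodic_def intro!: continuous_intros)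

lemma pcont_mult: "pcont f \<Longrightarrow> pcont g \<Longrightarrow> pcont (\<lambda>x. f x * g x)"
  by (auto simp: pcont_def periodic_def intro!: continuous_intros)

lemma pcont_abs: "pcont f \<Longrightarrow> pcont (\<lambda>x. \<bar>f x\<bar>)"
  by (auto simp: pcont_def periodic_def intro!: continuous_intros)

lemma pcont_sum: "(\<And>i. i \<in> I \<Longrightarrow> pcont (f i)) \<Longrightarrow> pcont (\<lambda>x. \<Sum>i\<in>I. f i x)"
  by (auto simp: pcont_def periodic_def intro!: continuous_intros)

lemma pcont_shift: "pcont f \<Longrightarrow> pcont (\<lambda>x. f (x + a))"
proof -
  assume f: "pcont f"
  have "f (x + k + a) = f (x + a)" if "\<And>i. k $ i \<in> \<int>" for x k
    using periodicD[of f k "x + a"] f that by (auto simp: pcont_def algebra_simps)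
  then show ?thesis using f
    by (auto simp: pcont_def periodic_def intro!: continuous_intros continuous_on_compose2[of UNIV f])
qed

lemma pcont_reflect: "pcont f \<Longrightarrow> pcont (\<lambda>x. f (a - x))"
proof -
  assume f: "pcont f"
  have "f (a - (x + k)) = f (a - x)" if "\<And>i. k $ i \<in> \<int>" for x k
    using periodicD[of f "-k" "a - x"] f that by (auto simp: pcont_def algebra_simps)
  then show ?thesis using f
    by (auto simp: pcont_def periodic_def intro!: continuous_intros continuous_on_compose2[of UNIV f])
qed

section \<open>Integration over the unit cube and its translation invariance\<close>

lemma space_cube_measure [simp]: "space cube_measure = cbox 0 One"
  by (simp add: cube_measure_def space_restrict_space)

lemma measurable_cube_measure [measurable]:
  "f \<in> borel_measurable borel \<Longrightarrow> f \<in> borel_measurable cube_measure"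
  unfolding cube_measure_def by (intro measurable_restrict_space1) simp

lemma emeasure_cube: "emeasure (cube_measure :: (real^'n) measure) (cbox 0 One) = 1"
proof -
  have "emeasure (cube_measure :: (real^'n) measure) (cbox 0 One) = emeasure lborel (cbox 0 (One :: real^'n))"
    unfolding cube_measure_def by (subst emeasure_restrict_space) auto
  also have "\<dots> = 1" by (subst emeasure_lborel_cbox_eq) (auto simp: One_inner prod.neutral)
  finally show ?thesis .
qed

interpretation cube: finite_measure "cube_measure :: (real^'n) measure"
  by (rule finite_measureI) (simp add: emeasure_cube)

lemma measure_cube [simp]: "measure cube_measure (cbox 0 One) = 1"
  by (simp add: measure_def emeasure_cube)

lemma integral_torus_measure:
  assumes [measurable]: "(f :: real^'n \<Rightarrow> real) \<in> borel_measurable borel"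
  shows "integral\<^sup>L torus_measure f = integral\<^sup>L cube_measure f"
proof -
  have 1: "cbox 0 (One :: real^'n) \<inter> space lebesgue \<in> sets lebesgue"
    using fmeasurableD[OF lmeasurable_cbox[of 0 "One :: real^'n"]] by (simp only: space_completion space_lborel space_borel Int_UNIV_right)
  have 2: "cbox 0 (One :: real^'n) \<inter> space lborel \<in> sets lborel"
    by (simp only: space_lborel space_borel Int_UNIV_right sets_lborel cbox_borel)
  have 3: "(\<lambda>x. indicator (cbox 0 One) x *\<^sub>R f x) \<in> borel_measurable lborel"
    by (intro borel_measurable_scaleR borel_measurable_indicator) (simp_all only: sets_lborel cbox_borel measurable_lborel1 measurable_lborel2 assms)
  show ?thesis
    unfolding torus_measure_def cube_measure_def integral_restrict_space[OF 1] integral_restrict_space[OF 2]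
    by (rule integral_completion[OF 3])
qed

lemma integrable_cube:
  assumes "continuous_on UNIV (f :: real^'n \<Rightarrow> real)"
  shows "integrable cube_measure f"
proof -
  have "integrable lborel (\<lambda>x. indicator (cbox 0 One) x *\<^sub>R f x)"
    using assms by (intro borel_integrable_compact) (auto intro: continuous_on_subset)
  then show ?thesis unfolding cube_measure_def by (subst integrable_restrict_space) auto
qed

lemma integrable_cube_pcont: "pcont f \<Longrightarrow> integrable cube_measure f"
  by (simp add: integrable_cube pcontD)

lemma integral_cube_HK:
  assumes "continuous_on UNIV (f :: real^'n \<Rightarrow> real)"
  shows "integral\<^sup>L cube_measure f = integral (cbox 0 One) f"
proof -
  have "set_integrable lborel (cbox 0 One) f"
    using assms unfolding set_integrable_def
    by (intro borel_integrable_compact) (auto intro: continuous_on_subset)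
  note set_borel_integral_eq_integral(2)[OF this]
  then show ?thesis unfolding cube_measure_def set_lebesgue_integral_def
    by (subst integral_restrict_space) auto
qed

lemma integral_torus_pcont: "pcont f \<Longrightarrow> integral\<^sup>L torus_measure f = integral\<^sup>L cube_measure f"
  by (intro integral_torus_measure pcont_measurable)

lemma integral_cbox_translate:
  fixes f :: "'a::euclidean_space \<Rightarrow> real"
  shows "integral (cbox (a + c) (b + c)) f = integral (cbox a b) (\<lambda>x. f (x + c))"
  using integral_shift_cbox_plus[of a b f c] by (simp add: o_def add.commute)

text \<open>Cut the shifted cube where coordinate \<open>i\<close> equals 1; the protruding slab,
  moved back by one period, fills the gap left by the shift.\<close>

lemma integral_cube_shift_axis:
  fixes f :: "real^'n \<Rightarrow> real"
  assumes f: "pcont f" and t: "0 \<le> t" "t \<le> 1"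
  shows "integral (cbox 0 One) (\<lambda>x. f (x + t *\<^sub>R axis i 1)) = integral (cbox 0 One) f"
proof -
  \<comment> \<open>Lower and upper corners of boxes that differ from the unit cube only in
    coordinate \<open>i\<close>.\<close>
  define A B :: "real \<Rightarrow> real^'n" where "A = (\<lambda>t. \<chi> j. if j = i then t else 0)"
    and "B = (\<lambda>t. \<chi> j. if j = i then t else 1)"
  have int: "f integrable_on cbox a b" for a b
    using f by (auto intro!: integrable_continuous continuous_on_subset[of UNIV] simp: pcont_def)
  have basis: "axis i (1::real) \<in> Basis" by (simp add: axis_in_Basis_iff)
  have spl: "integral (cbox a b) f = integral (cbox a (\<chi> j. if j = i then min (b $ i) c else b $ j)) f
     + integral (cbox (\<chi> j. if j = i then max (a $ i) c else a $ j) b) f" for a b c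
    using integral_split[OF int basis, of a b c] interval_split_cart(1)[where a=a and b=b and k=i and c=c]
      interval_split_cart(2)[where a=a and b=b and k=i and c=c]
    by (simp add: inner_axis interval_cbox_cart)
  have "integral (cbox 0 One) (\<lambda>x. f (x + t *\<^sub>R axis i 1)) = integral (cbox (0 + t *\<^sub>R axis i 1) (One + t *\<^sub>R axis i 1)) f"
    by (rule integral_cbox_translate[symmetric])
  also have "0 + t *\<^sub>R axis i 1 = A t" by (simp add: A_def vec_eq_iff axis_def)
  also have "One + t *\<^sub>R axis i 1 = B (1 + t)" by (simp add: B_def vec_eq_iff axis_def One_nth)
  also have "integral (cbox (A t) (B (1 + t))) f = integral (cbox (A t) One) f + integral (cbox (A 1) (B (1 + t))) f"
  proof -
    have "(\<chi> j. if j = i then min (B (1 + t) $ i) 1 else B (1 + t) $ j) = One"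
      "(\<chi> j. if j = i then max (A t $ i) 1 else A t $ j) = A 1"
      using t by (auto simp: A_def B_def vec_eq_iff One_nth)
    then show ?thesis using spl[of "A t" "B (1 + t)" 1] by simp
  qed
  also have "integral (cbox (A 1) (B (1 + t))) f = integral (cbox 0 (B t)) (\<lambda>x. f (x + axis i 1))"
  proof -
    have "A 1 = 0 + axis i 1" "B (1 + t) = B t + axis i 1" by (auto simp: A_def B_def vec_eq_iff axis_def)
    then show ?thesis by (metis integral_cbox_translate)
  qed
  also have "(\<lambda>x. f (x + axis i 1)) = f"
    using f by (auto simp: pcont_def periodic_def axis_def fun_eq_iff)
  also have "integral (cbox (A t) One) f + integral (cbox 0 (B t)) f = integral (cbox 0 One) f"
  proof -
    have "(\<chi> j. if j = i then min ((One::real^'n) $ i) t else (One::real^'n) $ j) = B t"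
      "(\<chi> j. if j = i then max ((0::real^'n) $ i) t else (0::real^'n) $ j) = A t"
      using t by (auto simp: A_def B_def vec_eq_iff One_nth)
    then show ?thesis using spl[of 0 One t] by simp
  qed
  finally show ?thesis .
qed

text \<open>A shift is composed of shifts along the axes, and by periodicity each of these may be
  reduced to its fractional part.\<close>

lemma integral_cube_shift:
  fixes f :: "real^'n \<Rightarrow> real"
  assumes f: "pcont f"
  shows "(\<integral>x. f (x + a) \<partial>cube_measure) = (\<integral>x. f x \<partial>cube_measure)"
proof -
  have c: "continuous_on UNIV (\<lambda>x. f (x + b))" for b
    using pcont_shift[OF f] pcontD by blast
  have axis: "integral (cbox 0 One) (\<lambda>x. f (x + b + t *\<^sub>R axis i 1)) = integral (cbox 0 One) (\<lambda>x. f (x + b))" for t b i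
  proof -
    define g where "g = (\<lambda>x. f (x + b))"
    have g: "pcont g" unfolding g_def by (rule pcont_shift[OF f])
    have "g (x + t *\<^sub>R axis i 1) = g (x + frac t *\<^sub>R axis i 1)" for x
    proof -
      have "x + t *\<^sub>R axis i 1 = x + frac t *\<^sub>R axis i 1 + of_int \<lfloor>t\<rfloor> *\<^sub>R axis i 1"
        by (simp add: frac_def algebra_simps)
      moreover have "g (x + frac t *\<^sub>R axis i 1 + of_int \<lfloor>t\<rfloor> *\<^sub>R axis i 1) = g (x + frac t *\<^sub>R axis i 1)"
        by (rule periodicD[OF pcontD(1)[OF g]]) (auto simp: axis_def)
      ultimately show ?thesis by (simp only:)
    qed
    then have "integral (cbox 0 One) (\<lambda>x. g (x + t *\<^sub>R axis i 1)) = integral (cbox 0 One) g"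
      using integral_cube_shift_axis[OF g, of "frac t" i] frac_lt_1[of t] by simp
    then show ?thesis by (simp add: g_def algebra_simps)
  qed
  have "integral (cbox 0 One) (\<lambda>x. f (x + (\<Sum>i\<in>I. a $ i *\<^sub>R axis i 1))) = integral (cbox 0 One) f" for I
  proof (induction I rule: infinite_finite_induct)
    case (insert j I)
    then show ?case using axis[of "\<Sum>i\<in>I. a $ i *\<^sub>R axis i 1" "a $ j" j] by (simp add: algebra_simps)
  qed auto
  from this[of UNIV] show ?thesis
    using basis_expansion[of a] c[of a] c[of 0] by (simp add: scalar_mult_eq_scaleR integral_cube_HK)
qed

text \<open>For the translate \<open>g\<close> of \<open>f\<close> by \<open>a - One\<close> the
  reflection becomes the one that sends \<open>x\<close> to \<open>One - x\<close>, which preserves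
  the cube.\<close>

lemma integral_cube_reflect:
  fixes f :: "real^'n \<Rightarrow> real"
  assumes f: "pcont f"
  shows "(\<integral>x. f (a - x) \<partial>cube_measure) = (\<integral>x. f x \<partial>cube_measure)"
proof -
  define g where "g = (\<lambda>x. f (x + (a - One)))"
  have g: "pcont g" unfolding g_def by (rule pcont_shift[OF f])
  have "(\<integral>x. f (a - x) \<partial>cube_measure) = integral (cbox 0 One) (\<lambda>x. g (One - x))"
    using pcontD(2)[OF pcont_reflect[OF f]] by (simp add: g_def integral_cube_HK)
  also have "\<dots> = integral (cbox 0 One) (\<lambda>x. (\<lambda>y. g (- y)) (x + (- One)))" by simp
  also have "\<dots> = integral (cbox (0 + (- One)) (One + (- One))) (\<lambda>y. g (- y))"
    by (rule integral_cbox_translate[symmetric])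
  also have "\<dots> = integral (cbox 0 One) g"
    using integral_reflect[of One 0 g] by simp
  also have "\<dots> = (\<integral>x. f x \<partial>cube_measure)"
    using integral_cube_shift[OF f, of "a - One"] pcontD(2)[OF g] by (simp add: integral_cube_HK g_def)
  finally show ?thesis .
qed

subsection \<open>Test functions and trigonometric polynomials\<close>

lemma test_functionD:
  "test_function f \<Longrightarrow> periodic f" "test_function f \<Longrightarrow> C_k k f"
  by (auto simp: test_function_def)

lemma test_function_pcont: "test_function f \<Longrightarrow> pcont f"
  by (auto simp: test_function_def pcont_def intro: C_k_continuous)

lemma periodic_partial:
  fixes f :: "real^'n \<Rightarrow> real"
  assumes "periodic f" "C_k (Suc 0) f"
  shows "periodic (partial i f)"
proof (rule periodicI)
  fix x k :: "real^'n" assume k: "\<And>i. k $ i \<in> \<int>"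
  have "(\<lambda>x. f (x + k)) = f" using periodicD[OF assms(1) k] by auto
  then show "partial i f (x + k) = partial i f x"
    using partial_shift_eq[OF assms(2), of i k x] by simp
qed

lemma test_function_partial: "test_function f \<Longrightarrow> test_function (partial i f)"
  unfolding test_function_def using periodic_partial[of f i] C_k_partial by blast

lemma test_function_add: "test_function f \<Longrightarrow> test_function g \<Longrightarrow> test_function (\<lambda>x. f x + g x)"
  by (auto simp: test_function_def periodic_def intro: C_k_add)

lemma test_function_sum: "(\<And>i. i \<in> I \<Longrightarrow> test_function (f i)) \<Longrightarrow> test_function (\<lambda>x. \<Sum>i\<in>I. f i x)"
  by (auto simp: test_function_def periodic_def intro!: C_k_sum sum.cong)

lemma test_function_cmult: "test_function f \<Longrightarrow> test_function (\<lambda>x. c * f x)"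
  by (auto simp: test_function_def periodic_def intro: C_k_cmult)

text \<open>The phase \<open>b\<close> covers sines and the frequency 0 covers constants, so sums of
  cosines alone are closed under products.\<close>

inductive trig_poly :: "(real^'n \<Rightarrow> real) \<Rightarrow> bool" where
  trig_poly_cos: "(\<And>i. a $ i \<in> \<int>) \<Longrightarrow> trig_poly (\<lambda>y. c * cos (((2 * pi) *\<^sub>R a) \<bullet> y + b))"
| trig_poly_add: "trig_poly f \<Longrightarrow> trig_poly g \<Longrightarrow> trig_poly (\<lambda>y. f y + g y)"

lemma trig_poly_const: "trig_poly (\<lambda>_. c)"
  using trig_poly_cos[of 0 c 0] by simp

lemma periodic_cos:
  fixes a :: "real^'n"
  assumes "\<And>i. a $ i \<in> \<int>"
  shows "periodic (\<lambda>y. c * cos (((2 * pi) *\<^sub>R a) \<bullet> y + b))"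
proof (rule periodicI)
  fix x k :: "real^'n" assume k: "\<And>i. k $ i \<in> \<int>"
  have "a \<bullet> k \<in> \<int>" unfolding inner_vec_def using assms k by (auto intro!: Ints_sum Ints_mult)
  then obtain m where m: "a \<bullet> k = of_int m" by (auto elim: Ints_cases)
  have "((2 * pi) *\<^sub>R a) \<bullet> (x + k) + b = (((2 * pi) *\<^sub>R a) \<bullet> x + b) + 2 * pi * of_int m"
    by (simp add: inner_add_right m algebra_simps)
  then show "c * cos (((2 * pi) *\<^sub>R a) \<bullet> (x + k) + b) = c * cos (((2 * pi) *\<^sub>R a) \<bullet> x + b)"
    using cos.plus_of_int[of "((2 * pi) *\<^sub>R a) \<bullet> x + b" m] by (simp add: algebra_simps)
qed

lemma trig_poly_test: "trig_poly f \<Longrightarrow> test_function f"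
proof (induction rule: trig_poly.induct)
  case (trig_poly_cos a c b)
  show ?case unfolding test_function_def
    using periodic_cos[OF trig_poly_cos, of c b] C_k_cos[of _ c "(2 * pi) *\<^sub>R a" b] by blast
qed (rule test_function_add)

text \<open>The product-to-sum formula, whose frequencies are the difference and the sum of two
  integer vectors.\<close>

lemma trig_poly_mult:
  assumes "trig_poly f" "trig_poly g"
  shows "trig_poly (\<lambda>y. f y * g y)"
  using assms(2)
proof (induction rule: trig_poly.induct)
  case (trig_poly_cos a' c' b')
  from assms(1) show ?case
  proof (induction rule: trig_poly.induct)
    case (trig_poly_cos a c b)
    have "(\<lambda>y. c * cos (((2 * pi) *\<^sub>R a) \<bullet> y + b) * (c' * cos (((2 * pi) *\<^sub>R a') \<bullet> y + b')))
      = (\<lambda>y. (c * c' / 2) * cos (((2 * pi) *\<^sub>R (a - a')) \<bullet> y + (b - b')) + (c * c' / 2) * cos (((2 * pi) *\<^sub>R (a + a')) \<bullet> y + (b + b')))"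
    proof
      fix y
      have "((2 * pi) *\<^sub>R (a - a')) \<bullet> y + (b - b') = (((2 * pi) *\<^sub>R a) \<bullet> y + b) - (((2 * pi) *\<^sub>R a') \<bullet> y + b')"
        "((2 * pi) *\<^sub>R (a + a')) \<bullet> y + (b + b') = (((2 * pi) *\<^sub>R a) \<bullet> y + b) + (((2 * pi) *\<^sub>R a') \<bullet> y + b')"
        by (simp_all add: inner_simps algebra_simps)
      then show "c * cos (((2 * pi) *\<^sub>R a) \<bullet> y + b) * (c' * cos (((2 * pi) *\<^sub>R a') \<bullet> y + b')) = (c * c' / 2) * cos (((2 * pi) *\<^sub>R (a - a')) \<bullet> y + (b - b')) + (c * c' / 2) * cos (((2 * pi) *\<^sub>R (a + a')) \<bullet> y + (b + b'))"
        by (simp only: cos_add cos_diff) (simp add: algebra_simps)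
    qed
    moreover have "trig_poly (\<lambda>y. (c * c' / 2) * cos (((2 * pi) *\<^sub>R (a - a')) \<bullet> y + (b - b')) + (c * c' / 2) * cos (((2 * pi) *\<^sub>R (a + a')) \<bullet> y + (b + b')))"
      using trig_poly_cos \<open>\<And>i. a' $ i \<in> \<int>\<close> by (intro trig_poly.intros) auto
    ultimately show ?case by (simp only:)
  next
    case (trig_poly_add f g)
    then show ?case by (simp add: distrib_right trig_poly.trig_poly_add)
  qed
next
  case (trig_poly_add f g)
  then show ?case by (simp add: distrib_left trig_poly.trig_poly_add)
qed

lemma trig_poly_prod: "finite I \<Longrightarrow> (\<And>i. i \<in> I \<Longrightarrow> trig_poly (f i)) \<Longrightarrow> trig_poly (\<lambda>x. \<Prod>i\<in>I. f i x)"
  by (induction I rule: finite_induct) (auto intro: trig_poly_const trig_poly_mult)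

lemma trig_poly_power: "trig_poly f \<Longrightarrow> trig_poly (\<lambda>x. f x ^ n)"
  by (induction n) (auto intro: trig_poly_const trig_poly_mult)

text \<open>Each factor is the square of \<open>cos (pi * y $ i)\<close>, so the product lies
  between 0 and 1 and equals 1 exactly at the lattice points.\<close>

definition peak :: "real^'n \<Rightarrow> real" where
  "peak y = (\<Prod>i\<in>UNIV. (1 + cos (2 * pi * y $ i)) / 2)"

lemma trig_poly_peak: "trig_poly (\<lambda>y::real^'n. peak (y - x) ^ n)"
proof -
  have "trig_poly (\<lambda>y::real^'n. 1 / 2 + 1 / 2 * cos (((2 * pi) *\<^sub>R axis i 1) \<bullet> y + (- 2 * pi * x $ i)))" for i
    by (intro trig_poly.intros trig_poly_const) (auto simp: axis_def)
  also have "(\<lambda>y::real^'n. 1 / 2 + 1 / 2 * cos (((2 * pi) *\<^sub>R axis i 1) \<bullet> y + (- 2 * pi * x $ i))) =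
     (\<lambda>y. (1 + cos (2 * pi * (y - x) $ i)) / 2)" for i
    by (auto simp: fun_eq_iff inner_axis' algebra_simps add_divide_distrib)
  finally show ?thesis unfolding peak_def
    by (intro trig_poly_power trig_poly_prod) auto
qed

lemma test_function_peak: "test_function (\<lambda>y::real^'n. peak (y - x) ^ n)"
  by (rule trig_poly_test[OF trig_poly_peak])

lemma peak_factor: "0 \<le> (1 + cos (t::real)) / 2" "(1 + cos t) / 2 \<le> 1"
  using cos_ge_minus_one[of t] cos_le_one[of t] by (auto simp del: cos_ge_minus_one cos_le_one)

lemma peak_nonneg: "0 \<le> peak y" and peak_le_1: "peak y \<le> 1"
  unfolding peak_def by (auto intro!: prod_nonneg prod_le_1 simp only: peak_factor)

lemma peak_0: "peak 0 = 1" by (simp add: peak_def)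

lemma peak_less_1:
  fixes y :: "real^'n"
  assumes "\<not> (\<forall>i. y $ i \<in> \<int>)"
  shows "peak y < 1"
proof -
  obtain i where i: "y $ i \<notin> \<int>" using assms by blast
  have "cos (2 * pi * y $ i) \<noteq> 1"
  proof
    assume "cos (2 * pi * y $ i) = 1"
    then obtain m :: int where "2 * pi * y $ i = of_int m * 2 * pi"
      using cos_one_2pi_int by auto
    then have "y $ i = of_int m" by simp
    then show False using i by simp
  qed
  then have "(1 + cos (2 * pi * y $ i)) / 2 < 1" using cos_le_one[of "2 * pi * y $ i"] by (simp add: less_le)
  moreover have "peak y = (1 + cos (2 * pi * y $ i)) / 2 * (\<Prod>i\<in>UNIV - {i}. (1 + cos (2 * pi * y $ i)) / 2)"
    unfolding peak_def by (subst prod.remove[of UNIV i]) auto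
  moreover have "(\<Prod>i\<in>UNIV - {i}. (1 + cos (2 * pi * y $ i)) / 2) \<le> 1"
    by (intro prod_le_1) (simp only: peak_factor)
  moreover have "(1 + cos (2 * pi * y $ i)) / 2 * (\<Prod>i\<in>UNIV - {i}. (1 + cos (2 * pi * y $ i)) / 2) \<le> (1 + cos (2 * pi * y $ i)) / 2 * 1"
    by (intro mult_left_mono calculation(3)) (simp only: peak_factor)
  ultimately show ?thesis by linarith
qed

lemma pcont_peak: "pcont (\<lambda>y. peak y ^ n)"
  using test_function_pcont[OF test_function_peak[of 0 n]] by simp

subsection \<open>Testing against trigonometric polynomials\<close>

text \<open>Laplace's method. Where \<open>v\<close> is not close to \<open>v 0\<close>,
  \<open>peak\<close> is at most some \<open>r < 1\<close>, while its powers have integral at least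
  a fixed multiple of \<open>r' ^ n\<close> with \<open>r' > r\<close>; the bad contribution is
  negligible for large \<open>n\<close>.\<close>

lemma peak_concentrates:
  fixes v :: "real^'n \<Rightarrow> real"
  assumes v: "pcont v" and e: "e > 0"
  obtains n where "(\<integral>y. peak y ^ n \<partial>(cube_measure :: (real^'n) measure)) > 0"
    "(\<integral>y. \<bar>v y - v 0\<bar> * peak y ^ n \<partial>cube_measure) \<le> e * (\<integral>y. peak y ^ n \<partial>(cube_measure :: (real^'n) measure))"
proof -
  obtain B where B: "B \<ge> 0" "\<And>x. \<bar>v x\<bar> \<le> B" using pcont_bounded[OF v] by blast
  \<comment> \<open>The corners of the cube are lattice points, where \<open>peak\<close> is 1.
    Periodicity of \<open>v\<close> keeps them out of this compact set, so \<open>peak\<close>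
    attains a maximum below 1 on it unless it is empty.\<close>
  define bad where "bad = cbox 0 One \<inter> {y. e / 2 \<le> \<bar>v y - v 0\<bar>}"
  have cv: "continuous_on UNIV v" using v by (rule pcontD)
  have cp: "continuous_on UNIV (peak :: real^'n \<Rightarrow> real)" using pcontD(2)[OF pcont_peak[of 1]] by simp
  have "closed {y. e / 2 \<le> \<bar>v y - v 0\<bar>}"
    by (intro closed_Collect_le continuous_intros cv)
  then have cb: "compact bad" unfolding bad_def by (intro compact_Int_closed compact_cbox)
  have badless: "peak y < 1" if "y \<in> bad" for y
  proof (rule peak_less_1, rule)
    assume "\<forall>i. y $ i \<in> \<int>"
    then have "v (0 + y) = v 0" by (intro periodicD[OF pcontD(1)[OF v]]) auto
    then show False using that e by (simp add: bad_def)
  qed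
  obtain r where r: "0 \<le> r" "r < 1" "\<And>y. y \<in> bad \<Longrightarrow> peak y \<le> r"
  proof (cases "bad = {}")
    case True
    then show ?thesis using that[of 0] by auto
  next
    case False
    then obtain z where "z \<in> bad" "\<forall>y\<in>bad. peak y \<le> peak z"
      using continuous_attains_sup[OF cb _ continuous_on_subset[OF cp]] by blast
    then show ?thesis using that[of "peak z"] badless peak_nonneg by blast
  qed
  define r' where "r' = (1 + r) / 2"
  have r': "r < r'" "r' < 1" "0 < r'" using r by (auto simp: r'_def)
  obtain d where d: "d > 0" "\<And>y::real^'n. dist y 0 < d \<Longrightarrow> dist (peak y) (peak (0::real^'n)) < 1 - r'"
    using cp r' unfolding continuous_on_iff by (metis UNIV_I diff_gt_0_iff_gt)
  \<comment> \<open>The box of side \<open>c\<close> at the corner 0 lies in the unit cube, and its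
    points have norm below \<open>d\<close> because the norm is at most the sum of the
    coordinates.\<close>
  define c where "c = min 1 (d / (2 * CARD('n)))"
  have c: "c > 0" "c \<le> 1" "CARD('n) * c < d"
  proof -
    show "c > 0" "c \<le> 1" using d by (auto simp: c_def)
    have "CARD('n) * c \<le> CARD('n) * (d / (2 * CARD('n)))" by (intro mult_left_mono) (auto simp: c_def)
    also have "\<dots> < d" using d by simp
    finally show "CARD('n) * c < d" .
  qed
  define S where "S = cbox 0 (c *\<^sub>R One :: real^'n)"
  have S_sub: "S \<subseteq> cbox 0 One"
  proof
    fix y assume "y \<in> S"
    then have "0 \<le> y $ i \<and> y $ i \<le> c" for i by (simp add: S_def mem_box_cart)
    then show "y \<in> cbox 0 One" unfolding mem_cube using c(2) by (meson order_trans)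
  qed
  have S_peak: "r' \<le> peak y" if "y \<in> S" for y
  proof -
    have "norm y \<le> (\<Sum>i\<in>UNIV. \<bar>y $ i\<bar>)" by (rule norm_le_l1_cart)
    also have "\<dots> \<le> (\<Sum>i\<in>(UNIV::'n set). c)" using that by (intro sum_mono) (auto simp: S_def mem_box_cart)
    also have "\<dots> < d" using c by simp
    finally have "dist (peak y) (peak (0::real^'n)) < 1 - r'" by (intro d) simp
    then show ?thesis unfolding dist_real_def peak_0 by linarith
  qed
  define \<mu> where "\<mu> = measure cube_measure S"
  have "\<mu> = measure lborel S"
    unfolding \<mu>_def cube_measure_def using S_sub by (subst measure_restrict_space) (auto simp: S_def)
  also have "\<dots> = c ^ CARD('n)"
    using c(1) unfolding S_def by (subst content_cbox_cart) (auto simp: interval_ne_empty_cart)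
  finally have \<mu>: "\<mu> > 0" using c by simp
  define I where "I = (\<lambda>n. \<integral>y. peak y ^ n \<partial>(cube_measure :: (real^'n) measure))"
  have int: "integrable cube_measure (\<lambda>y::real^'n. peak y ^ n)" for n
    by (rule integrable_cube_pcont[OF pcont_peak])
  have I_ge: "r' ^ n * \<mu> \<le> I n" for n
  proof -
    have Sm: "S \<in> sets cube_measure"
      using S_sub unfolding cube_measure_def by (subst sets_restrict_space_iff) (auto simp: S_def)
    have "r' ^ n * \<mu> = (\<integral>y. r' ^ n * indicator S y \<partial>cube_measure)"
      using Sm S_sub by (simp add: \<mu>_def Int_absorb2)
    also have "\<dots> \<le> I n" unfolding I_def
    proof (intro integral_mono int integrable_mult_right integrable_real_indicator Sm)
      show "emeasure cube_measure S < \<infinity>" by (simp add: less_top[symmetric])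
      show "r' ^ n * indicator S y \<le> peak y ^ n" for y
        using r' by (auto simp: indicator_def peak_nonneg intro!: power_mono S_peak)
    qed
    finally show ?thesis .
  qed
  have pc: "pcont (\<lambda>y. \<bar>v y - v 0\<bar> * peak y ^ n)" for n
    by (intro pcont_mult pcont_abs pcont_diff pcont_peak v pcont_const)
  have upper: "(\<integral>y. \<bar>v y - v 0\<bar> * peak y ^ n \<partial>cube_measure) \<le> e / 2 * I n + 2 * B * r ^ n" for n
  proof -
    have "(\<integral>y. \<bar>v y - v 0\<bar> * peak y ^ n \<partial>cube_measure) \<le> (\<integral>y. e / 2 * peak (y::real^'n) ^ n + 2 * B * r ^ n \<partial>cube_measure)"
    proof (rule integral_mono)
      show "integrable cube_measure (\<lambda>y. \<bar>v y - v 0\<bar> * peak y ^ n)" by (rule integrable_cube_pcont[OF pc])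
      show "integrable cube_measure (\<lambda>y::real^'n. e / 2 * peak y ^ n + 2 * B * r ^ n)" using int by simp
      fix y :: "real^'n" assume y: "y \<in> space cube_measure"
      show "\<bar>v y - v 0\<bar> * peak y ^ n \<le> e / 2 * peak y ^ n + 2 * B * r ^ n"
      proof (cases "y \<in> bad")
        case True
        have "\<bar>v y - v 0\<bar> \<le> 2 * B" using B(2)[of y] B(2)[of 0] by linarith
        then have "\<bar>v y - v 0\<bar> * peak y ^ n \<le> 2 * B * r ^ n"
          by (intro mult_mono power_mono r True peak_nonneg) (auto simp: B peak_nonneg)
        then show ?thesis using e peak_nonneg[of y] by (smt (verit) divide_nonneg_nonneg mult_nonneg_nonneg zero_le_power)
      next
        case False
        then have "\<bar>v y - v 0\<bar> \<le> e / 2" using y by (auto simp: bad_def)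
        then have "\<bar>v y - v 0\<bar> * peak y ^ n \<le> e / 2 * peak y ^ n" by (intro mult_right_mono) (simp_all add: peak_nonneg)
        moreover have "0 \<le> 2 * B * r ^ n" using B r by simp
        ultimately show ?thesis by linarith
      qed
    qed
    also have "\<dots> = e / 2 * I n + 2 * B * r ^ n" using int by (simp add: I_def)
    finally show ?thesis .
  qed
  \<comment> \<open>\<open>2 * B + 1\<close> instead of \<open>2 * B\<close> keeps the divisor
    positive when \<open>B = 0\<close>.\<close>
  obtain n where n: "(r / r') ^ n < e / 2 * \<mu> / (2 * B + 1)"
    using real_arch_pow_inv[of "e / 2 * \<mu> / (2 * B + 1)" "r / r'"] e \<mu> B r' by auto
  have "r ^ n * (2 * B + 1) < e / 2 * \<mu> * r' ^ n"
    using n r' B by (simp add: power_divide field_simps)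
  moreover have "2 * B * r ^ n \<le> r ^ n * (2 * B + 1)" using r by (simp add: algebra_simps)
  moreover have "e / 2 * (r' ^ n * \<mu>) \<le> e / 2 * I n" using I_ge[of n] e by (intro mult_left_mono) auto
  ultimately have "2 * B * r ^ n \<le> e / 2 * I n" by (simp add: algebra_simps)
  then have "(\<integral>y. \<bar>v y - v 0\<bar> * peak y ^ n \<partial>cube_measure) \<le> e * I n"
    using upper[of n] by linarith
  moreover have "I n > 0" using I_ge[of n] \<mu> r' by (meson less_le_trans mult_pos_pos zero_less_power)
  ultimately show ?thesis using that unfolding I_def by blast
qed

lemma peak_approximates:
  fixes w :: "real^'n \<Rightarrow> real"
  assumes w: "pcont w" and e: "e > 0"
  obtains n where "(\<integral>y. peak y ^ n \<partial>(cube_measure :: (real^'n) measure)) > 0"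
    "\<bar>w x * (\<integral>y. peak y ^ n \<partial>(cube_measure :: (real^'n) measure)) - (\<integral>y. w y * peak (y - x) ^ n \<partial>cube_measure)\<bar>
      \<le> e * (\<integral>y. peak y ^ n \<partial>(cube_measure :: (real^'n) measure))"
proof -
  define v where "v = (\<lambda>y. w (y + x))"
  have v: "pcont v" unfolding v_def by (rule pcont_shift[OF w])
  obtain n where n: "(\<integral>y. peak y ^ n \<partial>(cube_measure :: (real^'n) measure)) > 0"
    "(\<integral>y. \<bar>v y - v 0\<bar> * peak y ^ n \<partial>cube_measure) \<le> e * (\<integral>y. peak y ^ n \<partial>(cube_measure :: (real^'n) measure))"
    using peak_concentrates[OF v e] by blast
  have pw: "pcont (\<lambda>y. w y * peak (y - x) ^ n)"
    by (intro pcont_mult w test_function_pcont[OF test_function_peak])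
  have "(\<integral>y. w y * peak (y - x) ^ n \<partial>cube_measure) = (\<integral>y. v y * peak y ^ n \<partial>cube_measure)"
    using integral_cube_shift[OF pw, of x] by (simp add: v_def)
  moreover have "w x * (\<integral>y. peak y ^ n \<partial>(cube_measure :: (real^'n) measure)) - (\<integral>y. v y * peak y ^ n \<partial>cube_measure)
      = (\<integral>y. (v 0 - v y) * peak y ^ n \<partial>cube_measure)"
  proof -
    have "integrable cube_measure (\<lambda>y. v 0 * peak (y::real^'n) ^ n)" "integrable cube_measure (\<lambda>y. v y * peak y ^ n)"
      by (intro integrable_cube_pcont pcont_mult v pcont_peak pcont_const)+
    note i = this
    have "(\<integral>y. (v 0 - v y) * peak y ^ n \<partial>cube_measure) = (\<integral>y. v 0 * peak (y::real^'n) ^ n \<partial>cube_measure) - (\<integral>y. v y * peak y ^ n \<partial>cube_measure)"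
      unfolding left_diff_distrib by (rule Bochner_Integration.integral_diff[OF i])
    then show ?thesis by (simp add: v_def)
  qed
  moreover have "\<bar>\<integral>y. (v 0 - v y) * peak y ^ n \<partial>cube_measure\<bar> \<le> (\<integral>y. \<bar>(v 0 - v y) * peak y ^ n\<bar> \<partial>cube_measure)"
    by (rule integral_abs_bound)
  moreover have "(\<lambda>y. \<bar>(v 0 - v y) * peak y ^ n\<bar>) = (\<lambda>y. \<bar>v y - v 0\<bar> * peak y ^ n)"
    by (auto simp: abs_mult peak_nonneg abs_minus_commute)
  ultimately show ?thesis using that[OF n(1)] n(2) by simp
qed

text \<open>A translated power of \<open>peak\<close> divided by its integral is an admissible
  \<open>\<phi>\<close> that averages \<open>w\<close> near \<open>x\<close>. Used where only
  integrals against test functions are known, as for the mollified divergence.\<close>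

lemma sup_bound_by_test_functions:
  fixes w :: "real^'n \<Rightarrow> real"
  assumes w: "pcont w"
    and M: "\<And>\<phi>. test_function \<phi> \<Longrightarrow> (\<And>x. \<phi> x \<ge> 0) \<Longrightarrow> (\<integral>x. \<phi> x \<partial>cube_measure) = 1
        \<Longrightarrow> \<bar>\<integral>x. w x * \<phi> x \<partial>cube_measure\<bar> \<le> M"
  shows "\<bar>w x\<bar> \<le> M"
proof (rule field_le_epsilon)
  fix e :: real assume e: "e > 0"
  let ?J = "\<lambda>n. \<integral>y. peak y ^ n \<partial>(cube_measure :: (real^'n) measure)"
  obtain n where n: "?J n > 0"
    "\<bar>w x * (?J n) - (\<integral>y. w y * peak (y - x) ^ n \<partial>cube_measure)\<bar> \<le> e * (?J n)"
    using peak_approximates[OF w e] by blast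
  define \<phi> where "\<phi> = (\<lambda>y. (1 / (?J n)) * peak (y - x) ^ n)"
  have "\<bar>\<integral>y. w y * \<phi> y \<partial>cube_measure\<bar> \<le> M"
  proof (rule M)
    show "test_function \<phi>" unfolding \<phi>_def by (intro test_function_cmult test_function_peak)
    show "\<phi> y \<ge> 0" for y using n(1) by (simp add: \<phi>_def peak_nonneg)
    have "(\<integral>y. peak (y - x) ^ n \<partial>cube_measure) = (?J n)"
      using integral_cube_shift[OF pcont_peak[of n], of "- x"] by simp
    then show "(\<integral>y. \<phi> y \<partial>cube_measure) = 1" using n(1) by (simp add: \<phi>_def)
  qed
  moreover have "(\<integral>y. w y * \<phi> y \<partial>cube_measure) = (\<integral>y. w y * peak (y - x) ^ n \<partial>cube_measure) / (?J n)"
    by (simp add: \<phi>_def)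
  moreover have "w x = (w x * (?J n) - (\<integral>y. w y * peak (y - x) ^ n \<partial>cube_measure)) / (?J n) + (\<integral>y. w y * peak (y - x) ^ n \<partial>cube_measure) / (?J n)"
    using n(1) by (simp add: field_simps)
  moreover have "\<bar>(w x * (?J n) - (\<integral>y. w y * peak (y - x) ^ n \<partial>cube_measure)) / (?J n)\<bar> \<le> e"
    using n by (simp add: abs_divide pos_divide_le_eq)
  ultimately show "\<bar>w x\<bar> \<le> M + e" by linarith
qed

lemma zero_by_trig_poly:
  fixes w :: "real^'n \<Rightarrow> real"
  assumes w: "pcont w" and 0: "\<And>\<phi>. trig_poly \<phi> \<Longrightarrow> (\<integral>x. w x * \<phi> x \<partial>cube_measure) = 0"
  shows "w x = 0"
proof -
  have "\<bar>w x\<bar> \<le> 0 + e" if e: "e > 0" for e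
  proof -
    let ?J = "\<lambda>n. \<integral>y. peak y ^ n \<partial>(cube_measure :: (real^'n) measure)"
  obtain n where n: "?J n > 0"
      "\<bar>w x * (?J n) - (\<integral>y. w y * peak (y - x) ^ n \<partial>cube_measure)\<bar> \<le> e * (?J n)"
      using peak_approximates[OF w e] by blast
    then show ?thesis using 0[OF trig_poly_peak[of x n]] by (simp add: abs_mult)
  qed
  then show ?thesis using field_le_epsilon[of "\<bar>w x\<bar>" 0] by auto
qed

section \<open>Laplacian and weakly harmonic functions\<close>

definition laplacian :: "(real^'n \<Rightarrow> real) \<Rightarrow> real^'n \<Rightarrow> real" where
  "laplacian f x = (\<Sum>i\<in>UNIV. partial i (partial i f) x)"

lemma test_function_laplacian: "test_function f \<Longrightarrow> test_function (laplacian f)"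
  unfolding laplacian_def[abs_def] by (intro test_function_sum test_function_partial)

lemma laplacian_cos:
  fixes a :: "real^'n"
  shows "laplacian (\<lambda>y. c * cos (a \<bullet> y + b)) x = - (a \<bullet> a) * (c * cos (a \<bullet> x + b))"
proof -
  have p: "partial i (\<lambda>y. c * cos (a \<bullet> y + b)) = (\<lambda>y. (c * a $ i) * cos (a \<bullet> y + (b + pi / 2)))" for i c b
    by (rule ext, subst partial_eq[OF has_derivative_cos_inner]) (simp add: inner_axis mult.assoc)
  have c: "cos (a \<bullet> x + (b + pi / 2 + pi / 2)) = - cos (a \<bullet> x + b)"
    using cos_periodic_pi[of "a \<bullet> x + b"] by (simp add: algebra_simps)
  show ?thesis unfolding laplacian_def p c
    by (simp add: inner_vec_def sum_distrib_left sum_distrib_right sum_negf algebra_simps)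
qed

text \<open>Nonconstant cosines are eigenfunctions of the Laplacian with nonzero eigenvalue, so
  harmonicity removes their coefficients; the mean removes that of the constants. Uniqueness of the
  pressure rests on this.\<close>

lemma weakly_harmonic_zero:
  fixes w :: "real^'n \<Rightarrow> real"
  assumes w: "pcont w" and mean: "(\<integral>x. w x \<partial>cube_measure) = 0"
    and harm: "\<And>\<phi>. test_function \<phi> \<Longrightarrow> (\<integral>x. w x * laplacian \<phi> x \<partial>cube_measure) = 0"
  shows "w x = 0"
proof (rule zero_by_trig_poly[OF w])
  fix \<phi> :: "real^'n \<Rightarrow> real" assume "trig_poly \<phi>"
  then show "(\<integral>x. w x * \<phi> x \<partial>cube_measure) = 0"
  proof (induction rule: trig_poly.induct)
    case (trig_poly_cos a c b)
    let ?f = "\<lambda>y. c * cos (((2 * pi) *\<^sub>R a) \<bullet> y + b)"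
    show ?case
    proof (cases "a = 0")
      case True
      then show ?thesis using mean by simp
    next
      case False
      have t: "test_function ?f" by (rule trig_poly_test[OF trig_poly.trig_poly_cos[OF trig_poly_cos]])
      let ?l = "- (((2 * pi) *\<^sub>R a) \<bullet> ((2 * pi) *\<^sub>R a))"
      have "0 = (\<integral>x. w x * laplacian ?f x \<partial>cube_measure)" using harm[OF t] by simp
      also have "\<dots> = (\<integral>x. ?l * (w x * ?f x) \<partial>cube_measure)"
        by (simp only: laplacian_cos) (simp only: mult.left_commute mult.assoc)
      also have "\<dots> = ?l * (\<integral>x. w x * ?f x \<partial>cube_measure)" by (rule integral_mult_right_zero)
      finally show ?thesis using False by simp
    qed
  next
    case (trig_poly_add f g)
    then show ?case
      using integrable_cube_pcont[OF pcont_mult[OF w test_function_pcont[OF trig_poly_test]], of f]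
        integrable_cube_pcont[OF pcont_mult[OF w test_function_pcont[OF trig_poly_test]], of g]
      by (simp add: distrib_left)
  qed
qed

subsection \<open>Convolution with compactly supported kernels\<close>

lemma lborel_integral_translate:
  fixes f :: "'a::euclidean_space \<Rightarrow> real"
  assumes [measurable]: "f \<in> borel_measurable borel"
  shows "(\<integral>z. f (c + z) \<partial>lborel) = (\<integral>z. f z \<partial>lborel)"
proof -
  have "(\<integral>z. f z \<partial>lborel) = (\<integral>z. f z \<partial>distr lborel borel ((+) c))"
    by (simp only: lborel_distr_plus)
  also have "\<dots> = (\<integral>z. f (c + z) \<partial>lborel)" by (rule integral_distr) auto
  finally show ?thesis by simp
qed

lemma lborel_integral_affine:
  fixes f :: "'a::euclidean_space \<Rightarrow> real"
  assumes [measurable]: "f \<in> borel_measurable borel" and c: "c \<noteq> 0"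
  shows "(\<integral>z. f z \<partial>lborel) = \<bar>c\<bar> ^ DIM('a) * (\<integral>z. f (t + c *\<^sub>R z) \<partial>lborel)"
proof -
  have "(\<integral>z. f z \<partial>lborel) = (\<integral>z. f z \<partial>density (distr lborel borel (\<lambda>x. t + c *\<^sub>R x)) (\<lambda>_. ennreal (\<bar>c\<bar> ^ DIM('a))))"
    using lborel_affine[OF c, of t] by (simp add: ennreal_power)
  also have "\<dots> = (\<integral>z. \<bar>c\<bar> ^ DIM('a) *\<^sub>R f z \<partial>distr lborel borel (\<lambda>x. t + c *\<^sub>R x))"
    by (rule integral_density) auto
  also have "\<dots> = (\<integral>z. \<bar>c\<bar> ^ DIM('a) *\<^sub>R f (t + c *\<^sub>R z) \<partial>lborel)"
    by (rule integral_distr) auto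
  finally show ?thesis by simp
qed

lemma integrable_compact_support:
  fixes f :: "'a::euclidean_space \<Rightarrow> real"
  assumes "continuous_on UNIV f" "\<And>z. z \<notin> cbox a b \<Longrightarrow> f z = 0"
  shows "integrable lborel f"
proof -
  have "f z = indicator (cbox a b) z *\<^sub>R f z" for z using assms(2)[of z] by (cases "z \<in> cbox a b") auto
  then have "f = (\<lambda>z. indicator (cbox a b) z *\<^sub>R f z)" by blast
  moreover have "integrable lborel (\<lambda>z. indicator (cbox a b) z *\<^sub>R f z)"
    using assms(1) by (intro borel_integrable_compact) (auto intro: continuous_on_subset)
  ultimately show ?thesis by simp
qed

lemma integral_compact_support:
  fixes f :: "'a::euclidean_space \<Rightarrow> real"
  assumes "continuous_on UNIV f" "\<And>z. z \<notin> cbox a b \<Longrightarrow> f z = 0"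
  shows "(\<integral>z. f z \<partial>lborel) = integral (cbox a b) f"
proof -
  have e: "indicator (cbox a b) z *\<^sub>R f z = f z" for z using assms(2)[of z] by (cases "z \<in> cbox a b") auto
  have "set_integrable lborel (cbox a b) f"
    unfolding set_integrable_def using assms(1)
    by (intro borel_integrable_compact) (auto intro: continuous_on_subset)
  from set_borel_integral_eq_integral(2)[OF this] show ?thesis
    unfolding set_lebesgue_integral_def e .
qed

text \<open>The radius 1/2 makes a kernel at scale at most 1 fit into a single period cube, see
  \<open>conv_sup\<close>. The order is finite because the bumps in use have finite
  smoothness.\<close>

definition kernel :: "nat \<Rightarrow> (real^'n \<Rightarrow> real) \<Rightarrow> bool" where
  "kernel k K \<longleftrightarrow> C_k k K \<and> (\<forall>z. norm z > 1/2 \<longrightarrow> K z = 0)"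

text \<open>A negative scale reflects the kernel, so that \<open>conv K (- s)\<close> is the adjoint of \<open>conv K s\<close>.\<close>

definition conv :: "(real^'n \<Rightarrow> real) \<Rightarrow> real \<Rightarrow> (real^'n \<Rightarrow> real) \<Rightarrow> real^'n \<Rightarrow> real" where
  "conv K s F x = (\<integral>z. K z * F (x - s *\<^sub>R z) \<partial>lborel)"

abbreviation box_of :: "real \<Rightarrow> (real^'n) set" where
  "box_of r \<equiv> cbox (- r *\<^sub>R One) (r *\<^sub>R One)"

lemma mem_box_of: "norm (z::real^'n) \<le> r \<Longrightarrow> z \<in> box_of r"
  unfolding mem_box_cart
proof
  fix i assume "norm z \<le> r"
  with component_le_norm_cart[of z i] have "\<bar>z $ i\<bar> \<le> r" by simp
  then show "(- r *\<^sub>R One :: real^'n) $ i \<le> z $ i \<and> z $ i \<le> (r *\<^sub>R One :: real^'n) $ i"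
    by (simp add: abs_le_iff)
qed

lemma kernelD: "kernel k K \<Longrightarrow> continuous_on UNIV K" "kernel k K \<Longrightarrow> C_k k K"
  "kernel k K \<Longrightarrow> norm z > 1/2 \<Longrightarrow> K z = 0"
  by (auto simp: kernel_def intro: C_k_continuous)

lemma kernel_outside: "kernel k K \<Longrightarrow> 1/2 \<le> r \<Longrightarrow> z \<notin> box_of r \<Longrightarrow> K z = 0"
  using kernelD(3) mem_box_of by (metis linorder_not_le order_trans)

lemma kernel_mono: "kernel m K \<Longrightarrow> k \<le> m \<Longrightarrow> kernel k K"
  by (auto simp: kernel_def intro: C_k_mono)

lemma kernel_partial:
  assumes "kernel (Suc k) K"
  shows "kernel k (partial i K)"
proof -
  have "partial i K z = 0" if z: "norm z > 1/2" for z
  proof -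
    have "(K has_derivative (\<lambda>_. 0)) (at z)"
    proof (rule has_derivative_transform_within_open[of "\<lambda>_. 0" _ _ _ "- cball 0 (1/2)"])
      show "\<And>x. x \<in> - cball 0 (1/2) \<Longrightarrow> 0 = K x" using kernelD(3)[OF assms] by auto
    qed (use z in auto)
    from partial_eq[OF this] show ?thesis by simp
  qed
  then show ?thesis using assms C_k_partial by (auto simp: kernel_def simp del: C_k.simps)
qed

lemma kernel_mult: "kernel k K \<Longrightarrow> C_k k f \<Longrightarrow> kernel k (\<lambda>z. f z * K z)"
  by (auto simp: kernel_def intro: C_k_mult)

lemma kernel_abs: "kernel k K \<Longrightarrow> kernel 0 (\<lambda>z. \<bar>K z\<bar>)"
  using kernelD(1)[of k K] by (auto simp: kernel_def intro: continuous_intros)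

lemma kernel_bounded:
  assumes "kernel k K" obtains B where "B \<ge> 0" "\<And>z. \<bar>K z\<bar> \<le> B"
proof -
  have "bounded (K ` box_of (1/2))"
    using kernelD(1)[OF assms] by (intro compact_imp_bounded compact_continuous_image) (auto intro: continuous_on_subset)
  then obtain B where B: "\<And>x. x \<in> box_of (1/2) \<Longrightarrow> \<bar>K x\<bar> \<le> B"
    unfolding bounded_iff by auto
  have "\<bar>K z\<bar> \<le> max B 0" for z
    using B[of z] kernel_outside[OF assms, of "1/2" z] by fastforce
  then show ?thesis using that[of "max B 0"] by auto
qed

lemma integrable_kernel:
  assumes "kernel k K" "continuous_on UNIV G"
  shows "integrable lborel (\<lambda>z. K z * G z)"
  by (rule integrable_compact_support[where a = "-(1/2) *\<^sub>R One" and b = "(1/2) *\<^sub>R One"])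
    (use kernel_outside[OF assms(1), of "1/2"] kernelD(1)[OF assms(1)] assms(2) in \<open>auto intro!: continuous_intros\<close>)

lemma integral_kernel:
  assumes "kernel k K" "continuous_on UNIV G" "1/2 \<le> r"
  shows "(\<integral>z. K z * G z \<partial>lborel) = integral (box_of r) (\<lambda>z. K z * G z)"
  by (rule integral_compact_support)
    (use kernel_outside[OF assms(1), of r] kernelD(1)[OF assms(1)] assms(2,3) in \<open>auto intro!: continuous_intros\<close>)

lemma continuous_scaled:
  fixes F :: "real^'n \<Rightarrow> real"
  shows "continuous_on UNIV F \<Longrightarrow> continuous_on UNIV (\<lambda>z. F (x - s *\<^sub>R z))"
  by (rule continuous_on_compose2[of UNIV F]) (auto intro!: continuous_intros)

lemma integrable_conv: "kernel k K \<Longrightarrow> pcont F \<Longrightarrow> integrable lborel (\<lambda>z. K z * F (x - s *\<^sub>R z))"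
  by (intro integrable_kernel continuous_scaled pcontD)

lemma integrable_kernel_1: "kernel k K \<Longrightarrow> integrable lborel K"
  using integrable_kernel[of k K "\<lambda>_. 1"] by simp

lemma conv_box: "kernel k K \<Longrightarrow> pcont F \<Longrightarrow> 1/2 \<le> r \<Longrightarrow> conv K s F x = integral (box_of r) (\<lambda>z. K z * F (x - s *\<^sub>R z))"
  unfolding conv_def by (intro integral_kernel continuous_scaled pcontD)

lemma conv_bound:
  assumes "kernel k K" "pcont F" "\<And>x. \<bar>F x\<bar> \<le> B"
  shows "\<bar>conv K s F x\<bar> \<le> B * (\<integral>z. \<bar>K z\<bar> \<partial>lborel)"
proof -
  have "\<bar>conv K s F x\<bar> \<le> (\<integral>z. \<bar>K z * F (x - s *\<^sub>R z)\<bar> \<partial>lborel)"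
    unfolding conv_def by (rule integral_abs_bound)
  also have "\<dots> \<le> (\<integral>z. B * \<bar>K z\<bar> \<partial>lborel)"
  proof (rule Bochner_Integration.integral_mono)
    show "integrable lborel (\<lambda>z. \<bar>K z * F (x - s *\<^sub>R z)\<bar>)"
      by (intro integrable_abs integrable_conv[OF assms(1,2)])
    show "integrable lborel (\<lambda>z. B * \<bar>K z\<bar>)"
      by (intro integrable_mult_right integrable_kernel_1[OF kernel_abs[OF assms(1)]])
    show "\<bar>K z * F (x - s *\<^sub>R z)\<bar> \<le> B * \<bar>K z\<bar>" for z
      using mult_right_mono[OF assms(3)[of "x - s *\<^sub>R z"], of "\<bar>K z\<bar>"]
      by (simp only: abs_mult mult.commute[of "\<bar>K z\<bar>"] abs_ge_zero simp_thms)
  qed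
  finally show ?thesis by simp
qed

lemma conv_const: "conv K s (\<lambda>_. c) x = c * (\<integral>z. K z \<partial>lborel)"
  by (simp add: conv_def mult.commute)

lemma conv_add: "kernel k K \<Longrightarrow> pcont F \<Longrightarrow> pcont G \<Longrightarrow> conv K s (\<lambda>x. F x + G x) x = conv K s F x + conv K s G x"
  using integrable_conv[of k K F x s] integrable_conv[of k K G x s] by (simp add: conv_def distrib_left)

lemma conv_cmult: "conv K s (\<lambda>x. c * F x) x = c * conv K s F x"
proof -
  have "(\<lambda>z. K z * (c * F (x - s *\<^sub>R z))) = (\<lambda>z. c * (K z * F (x - s *\<^sub>R z)))" by (auto simp: algebra_simps)
  then show ?thesis by (simp add: conv_def)
qed

lemma conv_diff: "kernel k K \<Longrightarrow> pcont F \<Longrightarrow> pcont G \<Longrightarrow> conv K s (\<lambda>x. F x - G x) x = conv K s F x - conv K s G x"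
  using integrable_conv[of k K F x s] integrable_conv[of k K G x s] by (simp add: conv_def right_diff_distrib)

lemma conv_sum: "kernel k K \<Longrightarrow> (\<And>i. i \<in> I \<Longrightarrow> pcont (F i)) \<Longrightarrow> conv K s (\<lambda>x. \<Sum>i\<in>I. F i x) x = (\<Sum>i\<in>I. conv K s (F i) x)"
proof -
  assume a: "kernel k K" "\<And>i. i \<in> I \<Longrightarrow> pcont (F i)"
  have "conv K s (\<lambda>x. \<Sum>i\<in>I. F i x) x = (\<integral>z. (\<Sum>i\<in>I. K z * F i (x - s *\<^sub>R z)) \<partial>lborel)"
    by (simp add: conv_def sum_distrib_left)
  also have "\<dots> = (\<Sum>i\<in>I. conv K s (F i) x)"
    unfolding conv_def using integrable_conv[OF a(1) a(2)] by (intro Bochner_Integration.integral_sum) auto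
  finally show ?thesis .
qed

section \<open>Continuity and derivatives of convolutions\<close>

lemma continuous_on_UNIV_compose: "continuous_on UNIV f \<Longrightarrow> continuous_on S g \<Longrightarrow> continuous_on S (\<lambda>x. f (g x))"
  by (rule continuous_on_compose2[of UNIV f]) auto

lemma pcont_conv:
  fixes K F :: "real^'n \<Rightarrow> real"
  assumes K: "kernel k K" and F: "pcont F"
  shows "pcont (conv K s F)"
proof -
  have per: "periodic (conv K s F)"
  proof (rule periodicI)
    fix x k :: "real^'n" assume k: "\<And>i. k $ i \<in> \<int>"
    have "F (x + k - s *\<^sub>R z) = F (x - s *\<^sub>R z)" for z
      using periodicD[OF pcontD(1)[OF F] k, of "x - s *\<^sub>R z"] by (simp add: algebra_simps)
    then show "conv K s F (x + k) = conv K s F x" by (simp add: conv_def)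
  qed
  have "continuous_on UNIV (\<lambda>x. integral (box_of (1/2)) (\<lambda>z. K z * F (x - s *\<^sub>R z)))"
    by (rule integral_continuous_on_param)
      (auto simp: case_prod_beta intro!: continuous_intros continuous_on_UNIV_compose[OF kernelD(1)[OF K]]
        continuous_on_UNIV_compose[OF pcontD(2)[OF F]])
  then show ?thesis unfolding pcont_def using per conv_box[OF K F, of "1/2" s] by (simp cong: continuous_on_cong)
qed

text \<open>Serves twice: with \<open>\<phi>\<close> the periodic function and \<open>w\<close> the
  kernel, and with the roles exchanged. The derivative is the inner product with
  \<open>g y z\<close> because \<open>leibniz_rule\<close> integrates bounded linear maps.\<close>

lemma has_derivative_box_integral:
  fixes \<phi> w :: "real^'n \<Rightarrow> real"
  assumes \<phi>: "C_k (Suc 0) \<phi>" and w: "continuous_on UNIV w"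
  shows "((\<lambda>y. integral (cbox a b) (\<lambda>z. w z * \<phi> (y + l *\<^sub>R z))) has_derivative
    (\<lambda>h. \<Sum>i\<in>UNIV. h $ i * integral (cbox a b) (\<lambda>z. w z * partial i \<phi> (y + l *\<^sub>R z)))) (at y)"
proof -
  have c\<phi>: "continuous_on UNIV \<phi>" and cp: "continuous_on UNIV (partial i \<phi>)" for i
    using C_k_continuous[OF \<phi>] C_k_partial[OF \<phi>, of i] by auto
  define g :: "real^'n \<Rightarrow> real^'n \<Rightarrow> real^'n" where "g = (\<lambda>y z. \<chi> i. w z * partial i \<phi> (y + l *\<^sub>R z))"
  have cg: "continuous_on (UNIV \<times> cbox a b) (\<lambda>(y, z). g y z)"
    unfolding g_def case_prod_beta
    by (intro continuous_on_vec_lambda continuous_on_mult continuous_on_UNIV_compose[OF w]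
        continuous_on_UNIV_compose[OF cp] continuous_intros)
  have cgy: "continuous_on (cbox a b) (g y)" for y
    unfolding g_def
    by (intro continuous_on_vec_lambda continuous_on_mult continuous_on_UNIV_compose[OF w]
        continuous_on_UNIV_compose[OF cp] continuous_intros)
  have "((\<lambda>y. integral (cbox a b) (\<lambda>z. w z * \<phi> (y + l *\<^sub>R z))) has_derivative
     integral (cbox a b) (\<lambda>z. blinfun_inner_right (g y z))) (at y within UNIV)"
  proof (rule leibniz_rule[where fx = "\<lambda>y z. blinfun_inner_right (g y z)"])
    fix y z :: "real^'n"
    have "((\<lambda>y. w z * \<phi> (y + l *\<^sub>R z)) has_derivative (\<lambda>h. w z * (\<Sum>i\<in>UNIV. h $ i * partial i \<phi> (y + l *\<^sub>R z)))) (at y)"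
      by (intro has_derivative_mult_right partial_shift \<phi>)
    also have "(\<lambda>h. w z * (\<Sum>i\<in>UNIV. h $ i * partial i \<phi> (y + l *\<^sub>R z))) = blinfun_apply (blinfun_inner_right (g y z))"
      by (auto simp: g_def inner_vec_def sum_distrib_left algebra_simps)
    finally show "((\<lambda>y. w z * \<phi> (y + l *\<^sub>R z)) has_derivative blinfun_apply (blinfun_inner_right (g y z))) (at y within UNIV)"
      by simp
  next
    fix y :: "real^'n"
    show "(\<lambda>z. w z * \<phi> (y + l *\<^sub>R z)) integrable_on cbox a b"
      by (intro integrable_continuous continuous_on_mult continuous_on_UNIV_compose[OF w]
        continuous_on_UNIV_compose[OF c\<phi>] continuous_intros)
  next
    show "continuous_on (UNIV \<times> cbox a b) (\<lambda>(y, z). blinfun_inner_right (g y z))"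
      using bounded_linear.continuous_on[OF bounded_linear_blinfun_inner_right cg] by (simp add: case_prod_beta)
  qed auto
  moreover have "blinfun_apply (integral (cbox a b) (\<lambda>z. blinfun_inner_right (g y z))) =
     (\<lambda>h. \<Sum>i\<in>UNIV. h $ i * integral (cbox a b) (\<lambda>z. w z * partial i \<phi> (y + l *\<^sub>R z)))"
  proof
    fix h
    have "blinfun_apply (integral (cbox a b) (\<lambda>z. blinfun_inner_right (g y z))) h = integral (cbox a b) (\<lambda>z. g y z \<bullet> h)"
      by (subst blinfun_apply_integral)
        (auto intro!: integrable_continuous bounded_linear.continuous_on[OF bounded_linear_blinfun_inner_right] cgy)
    also have "\<dots> = integral (cbox a b) (\<lambda>z. \<Sum>i\<in>UNIV. h $ i * (w z * partial i \<phi> (y + l *\<^sub>R z)))"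
      by (simp add: g_def inner_vec_def algebra_simps)
    also have "\<dots> = (\<Sum>i\<in>UNIV. h $ i * integral (cbox a b) (\<lambda>z. w z * partial i \<phi> (y + l *\<^sub>R z)))"
      by (subst integral_sum) (auto intro!: integrable_continuous continuous_on_mult continuous_on_UNIV_compose[OF w]
        continuous_on_UNIV_compose[OF cp] continuous_intros)
    finally show "blinfun_apply (integral (cbox a b) (\<lambda>z. blinfun_inner_right (g y z))) h =
      (\<Sum>i\<in>UNIV. h $ i * integral (cbox a b) (\<lambda>z. w z * partial i \<phi> (y + l *\<^sub>R z)))" .
  qed
  ultimately show ?thesis by simp
qed

lemma pcont_C_k: "periodic F \<Longrightarrow> C_k k F \<Longrightarrow> pcont F"
  by (simp add: pcont_def C_k_continuous)

lemma conv_has_derivative: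
  assumes K: "kernel k K" and F: "periodic F" "C_k (Suc 0) F"
  shows "(conv K s F has_derivative (\<lambda>h. \<Sum>i\<in>UNIV. h $ i * conv K s (partial i F) x)) (at x)"
proof -
  have p: "pcont F" "pcont (partial i F)" for i
    using pcont_C_k[OF F] pcont_C_k[OF periodic_partial[OF F] C_k_partial[OF F(2)]] by auto
  have "conv K s F = (\<lambda>x. integral (box_of (1/2)) (\<lambda>z. K z * F (x + (- s) *\<^sub>R z)))"
    using conv_box[OF K p(1), of "1/2" s] by auto
  moreover have "conv K s (partial i F) x = integral (box_of (1/2)) (\<lambda>z. K z * partial i F (x + (- s) *\<^sub>R z))" for i
    using conv_box[OF K p(2), of "1/2" s i x] by auto
  ultimately show ?thesis
    using has_derivative_box_integral[OF F(2) kernelD(1)[OF K], of "- (1/2) *\<^sub>R One" "(1/2) *\<^sub>R One" "- s" x] by simp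
qed

lemma partial_conv: "kernel k K \<Longrightarrow> periodic F \<Longrightarrow> C_k (Suc 0) F \<Longrightarrow> partial i (conv K s F) x = conv K s (partial i F) x"
  by (subst partial_eq[OF conv_has_derivative]) (simp_all only: sum_axis not_False_eq_True)

lemma C_k_conv:
  assumes "kernel k K" "periodic F" "C_k m F"
  shows "C_k m (conv K s F)"
  using assms(2,3)
proof (induction m arbitrary: F)
  case 0
  then show ?case using pcontD(2)[OF pcont_conv[OF assms(1)], of F] by (auto simp: pcont_def)
next
  case (Suc m)
  have F: "C_k (Suc 0) F" using C_k_mono[OF Suc.prems(2), of "Suc 0"] by (simp del: C_k.simps)
  show ?case
  proof (rule C_k_SucI[OF conv_has_derivative[OF assms(1) Suc.prems(1) F]])
    fix i show "C_k m (\<lambda>x. \<Sum>j\<in>UNIV. axis i 1 $ j * conv K s (partial j F) x)"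
      unfolding sum_axis using Suc.IH[OF periodic_partial[OF Suc.prems(1) F] C_k_partial[OF Suc.prems(2)]] .
  qed
qed

lemma test_function_conv: "kernel k K \<Longrightarrow> test_function \<phi> \<Longrightarrow> test_function (conv K s \<phi>)"
  unfolding test_function_def using C_k_conv[of k K \<phi>] pcontD(1)[OF pcont_conv[of k K \<phi>]] pcont_C_k by blast

text \<open>Here \<open>F\<close> is only continuous, so the derivative has to fall on the kernel.
  Writing \<open>x' = x + s *\<^sub>R y\<close> and translating the integration variable by
  \<open>y\<close> moves the dependence on \<open>x'\<close> into the argument of \<open>K\<close>;
  the chain rule gives \<open>1 / s\<close>.\<close>

lemma conv_has_derivative_kernel:
  fixes K F :: "real^'n \<Rightarrow> real"
  assumes K: "kernel (Suc 0) K" and F: "pcont F" and s: "s \<noteq> 0"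
  shows "(conv K s F has_derivative (\<lambda>h. \<Sum>i\<in>UNIV. h $ i * (conv (partial i K) s F x / s))) (at x)"
proof -
  define w where "w = (\<lambda>z. F (x - s *\<^sub>R z))"
  have w: "continuous_on UNIV w" unfolding w_def by (intro continuous_scaled pcontD F)
  \<comment> \<open>For \<open>norm y < 1\<close> the translated support has radius at most 3/2, so
    one fixed box of radius 2 serves all such \<open>y\<close>.\<close>
  define J where "J = (\<lambda>y. integral (box_of 2) (\<lambda>z. w z * K (y + 1 *\<^sub>R z)))"
  have J: "(J has_derivative (\<lambda>h. \<Sum>i\<in>UNIV. h $ i * integral (box_of 2) (\<lambda>z. w z * partial i K (0 + 1 *\<^sub>R z)))) (at 0)"
    unfolding J_def by (rule has_derivative_box_integral[OF kernelD(2)[OF K] w])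
  have "integral (box_of 2) (\<lambda>z. w z * partial i K (0 + 1 *\<^sub>R z)) = conv (partial i K) s F x" for i
    using conv_box[OF kernel_partial[OF K] F, of 2 i s x] by (simp add: w_def mult.commute)
  then have J: "(J has_derivative (\<lambda>h. \<Sum>i\<in>UNIV. h $ i * conv (partial i K) s F x)) (at 0)"
    using J by simp
  have lin: "((\<lambda>x'. (1 / s) *\<^sub>R (x' - x)) has_derivative (\<lambda>h. (1 / s) *\<^sub>R h)) (at x)"
    by (auto intro!: derivative_eq_intros)
  have "((\<lambda>x'. J ((1 / s) *\<^sub>R (x' - x))) has_derivative (\<lambda>h. \<Sum>i\<in>UNIV. ((1 / s) *\<^sub>R h) $ i * conv (partial i K) s F x)) (at x)"
    by (rule has_derivative_compose[OF lin]) (simp add: J)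
  then have D: "((\<lambda>x'. J ((1 / s) *\<^sub>R (x' - x))) has_derivative (\<lambda>h. \<Sum>i\<in>UNIV. h $ i * (conv (partial i K) s F x / s))) (at x)"
    by simp
  show ?thesis
  proof (rule has_derivative_transform_within_open[OF D])
    show "open (ball x \<bar>s\<bar>)" "x \<in> ball x \<bar>s\<bar>" using s by auto
    fix x' assume x': "x' \<in> ball x \<bar>s\<bar>"
    define y where "y = (1 / s) *\<^sub>R (x' - x)"
    have "norm y = norm (x' - x) / \<bar>s\<bar>" by (simp add: y_def)
    then have y: "norm y < 1" using x' s by (simp add: dist_norm norm_minus_commute)
    have xy: "x' = x + s *\<^sub>R y" using s by (simp add: y_def)
    have cK: "continuous_on UNIV K" by (rule kernelD(1)[OF K])
    have "conv K s F x' = (\<integral>z. K (y + z) * F (x' - s *\<^sub>R (y + z)) \<partial>lborel)"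
      unfolding conv_def
      by (rule lborel_integral_translate[symmetric])
         (intro borel_measurable_continuous_onI continuous_on_mult cK continuous_scaled pcontD F)
    also have "\<dots> = (\<integral>z. w z * K (y + z) \<partial>lborel)"
      by (simp add: xy w_def algebra_simps)
    also have "\<dots> = J y" unfolding J_def
    proof (subst integral_compact_support[where a = "- 2 *\<^sub>R One" and b = "2 *\<^sub>R One"])
      show "continuous_on UNIV (\<lambda>z. w z * K (y + z))"
        by (intro continuous_on_mult w continuous_on_UNIV_compose[OF cK] continuous_intros)
      fix z :: "real^'n" assume "z \<notin> box_of 2"
      then have "norm z > 2" using mem_box_of[of z 2] by force
      then have "norm (y + z) > 1/2" using y norm_triangle_ineq2[of z "- y"] by (simp add: add.commute)
      then show "w z * K (y + z) = 0" using kernelD(3)[OF K] by simp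
    qed simp
    finally show "J ((1 / s) *\<^sub>R (x' - x)) = conv K s F x'" by (simp add: y_def)
  qed
qed

lemma partial_conv_kernel:
  "kernel (Suc 0) K \<Longrightarrow> pcont F \<Longrightarrow> s \<noteq> 0 \<Longrightarrow> partial i (conv K s F) x = conv (partial i K) s F x / s"
  by (subst partial_eq[OF conv_has_derivative_kernel]) (simp_all only: sum_axis not_False_eq_True)

lemma C_k_conv_kernel:
  assumes "kernel (Suc 0) K" "pcont F" "s \<noteq> 0"
  shows "C_k (Suc 0) (conv K s F)"
proof (rule C_k_SucI[OF conv_has_derivative_kernel[OF assms]])
  fix i
  have "continuous_on UNIV (\<lambda>x. conv (partial i K) s F x / s)"
    using pcontD(2)[OF pcont_conv[OF kernel_partial[OF assms(1)] assms(2)]] assms(3) by (intro continuous_intros) auto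
  then show "C_k 0 (\<lambda>x. \<Sum>j\<in>UNIV. axis i 1 $ j * (conv (partial j K) s F x / s))"
    unfolding sum_axis by simp
qed

text \<open>Both sides come from the same partial derivative of the convolution, computed once on
  the function and once on the kernel. This takes the place of integration by parts.\<close>

lemma conv_partial_swap:
  assumes "kernel (Suc 0) K" "periodic F" "C_k (Suc 0) F" "s \<noteq> 0"
  shows "conv (partial i K) s F x = s * conv K s (partial i F) x"
  using partial_conv[OF assms(1-3), of i s x] partial_conv_kernel[OF assms(1) pcont_C_k[OF assms(2,3)] assms(4), of i x] assms(4)
  by (metis nonzero_eq_divide_eq mult.commute)

text \<open>Swap the derivative onto the constant function 1, where it vanishes.\<close>

lemma integral_partial_kernel:
  fixes K :: "real^'n \<Rightarrow> real"
  shows "kernel (Suc 0) K \<Longrightarrow> (\<integral>z. partial i K z \<partial>lborel) = 0"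
proof -
  assume K: "kernel (Suc 0) K"
  have p: "periodic (\<lambda>_::real^'n. 1::real)" "C_k (Suc 0) (\<lambda>_::real^'n. 1)"
    by (rule pcontD(1)[OF pcont_const], rule C_k_const)
  have "partial i (\<lambda>_::real^'n. 1) = (\<lambda>_. 0)" using partial_eq[of "\<lambda>_::real^'n. 1" "\<lambda>_. 0"] by auto
  then have "conv (partial i K) 1 (\<lambda>_. 1) 0 = 0"
    using conv_partial_swap[OF K p, of 1 i 0] by (simp add: conv_const)
  then show ?thesis by (simp add: conv_const)
qed

section \<open>Fubini, duality and norm bounds for convolutions\<close>

lemma kernel_fubini:
  fixes K :: "real^'n \<Rightarrow> real" and G :: "real^'n \<Rightarrow> real^'n \<Rightarrow> real"
  assumes K: "kernel k K" and G: "continuous_on UNIV (\<lambda>p. G (fst p) (snd p))"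
  shows "(\<integral>x. (\<integral>z. K z * G x z \<partial>lborel) \<partial>cube_measure) = (\<integral>z. K z * (\<integral>x. G x z \<partial>cube_measure) \<partial>lborel)"
proof -
  have cK: "continuous_on UNIV K" by (rule kernelD(1)[OF K])
  have G1: "continuous_on S (\<lambda>q. G (f q) (g q))" if "continuous_on S f" "continuous_on S g" for S :: "'x::topological_space set" and f g
    using continuous_on_compose2[OF G continuous_on_Pair[OF that]] by simp
  have "(\<integral>x. (\<integral>z. K z * G x z \<partial>lborel) \<partial>cube_measure) = (\<integral>x. integral (box_of (1/2)) (\<lambda>z. K z * G x z) \<partial>cube_measure)"
    by (subst integral_kernel[OF K]) (auto intro!: G1 continuous_intros)
  also have "\<dots> = integral (cbox 0 One) (\<lambda>x. integral (box_of (1/2)) (\<lambda>z. K z * G x z))"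
    by (rule integral_cube_HK, rule integral_continuous_on_param)
      (auto simp: case_prod_beta intro!: G1 continuous_on_UNIV_compose[OF cK] continuous_intros)
  \<comment> \<open>Compact support and continuity have reduced Fubini to the exchange of two
    integrals of a continuous function over boxes.\<close>
  also have "\<dots> = integral (box_of (1/2)) (\<lambda>z. integral (cbox 0 One) (\<lambda>x. K z * G x z))"
    by (rule integral_swap_continuous)
      (auto simp: case_prod_beta intro!: G1 continuous_on_UNIV_compose[OF cK] continuous_intros)
  also have "\<dots> = integral (box_of (1/2)) (\<lambda>z. K z * (\<integral>x. G x z \<partial>cube_measure))"
    by (subst integral_cube_HK) (auto intro!: G1 continuous_intros)
  also have "\<dots> = (\<integral>z. K z * (\<integral>x. G x z \<partial>cube_measure) \<partial>lborel)"
  proof (rule integral_kernel[OF K, symmetric])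
    have "continuous_on UNIV (\<lambda>z. integral (cbox 0 One) (\<lambda>x. G x z))"
      by (rule integral_continuous_on_param) (auto simp: case_prod_beta intro!: G1 continuous_intros)
    then show "continuous_on UNIV (\<lambda>z. \<integral>x. G x z \<partial>cube_measure)"
      by (subst integral_cube_HK) (auto intro!: G1 continuous_intros)
  qed simp
  finally show ?thesis .
qed

text \<open>After Fubini the shift by \<open>s *\<^sub>R z\<close> passes from \<open>F\<close> to
  \<open>f\<close> by translation invariance, which turns \<open>s\<close> into
  \<open>- s\<close>.\<close>

lemma conv_adjoint:
  fixes K F f :: "real^'n \<Rightarrow> real"
  assumes K: "kernel k K" and F: "pcont F" and f: "pcont f"
  shows "(\<integral>x. conv K s F x * f x \<partial>cube_measure) = (\<integral>x. F x * conv K (- s) f x \<partial>cube_measure)"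
proof -
  have c: "continuous_on UNIV F" "continuous_on UNIV f" using F f by (auto dest: pcontD)
  have "(\<integral>x. conv K s F x * f x \<partial>cube_measure) = (\<integral>x. (\<integral>z. K z * (F (x - s *\<^sub>R z) * f x) \<partial>lborel) \<partial>cube_measure)"
    unfolding conv_def by (simp only: integral_mult_left_zero[symmetric] mult.assoc)
  also have "\<dots> = (\<integral>z. K z * (\<integral>x. F (x - s *\<^sub>R z) * f x \<partial>cube_measure) \<partial>lborel)"
    by (rule kernel_fubini[OF K]) (intro continuous_on_mult continuous_on_UNIV_compose[OF c(1)] continuous_on_UNIV_compose[OF c(2)] continuous_intros)
  also have "\<dots> = (\<integral>z. K z * (\<integral>x. F x * f (x + s *\<^sub>R z) \<partial>cube_measure) \<partial>lborel)"
  proof -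
    have "(\<integral>x. F (x - s *\<^sub>R z) * f x \<partial>cube_measure) = (\<integral>x. F x * f (x + s *\<^sub>R z) \<partial>cube_measure)" for z
    proof -
      have "pcont (\<lambda>x. F (x + - (s *\<^sub>R z)) * f x)" by (intro pcont_mult pcont_shift F f)
      from integral_cube_shift[OF this, of "s *\<^sub>R z"] show ?thesis by simp
    qed
    then show ?thesis by simp
  qed
  also have "\<dots> = (\<integral>x. (\<integral>z. K z * (F x * f (x + s *\<^sub>R z)) \<partial>lborel) \<partial>cube_measure)"
    by (rule kernel_fubini[OF K, symmetric]) (intro continuous_on_mult continuous_on_UNIV_compose[OF c(1)] continuous_on_UNIV_compose[OF c(2)] continuous_intros)
  also have "\<dots> = (\<integral>x. F x * conv K (- s) f x \<partial>cube_measure)"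
    unfolding conv_def by (simp only: integral_mult_right_zero[symmetric] mult.left_commute[of "F _"] scaleR_minus_left diff_minus_eq_add)
  finally show ?thesis .
qed

lemma integral_conv:
  assumes "kernel k K" "pcont F"
  shows "(\<integral>x. conv K s F x \<partial>cube_measure) = (\<integral>x. F x \<partial>cube_measure) * (\<integral>z. K z \<partial>lborel)"
  using conv_adjoint[OF assms pcont_const[of 1], of s] by (simp add: conv_const)

lemma conv_L1:
  assumes K: "kernel k K" and F: "pcont F"
  shows "(\<integral>x. \<bar>conv K s F x\<bar> \<partial>cube_measure) \<le> (\<integral>z. \<bar>K z\<bar> \<partial>lborel) * (\<integral>x. \<bar>F x\<bar> \<partial>cube_measure)"
proof -
  have Ka: "kernel 0 (\<lambda>z. \<bar>K z\<bar>)" by (rule kernel_abs[OF K])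
  have "(\<integral>x. \<bar>conv K s F x\<bar> \<partial>cube_measure) \<le> (\<integral>x. conv (\<lambda>z. \<bar>K z\<bar>) s (\<lambda>x. \<bar>F x\<bar>) x \<partial>cube_measure)"
  proof (rule Bochner_Integration.integral_mono)
    show "integrable cube_measure (\<lambda>x. \<bar>conv K s F x\<bar>)"
      by (intro integrable_cube_pcont pcont_abs pcont_conv[OF K F])
    show "integrable cube_measure (conv (\<lambda>z. \<bar>K z\<bar>) s (\<lambda>x. \<bar>F x\<bar>))"
      by (intro integrable_cube_pcont pcont_conv[OF Ka] pcont_abs F)
    fix x
    show "\<bar>conv K s F x\<bar> \<le> conv (\<lambda>z. \<bar>K z\<bar>) s (\<lambda>x. \<bar>F x\<bar>) x"
      unfolding conv_def abs_mult[symmetric] by (rule integral_abs_bound)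
  qed
  also have "\<dots> = (\<integral>z. \<bar>K z\<bar> \<partial>lborel) * (\<integral>x. \<bar>F x\<bar> \<partial>cube_measure)"
    by (subst integral_conv[OF Ka pcont_abs[OF F]]) (rule mult.commute)
  finally show ?thesis .
qed

text \<open>The substitution \<open>y = x - s *\<^sub>R z\<close> gives the factor
  \<open>1 / \<bar>s\<bar> ^ CARD('n)\<close>. For \<open>\<bar>s\<bar> \<le> 1\<close> the kernel
  then lives on one translate \<open>S\<close> of the unit cube, over which \<open>\<phi>\<close>
  has the same integral as over the unit cube itself.\<close>

lemma conv_sup:
  fixes K \<phi> :: "real^'n \<Rightarrow> real"
  assumes K: "kernel k K" and B: "\<And>z. \<bar>K z\<bar> \<le> B" and \<phi>: "pcont \<phi>" "\<And>x. \<phi> x \<ge> 0"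
    and s: "s \<noteq> 0" "\<bar>s\<bar> \<le> 1"
  shows "\<bar>conv K s \<phi> x\<bar> \<le> B / \<bar>s\<bar> ^ CARD('n) * (\<integral>x. \<phi> x \<partial>cube_measure)"
proof -
  have c\<phi>: "continuous_on UNIV \<phi>" by (rule pcontD[OF \<phi>(1)])
  have Ka: "kernel 0 (\<lambda>z. \<bar>K z\<bar>)" by (rule kernel_abs[OF K])
  define f where "f = (\<lambda>y. \<bar>K ((1 / s) *\<^sub>R (x - y))\<bar> * \<phi> y)"
  have cf: "continuous_on UNIV f"
    unfolding f_def by (intro continuous_on_mult c\<phi> continuous_on_UNIV_compose[OF kernelD(1)[OF Ka]] continuous_intros)
  define a where "a = x - (1/2) *\<^sub>R One"
  define S where "S = cbox a (x + (1/2) *\<^sub>R One)"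
  have fS: "f y = 0" if "y \<notin> S" for y
  proof -
    have "x - y \<notin> box_of (1/2)"
    proof
      assume h: "x - y \<in> box_of (1/2)"
      have "a $ i \<le> y $ i \<and> y $ i \<le> (x + (1/2) *\<^sub>R One) $ i" for i
      proof -
        have "- (1/2) \<le> x $ i - y $ i \<and> x $ i - y $ i \<le> 1/2" using h by (simp add: mem_box_cart)
        then show ?thesis unfolding a_def by simp
      qed
      then have "y \<in> S" by (simp only: S_def mem_box_cart) blast
      with that show False by blast
    qed
    then have "norm (x - y) > 1/2" using mem_box_of[of "x - y" "1/2"] by force
    then have "\<bar>s\<bar> * (1/2) < norm (x - y)" using s(2) by linarith
    then have "1/2 < norm (x - y) / \<bar>s\<bar>" using s(1) by (simp add: field_simps)
    then have "norm ((1 / s) *\<^sub>R (x - y)) > 1/2" by simp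
    then show ?thesis using kernelD(3)[OF K] by (simp add: f_def)
  qed
  have fx: "f (x + (- s) *\<^sub>R z) = \<bar>K z\<bar> * \<phi> (x - s *\<^sub>R z)" for z
    using s(1) by (simp add: f_def)
  have meas: "f \<in> borel_measurable borel" by (rule borel_measurable_continuous_onI[OF cf])
  have "(\<integral>y. f y \<partial>lborel) = \<bar>- s\<bar> ^ DIM(real^'n) * (\<integral>z. f (x + (- s) *\<^sub>R z) \<partial>lborel)"
    by (rule lborel_integral_affine[OF meas]) (use s in simp)
  then have 1: "(\<integral>z. \<bar>K z\<bar> * \<phi> (x - s *\<^sub>R z) \<partial>lborel) = (\<integral>y. f y \<partial>lborel) / \<bar>s\<bar> ^ CARD('n)"
    unfolding fx using s(1) by simp
  have "\<bar>conv K s \<phi> x\<bar> \<le> (\<integral>z. \<bar>K z * \<phi> (x - s *\<^sub>R z)\<bar> \<partial>lborel)"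
    unfolding conv_def by (rule integral_abs_bound)
  also have "\<dots> = (\<integral>z. \<bar>K z\<bar> * \<phi> (x - s *\<^sub>R z) \<partial>lborel)"
    using \<phi>(2) by (simp add: abs_mult)
  also note 1
  finally have 2: "\<bar>conv K s \<phi> x\<bar> \<le> (\<integral>y. f y \<partial>lborel) / \<bar>s\<bar> ^ CARD('n)" .
  have "(\<integral>y. f y \<partial>lborel) \<le> (\<integral>y. B * (indicator S y *\<^sub>R \<phi> y) \<partial>lborel)"
  proof (rule Bochner_Integration.integral_mono)
    show "integrable lborel f"
      by (rule integrable_compact_support[OF cf, where a = a and b = "x + (1/2) *\<^sub>R One"]) (use fS in \<open>simp add: S_def\<close>)
    show "integrable lborel (\<lambda>y. B * (indicator S y *\<^sub>R \<phi> y))"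
      unfolding S_def by (intro integrable_mult_right borel_integrable_compact compact_cbox continuous_on_subset[OF c\<phi>] subset_UNIV)
    show "f y \<le> B * (indicator S y *\<^sub>R \<phi> y)" for y
      using fS[of y] B[of "(1 / s) *\<^sub>R (x - y)"] \<phi>(2)[of y]
      by (cases "y \<in> S") (auto simp: f_def intro!: mult_right_mono)
  qed
  also have "\<dots> = B * (\<integral>y. indicator S y *\<^sub>R \<phi> y \<partial>lborel)" by (rule integral_mult_right_zero)
  also have "(\<integral>y. indicator S y *\<^sub>R \<phi> y \<partial>lborel) = (\<integral>y. indicator S (a + y) *\<^sub>R \<phi> (a + y) \<partial>lborel)"
    by (rule lborel_integral_translate[symmetric])
      (intro borel_measurable_scaleR borel_measurable_indicator borel_measurable_continuous_onI c\<phi>, simp add: S_def)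
  also have "\<dots> = (\<integral>y. indicator (cbox 0 One) y *\<^sub>R \<phi> (y + a) \<partial>lborel)"
  proof (rule Bochner_Integration.integral_cong[OF refl])
    fix y
    have "a + y \<in> S \<longleftrightarrow> y \<in> cbox 0 One" by (auto simp: S_def a_def mem_box_cart algebra_simps)
    then show "indicator S (a + y) *\<^sub>R \<phi> (a + y) = indicator (cbox 0 One) y *\<^sub>R \<phi> (y + a)"
      by (simp add: indicator_def add.commute)
  qed
  also have "\<dots> = (\<integral>y. \<phi> (y + a) \<partial>cube_measure)"
    unfolding cube_measure_def by (subst integral_restrict_space) auto
  also have "\<dots> = (\<integral>y. \<phi> y \<partial>cube_measure)" by (rule integral_cube_shift[OF \<phi>(1)])
  finally have "(\<integral>y. f y \<partial>lborel) / \<bar>s\<bar> ^ CARD('n) \<le> (B * (\<integral>y. \<phi> y \<partial>cube_measure)) / \<bar>s\<bar> ^ CARD('n)"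
    by (rule divide_right_mono) simp
  with 2 show ?thesis by simp
qed

section \<open>Decay at large scales and cancellation at small ones\<close>

lemma norm_cube_le: "w \<in> cbox 0 (One::real^'n) \<Longrightarrow> norm w \<le> CARD('n)"
proof -
  assume "w \<in> cbox 0 (One::real^'n)"
  then have "(\<Sum>i\<in>UNIV. \<bar>w $ i\<bar>) \<le> (\<Sum>i\<in>(UNIV::'n set). 1)" by (intro sum_mono) (simp add: mem_cube)
  then show ?thesis using norm_le_l1_cart[of w] by simp
qed

lemma conv_partials_bound:
  fixes K :: "real^'n \<Rightarrow> real"
  assumes K: "kernel (Suc 0) K"
  obtains C where "C \<ge> 0" "\<And>s F B x i. pcont F \<Longrightarrow> (\<And>x. \<bar>F x\<bar> \<le> B) \<Longrightarrow> \<bar>conv (partial i K) s F x\<bar> \<le> C * B"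
proof -
  define C where "C = (\<Sum>i\<in>UNIV. \<integral>z. \<bar>partial i K z\<bar> \<partial>lborel)"
  have le: "(\<integral>z. \<bar>partial i K z\<bar> \<partial>lborel) \<le> C" for i
    unfolding C_def by (rule member_le_sum) (auto intro: integral_nonneg_AE)
  have "C \<ge> 0" unfolding C_def by (intro sum_nonneg integral_nonneg_AE) auto
  moreover have "\<bar>conv (partial i K) s F x\<bar> \<le> C * B" if "pcont F" "\<And>x. \<bar>F x\<bar> \<le> B" for s F B x i
  proof -
    have "B \<ge> 0" using that(2)[of 0] by linarith
    then show ?thesis
      using conv_bound[OF kernel_partial[OF K] that, of i s x] mult_left_mono[OF le[of i], of B]
      by (simp add: mult.commute)
  qed
  ultimately show ?thesis using that by blast
qed

text \<open>At scale \<open>s\<close> the convolution varies by \<open>O(1/s)\<close> over a period, and it has mean zero.\<close>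

lemma conv_decay_mean_zero:
  fixes K :: "real^'n \<Rightarrow> real"
  assumes K: "kernel (Suc 0) K"
  obtains C where "C \<ge> 0" "\<And>(s::real) F B x. s > 0 \<Longrightarrow> pcont F \<Longrightarrow> (\<integral>x. F x \<partial>cube_measure) = 0 \<Longrightarrow> (\<And>x. \<bar>F x\<bar> \<le> B)
     \<Longrightarrow> \<bar>conv K s F x\<bar> \<le> C * B / s"
proof -
  obtain C where C: "C \<ge> 0" "\<And>s F B x i. pcont F \<Longrightarrow> (\<And>x. \<bar>F x\<bar> \<le> B) \<Longrightarrow> \<bar>conv (partial i K) s F x\<bar> \<le> C * B"
    using conv_partials_bound[OF K] by metis
  \<comment> \<open>One factor \<open>CARD('n)\<close> comes from the Lipschitz bound, the other
    from the size of the unit cube.\<close>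
  define C' where "C' = CARD('n) * C * CARD('n)"
  show ?thesis
  proof (rule that[of C'])
    show "C' \<ge> 0" using C by (simp add: C'_def)
    fix s B :: real and x :: "real^'n" and F :: "real^'n \<Rightarrow> real"
    assume s: "s > 0" and F: "pcont F" "(\<integral>x. F x \<partial>cube_measure) = 0" "\<And>x. \<bar>F x\<bar> \<le> B"
    have B: "B \<ge> 0" using F(3)[of 0] by linarith
    have pc: "pcont (conv K s F)" by (rule pcont_conv[OF K F(1)])
    have sn: "s \<noteq> 0" using s by simp
    have pb: "\<bar>partial i (conv K s F) x\<bar> \<le> C * B / s" for i x
      using C(2)[OF F(1,3), of i s x] s by (simp add: partial_conv_kernel[OF K F(1)] divide_right_mono)
    have lip: "\<bar>conv K s F y - conv K s F z\<bar> \<le> CARD('n) * (C * B / s) * norm (y - z)" for y z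
      using Lipschitz_partial[OF C_k_conv_kernel[OF K F(1) sn] pb, of y z] by simp
    have near: "\<bar>conv K s F x - conv K s F (x - w)\<bar> \<le> C' * B / s" if "w \<in> cbox 0 One" for w
    proof -
      have "CARD('n) * (C * B / s) * norm (x - (x - w)) \<le> CARD('n) * (C * B / s) * CARD('n)"
        using norm_cube_le[OF that] C B s by (intro mult_left_mono) auto
      then show ?thesis using lip[of x "x - w"] by (simp add: C'_def algebra_simps)
    qed
    have int: "integrable cube_measure (\<lambda>w. conv K s F (x - w))"
      by (rule integrable_cube_pcont[OF pcont_reflect[OF pc]])
    \<comment> \<open>Subtracting this vanishing average turns the value at \<open>x\<close> into an
      average of differences over one period.\<close>
    have "(\<integral>w. conv K s F (x - w) \<partial>cube_measure) = 0"
      using integral_cube_reflect[OF pc, of x] integral_conv[OF K F(1), of s] F(2) by simp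
    then have "conv K s F x = (\<integral>w. conv K s F x - conv K s F (x - w) \<partial>cube_measure)"
      using int by simp
    also have "\<bar>\<dots>\<bar> \<le> (\<integral>w. \<bar>conv K s F x - conv K s F (x - w)\<bar> \<partial>cube_measure)"
      by (rule integral_abs_bound)
    also have "\<dots> \<le> (\<integral>w. C' * B / s \<partial>(cube_measure :: (real^'n) measure))"
      using near int by (intro Bochner_Integration.integral_mono) auto
    finally show "\<bar>conv K s F x\<bar> \<le> C' * B / s" by simp
  qed
qed

lemma abs_integral_cube_le:
  assumes "pcont F" "\<And>x. \<bar>F x\<bar> \<le> B"
  shows "\<bar>\<integral>x. F x \<partial>cube_measure\<bar> \<le> B"
proof -
  have "\<bar>\<integral>x. F x \<partial>cube_measure\<bar> \<le> (\<integral>x. \<bar>F x\<bar> \<partial>cube_measure)" by (rule integral_abs_bound)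
  also have "\<dots> \<le> (\<integral>x. B \<partial>(cube_measure :: (real^'a) measure))"
    using assms by (intro Bochner_Integration.integral_mono integrable_cube_pcont pcont_abs pcont_const)
  finally show ?thesis by simp
qed

text \<open>Split off the mean of \<open>F\<close>, which convolution multiplies by the integral of
  the kernel; the rest has mean zero and is at most \<open>2 * B\<close>.\<close>

lemma conv_decay:
  fixes K :: "real^'n \<Rightarrow> real"
  assumes K: "kernel (Suc 0) K"
  obtains C where "C \<ge> 0" "\<And>(s::real) F B x. s > 0 \<Longrightarrow> pcont F \<Longrightarrow> (\<And>x. \<bar>F x\<bar> \<le> B)
     \<Longrightarrow> \<bar>conv K s F x - (\<integral>x. F x \<partial>cube_measure) * (\<integral>z. K z \<partial>lborel)\<bar> \<le> C * B / s"
proof -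
  obtain C where C: "C \<ge> 0" "\<And>(s::real) F B x. s > 0 \<Longrightarrow> pcont F \<Longrightarrow> (\<integral>x. F x \<partial>cube_measure) = 0 \<Longrightarrow> (\<And>x. \<bar>F x\<bar> \<le> B)
     \<Longrightarrow> \<bar>conv K s F x\<bar> \<le> C * B / s"
    using conv_decay_mean_zero[OF K] by metis
  show ?thesis
  proof (rule that[of "2 * C"])
    show "2 * C \<ge> 0" using C by simp
    fix s B :: real and x :: "real^'n" and F :: "real^'n \<Rightarrow> real"
    assume s: "s > 0" and F: "pcont F" "\<And>x. \<bar>F x\<bar> \<le> B"
    define m where "m = (\<integral>x. F x \<partial>cube_measure)"
    have m: "\<bar>m\<bar> \<le> B" unfolding m_def by (rule abs_integral_cube_le[OF F])
    have "\<bar>conv K s (\<lambda>x. F x - m) x\<bar> \<le> C * (2 * B) / s"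
    proof (rule C(2)[OF s])
      show "pcont (\<lambda>x. F x - m)" by (intro pcont_diff F pcont_const)
      show "(\<integral>x. F x - m \<partial>cube_measure) = 0" using integrable_cube_pcont[OF F(1)] by (simp add: m_def)
      show "\<bar>F x - m\<bar> \<le> 2 * B" for x using F(2)[of x] m by linarith
    qed
    then show "\<bar>conv K s F x - (\<integral>x. F x \<partial>cube_measure) * (\<integral>z. K z \<partial>lborel)\<bar> \<le> 2 * C * B / s"
      unfolding conv_diff[OF K F(1) pcont_const] conv_const m_def by (simp add: algebra_simps)
  qed
qed

lemma conv_zero_mean_kernel:
  assumes K: "kernel k K" "(\<integral>z. K z \<partial>lborel) = 0" and F: "pcont F"
  shows "conv K s F x = (\<integral>z. K z * (F (x - s *\<^sub>R z) - F x) \<partial>lborel)"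
  using conv_diff[OF K(1) F pcont_const[of "F x"], of s x] K(2) by (simp add: conv_const) (simp add: conv_def)

text \<open>The mean-zero kernel allows subtracting \<open>F x\<close>. The modulus of continuity is
  asked for at the centre \<open>x\<close> only and \<open>\<gamma>\<close> may exceed 1:
  \<open>quad_double\<close> applies this to a product of increments that is small just at that
  point.\<close>

lemma conv_Hoelder:
  assumes K: "kernel k K" "(\<integral>z. K z \<partial>lborel) = 0" and F: "pcont F"
    and H: "\<And>y. \<bar>F y - F x\<bar> \<le> H * norm (y - x) powr \<gamma>" "H \<ge> 0" and \<gamma>: "\<gamma> > 0"
  shows "\<bar>conv K s F x\<bar> \<le> H * \<bar>s\<bar> powr \<gamma> * (\<integral>z. \<bar>K z\<bar> \<partial>lborel)"
proof -
  have c: "continuous_on UNIV (\<lambda>z. F (x - s *\<^sub>R z) - F x)"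
    by (rule continuous_on_diff[OF continuous_scaled[OF pcontD(2)[OF F]] continuous_on_const])
  have "\<bar>conv K s F x\<bar> \<le> (\<integral>z. \<bar>K z * (F (x - s *\<^sub>R z) - F x)\<bar> \<partial>lborel)"
    unfolding conv_zero_mean_kernel[OF K F] by (rule integral_abs_bound)
  also have "\<dots> \<le> (\<integral>z. (H * \<bar>s\<bar> powr \<gamma>) * \<bar>K z\<bar> \<partial>lborel)"
  proof (rule Bochner_Integration.integral_mono)
    show "integrable lborel (\<lambda>z. \<bar>K z * (F (x - s *\<^sub>R z) - F x)\<bar>)"
      by (intro integrable_abs integrable_kernel[OF K(1) c])
    show "integrable lborel (\<lambda>z. (H * \<bar>s\<bar> powr \<gamma>) * \<bar>K z\<bar>)"
      by (intro integrable_mult_right integrable_kernel_1[OF kernel_abs[OF K(1)]])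
    fix z
    show "\<bar>K z * (F (x - s *\<^sub>R z) - F x)\<bar> \<le> (H * \<bar>s\<bar> powr \<gamma>) * \<bar>K z\<bar>"
    proof (cases "norm z > 1/2")
      case True
      then show ?thesis using kernelD(3)[OF K(1)] by simp
    next
      case False
      have "\<bar>F (x - s *\<^sub>R z) - F x\<bar> \<le> H * norm (s *\<^sub>R z) powr \<gamma>" using H(1)[of "x - s *\<^sub>R z"] by simp
      also have "\<dots> \<le> H * \<bar>s\<bar> powr \<gamma>"
      proof (intro mult_left_mono powr_mono2 H(2))
        show "norm (s *\<^sub>R z) \<le> \<bar>s\<bar>"
          using False mult_left_mono[of "norm z" 1 "\<bar>s\<bar>"] by simp
      qed (use \<gamma> in simp_all)
      finally have "\<bar>F (x - s *\<^sub>R z) - F x\<bar> * \<bar>K z\<bar> \<le> (H * \<bar>s\<bar> powr \<gamma>) * \<bar>K z\<bar>"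
        by (rule mult_right_mono) simp
      moreover have "\<bar>K z * (F (x - s *\<^sub>R z) - F x)\<bar> = \<bar>F (x - s *\<^sub>R z) - F x\<bar> * \<bar>K z\<bar>"
        unfolding abs_mult by (rule mult.commute)
      ultimately show ?thesis by (simp only:)
    qed
  qed
  finally show ?thesis by simp
qed

subsection \<open>The bump kernel and a representation of mean-free functions\<close>

text \<open>A truncated polynomial: \<open>bump m\<close> has at least \<open>m - 1\<close>
  continuous derivatives, and for \<open>m \<ge> 2\<close> its gradient is an explicit multiple of
  \<open>z\<close> times the bump of one degree less.\<close>

definition bump :: "nat \<Rightarrow> real^'n \<Rightarrow> real" where
  "bump m z = (max 0 (1/4 - z \<bullet> z)) ^ m"

lemma DERIV_max_power:
  assumes "m \<ge> 1"
  shows "((\<lambda>t::real. (max 0 t) ^ Suc m) has_field_derivative (1 + real m) * (max 0 t) ^ m) (at t)"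
proof -
  consider "t < 0" | "t > 0" | "t = 0" by linarith
  then show ?thesis
  proof cases
    case 1
    have "((\<lambda>t::real. 0) has_field_derivative (1 + real m) * (max 0 t) ^ m) (at t)"
      using 1 assms by (simp add: power_0_left)
    then show ?thesis
      by (rule has_field_derivative_transform_within_open[where S = "{..<0}"]) (use 1 in auto)
  next
    case 2
    have "((\<lambda>t::real. t ^ Suc m) has_field_derivative (1 + real m) * (max 0 t) ^ m) (at t)"
      using 2 DERIV_pow[of "Suc m" t] by (simp add: algebra_simps)
    then show ?thesis
      by (rule has_field_derivative_transform_within_open[where S = "{0<..}"]) (use 2 in auto)
  next
    \<comment> \<open>At 0 the difference quotient equals \<open>(max 0 y) ^ m\<close>, which tends
      to 0 since \<open>m \<ge> 1\<close>.\<close>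
    case 3
    have "((\<lambda>y::real. (max 0 y) ^ m) \<longlongrightarrow> (max 0 0) ^ m) (at 0)"
      by (intro tendsto_intros)
    then have "((\<lambda>y::real. (max 0 y) ^ m) \<longlongrightarrow> 0) (at 0)" using assms by (simp add: power_0_left)
    moreover have "\<forall>\<^sub>F y in at 0. (max 0 y) ^ m = ((max 0 y) ^ Suc m - (max 0 0) ^ Suc m) / (y - (0::real))"
      unfolding eventually_at using assms
      by (intro exI[of _ 1]) (auto simp: max_def power_0_left)
    ultimately have "((\<lambda>y::real. ((max 0 y) ^ Suc m - (max 0 0) ^ Suc m) / (y - 0)) \<longlongrightarrow> 0) (at 0)"
      by (rule Lim_transform_eventually)
    then show ?thesis using 3 assms by (simp add: has_field_derivative_iff power_0_left)
  qed
qed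

lemma bump_has_derivative:
  assumes "m \<ge> 1"
  shows "(bump (Suc m) has_derivative (\<lambda>h. - 2 * (1 + real m) * (z \<bullet> h) * bump m z)) (at z)"
proof -
  have 1: "((\<lambda>z. 1/4 - z \<bullet> z) has_derivative (\<lambda>h. - 2 * (z \<bullet> h))) (at z)"
    by (auto intro!: derivative_eq_intros simp: inner_commute)
  have "((\<lambda>z. (max 0 (1/4 - z \<bullet> z)) ^ Suc m) has_derivative
      (\<lambda>h. ((1 + real m) * (max 0 (1/4 - z \<bullet> z)) ^ m) * (- 2 * (z \<bullet> h)))) (at z)"
    using has_derivative_compose[OF 1 DERIV_max_power[OF assms, unfolded has_field_derivative_def]] .
  then show ?thesis unfolding bump_def[abs_def] by (simp add: algebra_simps)
qed

lemma partial_bump: "m \<ge> 1 \<Longrightarrow> partial i (bump (Suc m)) z = - 2 * (1 + real m) * z $ i * bump m z"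
  by (subst partial_eq[OF bump_has_derivative]) (auto simp: inner_axis)

lemma C_k_bump: "n < m \<Longrightarrow> C_k n (bump m :: real^'n \<Rightarrow> real)"
proof (induction n arbitrary: m)
  case 0
  then show ?case unfolding bump_def by (auto intro!: continuous_intros)
next
  case (Suc n)
  then obtain m' where m': "m = Suc m'" "m' \<ge> 1" "n < m'" by (cases m) auto
  show ?case unfolding m'(1)
  proof (rule C_k_SucI[OF bump_has_derivative[OF m'(2)]])
    fix i
    have "C_k n (\<lambda>x::real^'n. (- 2 * (1 + real m')) * (x $ i) * bump m' x)"
      by (intro C_k_mult C_k_const C_k_coord Suc.IH[OF m'(3)])
    then show "C_k n (\<lambda>x::real^'n. - 2 * (1 + real m') * (x \<bullet> axis i 1) * bump m' x)"
      by (simp add: inner_axis)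
  qed
qed

lemma kernel_bump: "n < m \<Longrightarrow> kernel n (bump m)"
proof -
  assume nm: "n < m"
  have "bump m z = 0" if "norm z > 1/2" for z :: "real^'b"
  proof -
    have "(1/2)\<^sup>2 < (norm z)\<^sup>2" using that by (intro power_strict_mono) auto
    then have "1/4 - z \<bullet> z < 0" by (simp add: dot_square_norm power2_eq_square)
    then show ?thesis using nm by (simp add: bump_def power_0_left)
  qed
  then show ?thesis using C_k_bump[OF nm] by (auto simp: kernel_def)
qed

text \<open>The pair is chosen so that the gradient of \<open>\<Phi>\<^sub>0\<close> is \<open>- z * G\<^sub>0 z\<close>; this is what turns the derivative of
  \<open>conv G\<^sub>0 s \<psi>\<close> in \<open>s\<close> into \<open>s * conv \<Phi>\<^sub>0 s (laplacian \<psi>)\<close>. The proof of the \<open>C1\<close> estimate differentiates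
  \<open>\<Phi>\<^sub>0\<close> five times, hence the high powers.\<close>

definition G\<^sub>0 :: "real^'n \<Rightarrow> real" where "G\<^sub>0 = bump 7"
definition \<Phi>\<^sub>0 :: "real^'n \<Rightarrow> real" where "\<Phi>\<^sub>0 = (\<lambda>z. (1/16) * bump 8 z)"

lemma kernel_G0: "kernel 6 G\<^sub>0" by (simp add: G\<^sub>0_def kernel_bump)

lemma kernel_Phi0: "kernel 7 \<Phi>\<^sub>0"
  unfolding \<Phi>\<^sub>0_def by (intro kernel_mult[OF kernel_bump] C_k_const) simp

text \<open>Differentiating \<open>bump 8\<close> produces the factor \<open>- 2 * 8\<close>; the
  \<open>1/16\<close> in \<open>\<Phi>\<^sub>0\<close> cancels it up to the sign.\<close>

lemma partial_Phi0: "partial i \<Phi>\<^sub>0 z = - (z $ i * G\<^sub>0 z)"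
proof -
  have "C_k (Suc 0) (bump 8)" by (rule C_k_bump) simp
  from partial_cmult[OF this, of i "1/16" z] show ?thesis
    using partial_bump[of 7 i z] by (simp add: \<Phi>\<^sub>0_def G\<^sub>0_def)
qed

text \<open>The dimension enters through the type alone, hence the type argument.\<close>

definition bump_mass :: "'n::finite itself \<Rightarrow> real" where
  "bump_mass _ = (\<integral>z. (G\<^sub>0 :: real^'n \<Rightarrow> real) z \<partial>lborel)"

text \<open>A continuous nonnegative function with zero integral would vanish at 0, where the bump
  is positive.\<close>

lemma bump_mass_pos: "bump_mass TYPE('n::finite) > 0"
proof -
  have K: "kernel 6 (G\<^sub>0 :: real^'n \<Rightarrow> real)" by (rule kernel_G0)
  have nn: "G\<^sub>0 z \<ge> 0" for z :: "real^'n" by (simp add: G\<^sub>0_def bump_def)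
  have c: "continuous_on (box_of 1) (G\<^sub>0 :: real^'n \<Rightarrow> real)"
    using kernelD(1)[OF K] continuous_on_subset by blast
  have eq: "bump_mass TYPE('n) = integral (box_of 1) (G\<^sub>0 :: real^'n \<Rightarrow> real)"
    unfolding bump_mass_def using integral_kernel[OF K, of "\<lambda>_. 1" 1] by simp
  have int: "(G\<^sub>0 has_integral bump_mass TYPE('n)) (box_of 1 :: (real^'n) set)"
    unfolding eq by (intro integrable_integral integrable_continuous c)
  have "bump_mass TYPE('n) \<noteq> 0"
  proof
    assume "bump_mass TYPE('n) = 0"
    then have "G\<^sub>0 (0 :: real^'n) = 0"
      using int by (intro has_integral_0_cbox_imp_0[OF c nn]) (auto simp: mem_box_cart box_ne_empty One_inner inner_minus_left)
    then show False by (simp add: G\<^sub>0_def bump_def)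
  qed
  moreover have "bump_mass TYPE('n) \<ge> 0"
    unfolding bump_mass_def by (intro integral_nonneg_AE) (simp add: nn)
  ultimately show ?thesis by simp
qed

text \<open>Undoes the reflected scale that \<open>conv_adjoint\<close> produces.\<close>

lemma conv_even:
  fixes K :: "real^'n \<Rightarrow> real"
  assumes K: "kernel k K" and F: "pcont F" and even: "\<And>z. K (- z) = K z"
  shows "conv K (- s) F x = conv K s F x"
proof -
  have "conv K s F x = \<bar>- 1\<bar> ^ DIM(real^'n) * (\<integral>z. K (0 + (- 1) *\<^sub>R z) * F (x - s *\<^sub>R (0 + (- 1) *\<^sub>R z)) \<partial>lborel)"
    unfolding conv_def
    by (rule lborel_integral_affine)
      (intro borel_measurable_continuous_onI continuous_on_mult kernelD(1)[OF K] continuous_scaled[OF pcontD(2)[OF F]], simp)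
  then show ?thesis by (simp add: conv_def even)
qed

lemma Phi0_even: "\<Phi>\<^sub>0 (- z) = \<Phi>\<^sub>0 z" by (simp add: \<Phi>\<^sub>0_def bump_def)

text \<open>Convolve with \<open>G\<^sub>0\<close> and integrate: moved to the kernel, the
  derivative integrates to 0, while convolution multiplies the integral by the positive
  \<open>bump_mass\<close>. No boundary terms on the cube have to be cancelled.\<close>

lemma integral_partial_cube:
  fixes \<phi> :: "real^'n \<Rightarrow> real"
  assumes \<phi>: "test_function \<phi>"
  shows "(\<integral>x. partial i \<phi> x \<partial>cube_measure) = 0"
proof -
  have K: "kernel (Suc 0) (G\<^sub>0 :: real^'n \<Rightarrow> real)" by (rule kernel_mono[OF kernel_G0]) simp
  have "(\<integral>x. conv (partial i G\<^sub>0) 1 \<phi> x \<partial>cube_measure) = 0"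
    by (subst integral_conv[OF kernel_partial[OF K] test_function_pcont[OF \<phi>]]) (simp add: integral_partial_kernel[OF K])
  moreover have "conv (partial i G\<^sub>0) 1 \<phi> x = conv G\<^sub>0 1 (partial i \<phi>) x" for x
    using conv_partial_swap[OF K test_functionD(1)[OF \<phi>] test_functionD(2)[OF \<phi>], of 1 i x] by simp
  ultimately have "(\<integral>x. partial i \<phi> x \<partial>cube_measure) * bump_mass TYPE('n) = 0"
    using integral_conv[OF K test_function_pcont[OF test_function_partial[OF \<phi>]], of 1 i] by (simp add: bump_mass_def)
  then show ?thesis using bump_mass_pos[where 'n = 'n] by simp
qed

text \<open>The chain rule on \<open>\<psi> (x - s *\<^sub>R z)\<close> brings down
  \<open>- z $ i\<close> in each direction, which is absorbed into the kernel.\<close>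

lemma conv_scale_derivative:
  fixes K \<psi> :: "real^'n \<Rightarrow> real"
  assumes K: "kernel k K" and \<psi>: "periodic \<psi>" "C_k (Suc 0) \<psi>"
  shows "((\<lambda>s. conv K s \<psi> x) has_field_derivative (\<Sum>i\<in>UNIV. conv (\<lambda>z. - (z $ i * K z)) s (partial i \<psi>) x)) (at s)"
proof -
  have p: "pcont \<psi>" "pcont (partial i \<psi>)" for i
    using pcont_C_k[OF \<psi>] pcont_C_k[OF periodic_partial[OF \<psi>] C_k_partial[OF \<psi>(2)]] by auto
  have cK: "continuous_on UNIV K" by (rule kernelD(1)[OF K])
  have Ki: "kernel 0 (\<lambda>z. - (z $ i * K z))" for i
    using kernel_mult[OF kernel_mono[OF K], of 0 "\<lambda>z. (-1) * z $ i"] C_k_mult[OF C_k_const C_k_coord, of 0 "-1" i] by simp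
  define fx where "fx = (\<lambda>s z. \<Sum>i\<in>UNIV. (- (z $ i * K z)) * partial i \<psi> (x - s *\<^sub>R z))"
  have "((\<lambda>s. integral (box_of (1/2)) (\<lambda>z. K z * \<psi> (x - s *\<^sub>R z))) has_field_derivative integral (box_of (1/2)) (fx s)) (at s within UNIV)"
  proof (rule leibniz_rule_field_derivative)
    fix s and z :: "real^'n"
    have "((\<lambda>s. x - s *\<^sub>R z) has_derivative (\<lambda>h. - (h *\<^sub>R z))) (at s)"
      by (auto intro!: derivative_eq_intros)
    then have "((\<lambda>s. K z * \<psi> (x - s *\<^sub>R z)) has_derivative (\<lambda>h. K z * (\<Sum>i\<in>UNIV. (- (h *\<^sub>R z)) $ i * partial i \<psi> (x - s *\<^sub>R z)))) (at s)"
      by (intro has_derivative_mult_right has_derivative_compose[OF _ C_k_Suc_has_derivative[OF \<psi>(2)]])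
    also have "(\<lambda>h. K z * (\<Sum>i\<in>UNIV. (- (h *\<^sub>R z)) $ i * partial i \<psi> (x - s *\<^sub>R z))) = (*) (fx s z)"
      by (auto simp: fx_def fun_eq_iff sum_distrib_left sum_distrib_right algebra_simps)
    finally show "((\<lambda>s. K z * \<psi> (x - s *\<^sub>R z)) has_field_derivative fx s z) (at s within UNIV)"
      by (simp add: has_field_derivative_def)
  next
    show "(\<lambda>z. K z * \<psi> (x - s *\<^sub>R z)) integrable_on box_of (1/2)" for s
      by (intro integrable_continuous continuous_on_mult continuous_on_UNIV_compose[OF cK]
          continuous_on_UNIV_compose[OF pcontD(2)[OF p(1)]] continuous_intros)
    show "continuous_on (UNIV \<times> box_of (1/2)) (\<lambda>(s, z). fx s z)"
      unfolding fx_def case_prod_beta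
      by (intro continuous_on_sum continuous_on_mult continuous_on_minus continuous_on_UNIV_compose[OF cK]
          continuous_on_UNIV_compose[OF pcontD(2)[OF p(2)]] continuous_intros)
  qed auto
  moreover have "integral (box_of (1/2)) (fx s) = (\<Sum>i\<in>UNIV. conv (\<lambda>z. - (z $ i * K z)) s (partial i \<psi>) x)"
  proof -
    have "(\<lambda>z. (- (z $ i * K z)) * partial i \<psi> (x - s *\<^sub>R z)) integrable_on box_of (1/2)" for i
      by (intro integrable_continuous continuous_on_mult continuous_on_minus continuous_on_UNIV_compose[OF cK]
          continuous_on_UNIV_compose[OF pcontD(2)[OF p(2)]] continuous_intros)
    then show ?thesis unfolding fx_def by (subst integral_sum) (simp_all add: conv_box[OF Ki p(2), of "1/2"])
  qed
  ultimately show ?thesis using conv_box[OF K p(1), of "1/2"] by simp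
qed

lemma conv_G0_derivative:
  fixes \<psi> :: "real^'n \<Rightarrow> real"
  assumes \<psi>: "test_function \<psi>" and s: "s \<noteq> 0"
  shows "((\<lambda>s. conv G\<^sub>0 s \<psi> x) has_field_derivative s * conv \<Phi>\<^sub>0 s (laplacian \<psi>) x) (at s)"
proof -
  have K: "kernel (Suc 0) (\<Phi>\<^sub>0 :: real^'n \<Rightarrow> real)" by (rule kernel_mono[OF kernel_Phi0]) simp
  have t: "test_function (partial i \<psi>)" for i by (rule test_function_partial[OF \<psi>])
  have "(\<Sum>i\<in>UNIV. conv (\<lambda>z. - (z $ i * G\<^sub>0 z)) s (partial i \<psi>) x) = (\<Sum>i\<in>UNIV. conv (partial i \<Phi>\<^sub>0) s (partial i \<psi>) x)"
    by (simp add: partial_Phi0[abs_def, symmetric])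
  also have "\<dots> = (\<Sum>i\<in>UNIV. s * conv \<Phi>\<^sub>0 s (partial i (partial i \<psi>)) x)"
    using conv_partial_swap[OF K test_functionD(1)[OF t] test_functionD(2)[OF t] s] by simp
  also have "\<dots> = s * conv \<Phi>\<^sub>0 s (laplacian \<psi>) x"
    unfolding laplacian_def[abs_def]
    by (subst conv_sum[OF K]) (auto simp: sum_distrib_left intro: test_function_pcont test_function_partial t)
  finally show ?thesis
    using conv_scale_derivative[OF kernel_G0 test_functionD(1)[OF \<psi>] test_functionD(2)[OF \<psi>], of x s] by simp
qed

subsection \<open>Integrals over all scales\<close>

lemma set_integral_powr:
  fixes S :: "real set"
  assumes "((\<lambda>s. s powr a) has_integral I) S" "S \<in> sets borel"
  shows "integrable lborel (\<lambda>s. indicator S s * s powr a)" "(\<integral>s. indicator S s * s powr a \<partial>lborel) = I"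
proof -
  have "I \<ge> 0" using has_integral_nonneg[OF assms(1)] by simp
  have "has_bochner_integral lborel (\<lambda>s. indicator S s * s powr a) I"
  proof (rule has_bochner_integral_nn_integral)
    show "(\<lambda>s. indicator S s * s powr a) \<in> borel_measurable lborel" using assms(2) by measurable
    show "(\<integral>\<^sup>+ s. ennreal (indicator S s * s powr a) \<partial>lborel) = ennreal I"
      using nn_integral_has_integral_lebesgue[OF _ assms(1)] by simp
  qed (use \<open>I \<ge> 0\<close> in auto)
  then show "integrable lborel (\<lambda>s. indicator S s * s powr a)" "(\<integral>s. indicator S s * s powr a \<partial>lborel) = I"
    by (auto simp: has_bochner_integral_iff)
qed

text \<open>The split point \<open>r\<close> is a parameter: it is 1 when integrability is at stake
  and the distance of two points in Hoelder estimates.\<close>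

lemma scale_integral_bound:
  fixes q :: "real \<Rightarrow> real"
  assumes q: "q \<in> borel_measurable borel" and \<alpha>: "\<alpha> > 0" and e: "e < - 1" and r: "r > 0" and AD: "A \<ge> 0" "D \<ge> 0"
    and small: "\<And>s. 0 < s \<Longrightarrow> s \<le> r \<Longrightarrow> \<bar>q s\<bar> \<le> A * s powr (\<alpha> - 1)"
    and large: "\<And>s. r < s \<Longrightarrow> \<bar>q s\<bar> \<le> D * s powr e"
  shows "set_integrable lborel {0<..} q" (is ?A)
    "\<bar>LBINT s:{0<..}. q s\<bar> \<le> A * (r powr \<alpha> / \<alpha>) + D * (- (r powr (e + 1)) / (e + 1))" (is ?B)
proof -
  note i0 = set_integral_powr[OF has_integral_powr_from_0[of "\<alpha> - 1" r]]
  note i1 = set_integral_powr[OF has_integral_powr_to_inf[OF e r]]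
  define dom where "dom = (\<lambda>s. A * (indicator {0..r} s * s powr (\<alpha> - 1)) + D * (indicator {r..} s * s powr e))"
  have dom: "integrable lborel dom" "(\<integral>s. dom s \<partial>lborel) = A * (r powr \<alpha> / \<alpha>) + D * (- (r powr (e + 1)) / (e + 1))"
    using i0 i1 \<alpha> r by (auto simp: dom_def)
  have le: "\<bar>indicator {0<..} s *\<^sub>R q s\<bar> \<le> dom s" for s
  proof -
    consider "s \<le> 0" | "0 < s" "s \<le> r" | "r < s" by linarith
    then show ?thesis
    proof cases
      case 1
      then show ?thesis using AD by (simp add: dom_def)
    next
      case 2
      have "0 \<le> D * (indicator {r..} s * s powr e)" using AD by simp
      then show ?thesis using small[OF 2] 2 by (simp add: dom_def)
    next
      case 3
      then show ?thesis using large[OF 3] AD r by (simp add: dom_def)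
    qed
  qed
  show A: ?A unfolding set_integrable_def
  proof (rule Bochner_Integration.integrable_bound[OF dom(1)])
    show "(\<lambda>s. indicator {0<..} s *\<^sub>R q s) \<in> borel_measurable lborel" using q by measurable
    show "AE s in lborel. norm (indicator {0<..} s *\<^sub>R q s) \<le> norm (dom s)"
      using le by (intro AE_I2) (metis abs_ge_self order_trans real_norm_def)
  qed
  have "\<bar>LBINT s:{0<..}. q s\<bar> \<le> (\<integral>s. \<bar>indicator {0<..} s *\<^sub>R q s\<bar> \<partial>lborel)"
    unfolding set_lebesgue_integral_def by (rule integral_abs_bound)
  also have "\<dots> \<le> (\<integral>s. dom s \<partial>lborel)"
    using A le dom(1) unfolding set_integrable_def by (intro Bochner_Integration.integral_mono integrable_abs) auto
  finally show ?B by (simp only: dom(2))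
qed

lemma continuous_conv2:
  fixes K F :: "real^'n \<Rightarrow> real"
  assumes K: "kernel k K" and F: "pcont F"
  shows "continuous_on UNIV (\<lambda>p. conv K (fst p) F (snd p))"
proof -
  have "continuous_on UNIV (\<lambda>p::real \<times> (real^'n). integral (box_of (1/2)) (\<lambda>z. K z * F (snd p - fst p *\<^sub>R z)))"
    by (rule integral_continuous_on_param)
      (auto simp: case_prod_beta intro!: continuous_on_mult continuous_on_UNIV_compose[OF kernelD(1)[OF K]]
        continuous_on_UNIV_compose[OF pcontD(2)[OF F]] continuous_intros)
  then show ?thesis using conv_box[OF K F, of "1/2"] by simp
qed

lemma measurable_conv2 [measurable]:
  assumes K: "kernel k K" and F: "pcont F"
  shows "(\<lambda>p. conv K (fst p) F (snd p)) \<in> borel_measurable (borel \<Otimes>\<^sub>M borel)"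
  unfolding borel_prod by (rule borel_measurable_continuous_onI[OF continuous_conv2[OF K F]])

lemma continuous_conv_scale:
  assumes K: "kernel k K" and F: "pcont F"
  shows "continuous_on UNIV (\<lambda>s. conv K s F x)"
  using continuous_on_UNIV_compose[OF continuous_conv2[OF K F], of UNIV "\<lambda>s. (s, x)"]
  by (simp add: continuous_on_Pair)

lemma measurable_conv_scale:
  assumes K: "kernel k K" and F: "pcont F"
  shows "(\<lambda>s. conv K s F x) \<in> borel_measurable borel"
  by (rule borel_measurable_continuous_onI[OF continuous_conv_scale[OF K F]])

text \<open>Moving both derivatives to the kernel turns the factor \<open>s\<close> into
  \<open>1 / s\<close>; the second derivatives of the kernel have mean zero, so
  \<open>conv_decay\<close> contributes another \<open>1 / s\<close>.\<close>

lemma conv_laplacian_decay: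
  fixes \<psi> :: "real^'n \<Rightarrow> real"
  assumes \<psi>: "test_function \<psi>"
  obtains D where "D \<ge> 0" "\<And>s x. s > 0 \<Longrightarrow> \<bar>s * conv \<Phi>\<^sub>0 s (laplacian \<psi>) x\<bar> \<le> D * s powr (- 2)"
proof -
  have K: "kernel (Suc (Suc (Suc 0))) (\<Phi>\<^sub>0 :: real^'n \<Rightarrow> real)" by (rule kernel_mono[OF kernel_Phi0]) simp
  have K1: "kernel (Suc 0) (\<Phi>\<^sub>0 :: real^'n \<Rightarrow> real)" by (rule kernel_mono[OF K]) simp
  have Ki: "kernel (Suc (Suc 0)) (partial i (\<Phi>\<^sub>0 :: real^'n \<Rightarrow> real))" for i by (rule kernel_partial[OF K])
  have Ki1: "kernel (Suc 0) (partial i (\<Phi>\<^sub>0 :: real^'n \<Rightarrow> real))" for i by (rule kernel_mono[OF Ki]) simp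
  have Kii: "kernel (Suc 0) (partial i (partial i (\<Phi>\<^sub>0 :: real^'n \<Rightarrow> real)))" for i by (rule kernel_partial[OF Ki])
  have t: "test_function (partial i \<psi>)" for i by (rule test_function_partial[OF \<psi>])
  obtain B where B: "B \<ge> 0" "\<And>x. \<bar>\<psi> x\<bar> \<le> B" using pcont_bounded[OF test_function_pcont[OF \<psi>]] by blast
  have "\<exists>C\<ge>0. \<forall>s>0. \<forall>x. \<bar>conv (partial i (partial i \<Phi>\<^sub>0)) s \<psi> x\<bar> \<le> C / s" for i :: 'n
  proof -
    obtain C where C: "C \<ge> 0" "\<And>(s::real) F B x. s > 0 \<Longrightarrow> pcont F \<Longrightarrow> (\<And>x. \<bar>F x\<bar> \<le> B)
     \<Longrightarrow> \<bar>conv (partial i (partial i \<Phi>\<^sub>0)) s F x - (\<integral>x. F x \<partial>cube_measure) * (\<integral>z. partial i (partial i \<Phi>\<^sub>0) z \<partial>lborel)\<bar> \<le> C * B / s"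
      using conv_decay[OF Kii[of i]] by metis
    have "(\<integral>z. partial i (partial i (\<Phi>\<^sub>0 :: real^'n \<Rightarrow> real)) z \<partial>lborel) = 0"
      by (rule integral_partial_kernel[OF Ki1])
    then show ?thesis using C(2)[OF _ test_function_pcont[OF \<psi>] B(2)] C(1) B(1) by (intro exI[of _ "C * B"]) auto
  qed
  then obtain C where C: "\<And>i. C i \<ge> 0" "\<And>i s x. s > 0 \<Longrightarrow> \<bar>conv (partial i (partial i \<Phi>\<^sub>0)) s \<psi> x\<bar> \<le> C i / s"
    by metis
  show ?thesis
  proof (rule that[of "\<Sum>i\<in>UNIV. C i"])
    show "(\<Sum>i\<in>UNIV. C i) \<ge> 0" by (intro sum_nonneg C)
    fix s :: real and x :: "real^'n" assume s: "s > 0"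
    then have s0: "s \<noteq> 0" by simp
    have "s * conv \<Phi>\<^sub>0 s (laplacian \<psi>) x = (\<Sum>i\<in>UNIV. s * conv \<Phi>\<^sub>0 s (partial i (partial i \<psi>)) x)"
      unfolding laplacian_def[abs_def]
      by (subst conv_sum[OF K]) (auto simp: sum_distrib_left intro: test_function_pcont test_function_partial t)
    also have "\<dots> = (\<Sum>i\<in>UNIV. conv (partial i (partial i \<Phi>\<^sub>0)) s \<psi> x / s)"
      using conv_partial_swap[OF K1 test_functionD(1)[OF t] test_functionD(2)[OF t] s0]
        conv_partial_swap[OF Ki1 test_functionD(1)[OF \<psi>] test_functionD(2)[OF \<psi>] s0] s0 by simp
    also have "\<bar>\<dots>\<bar> \<le> (\<Sum>i\<in>UNIV. \<bar>conv (partial i (partial i \<Phi>\<^sub>0)) s \<psi> x / s\<bar>)" by (rule sum_abs)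
    also have "\<dots> \<le> (\<Sum>i\<in>UNIV. C i * s powr (- 2))"
    proof (rule sum_mono)
      fix i
      have "\<bar>conv (partial i (partial i \<Phi>\<^sub>0)) s \<psi> x / s\<bar> \<le> (C i / s) / s"
        using divide_right_mono[OF C(2)[OF s, of i x], of s] s by simp
      also have "\<dots> = C i * s powr (- 2)"
        using s powr_minus[of s 2] powr_numeral[of s "num.Bit0 num.One"] by (simp add: power2_eq_square field_simps)
      finally show "\<bar>conv (partial i (partial i \<Phi>\<^sub>0)) s \<psi> x / s\<bar> \<le> C i * s powr (- 2)" .
    qed
    finally show "\<bar>s * conv \<Phi>\<^sub>0 s (laplacian \<psi>) x\<bar> \<le> (\<Sum>i\<in>UNIV. C i) * s powr (- 2)"
      by (simp add: sum_distrib_right)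
  qed
qed

text \<open>At small scales plain boundedness is used, put in the shape
  \<open>s powr (\<alpha> - 1)\<close> with \<open>\<alpha> = 1\<close> that the lemmas on scale
  integrals expect.\<close>

lemma scale_laplacian_bounds:
  fixes \<psi> :: "real^'n \<Rightarrow> real"
  assumes \<psi>: "test_function \<psi>"
  shows "\<exists>B\<ge>0. (\<forall>s x. 0 < s \<longrightarrow> s \<le> 1 \<longrightarrow> \<bar>s * conv \<Phi>\<^sub>0 s (laplacian \<psi>) x\<bar> \<le> B * s powr (1 - 1)) \<and>
    (\<forall>s x. 0 < s \<longrightarrow> \<bar>s * conv \<Phi>\<^sub>0 s (laplacian \<psi>) x\<bar> \<le> B * s powr (- 2)) \<and>
    (\<forall>x. set_integrable lborel {0<..} (\<lambda>s. s * conv \<Phi>\<^sub>0 s (laplacian \<psi>) x))"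
proof -
  have tl: "pcont (laplacian \<psi>)" by (rule test_function_pcont[OF test_function_laplacian[OF \<psi>]])
  obtain D where D: "D \<ge> 0" "\<And>s x. s > 0 \<Longrightarrow> \<bar>s * conv \<Phi>\<^sub>0 s (laplacian \<psi>) x\<bar> \<le> D * s powr (- 2)"
    using conv_laplacian_decay[OF \<psi>] by metis
  obtain B where B: "B \<ge> 0" "\<And>x. \<bar>laplacian \<psi> x\<bar> \<le> B" using pcont_bounded[OF tl] by blast
  define A where "A = B * (\<integral>z. \<bar>(\<Phi>\<^sub>0 :: real^'n \<Rightarrow> real) z\<bar> \<partial>lborel)"
  have A: "\<bar>conv \<Phi>\<^sub>0 s (laplacian \<psi>) x\<bar> \<le> A" for s x
    unfolding A_def by (rule conv_bound[OF kernel_Phi0 tl B(2)])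
  have A0: "A \<ge> 0" using A[of 0 0] by linarith
  have AD: "A + D \<ge> 0" using A0 D(1) by simp
  have 1: "\<bar>s * conv \<Phi>\<^sub>0 s (laplacian \<psi>) x\<bar> \<le> (A + D) * s powr (1 - 1)" if s: "0 < s" "s \<le> 1" for s x
  proof -
    have "\<bar>s * conv \<Phi>\<^sub>0 s (laplacian \<psi>) x\<bar> \<le> 1 * A" unfolding abs_mult using s by (intro mult_mono A) auto
    then show ?thesis using s D(1) by simp
  qed
  have 2: "\<bar>s * conv \<Phi>\<^sub>0 s (laplacian \<psi>) x\<bar> \<le> (A + D) * s powr (- 2)" if s: "0 < s" for s x
  proof -
    have "D * s powr (- 2) \<le> (A + D) * s powr (- 2)" using A0 by (intro mult_right_mono) auto
    then show ?thesis using D(2)[OF s, of x] by linarith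
  qed
  have "set_integrable lborel {0<..} (\<lambda>s. s * conv \<Phi>\<^sub>0 s (laplacian \<psi>) x)" for x
    by (rule scale_integral_bound(1)[where \<alpha> = 1 and e = "- 2" and r = 1 and A = "A + D" and D = "A + D"])
      (use measurable_conv_scale[OF kernel_Phi0 tl] AD 1 2 in auto)
  then show ?thesis using 1 2 AD by blast
qed

text \<open>The fundamental theorem of calculus for \<open>conv G\<^sub>0 s \<psi> x\<close> on
  \<open>s > 0\<close>: towards 0 the kernel concentrates and gives \<open>\<psi> x\<close> times
  the mass, towards infinity it averages and gives the mean times the mass.\<close>

lemma scale_representation:
  fixes \<psi> :: "real^'n \<Rightarrow> real"
  assumes \<psi>: "test_function \<psi>"
  shows "(LBINT s:{0<..}. s * conv \<Phi>\<^sub>0 s (laplacian \<psi>) x)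
    = bump_mass TYPE('n) * ((\<integral>x. \<psi> x \<partial>cube_measure) - \<psi> x)"
proof -
  have tl: "pcont (laplacian \<psi>)" by (rule test_function_pcont[OF test_function_laplacian[OF \<psi>]])
  have int: "set_integrable lborel {0<..} (\<lambda>s. s * conv \<Phi>\<^sub>0 s (laplacian \<psi>) x)"
    using scale_laplacian_bounds[OF \<psi>] by blast
  obtain B' where B': "B' \<ge> 0" "\<And>x. \<bar>\<psi> x\<bar> \<le> B'" using pcont_bounded[OF test_function_pcont[OF \<psi>]] by blast
  have "(LBINT s=ereal 0..\<infinity>. s * conv \<Phi>\<^sub>0 s (laplacian \<psi>) x)
     = (\<integral>x. \<psi> x \<partial>cube_measure) * bump_mass TYPE('n) - \<psi> x * bump_mass TYPE('n)"
  proof (rule interval_integral_FTC_integrable[where F = "\<lambda>s. conv G\<^sub>0 s \<psi> x"])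
    fix s assume "ereal 0 < ereal s" "ereal s < \<infinity>"
    then show "((\<lambda>s. conv G\<^sub>0 s \<psi> x) has_vector_derivative s * conv \<Phi>\<^sub>0 s (laplacian \<psi>) x) (at s)"
      using conv_G0_derivative[OF \<psi>, of s x] by (simp add: has_real_derivative_iff_has_vector_derivative)
    show "isCont (\<lambda>s. s * conv \<Phi>\<^sub>0 s (laplacian \<psi>) x) s"
      using continuous_conv_scale[OF kernel_Phi0 tl, of x]
      by (intro continuous_intros) (auto simp: continuous_on_eq_continuous_at)
  next
    show "set_integrable lborel (einterval (ereal 0) \<infinity>) (\<lambda>s. s * conv \<Phi>\<^sub>0 s (laplacian \<psi>) x)"
      using int by simp
    have "isCont (\<lambda>s. conv G\<^sub>0 s \<psi> x) 0"
      using continuous_conv_scale[OF kernel_G0 test_function_pcont[OF \<psi>], of x] by (auto simp: continuous_on_eq_continuous_at)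
    moreover have "conv G\<^sub>0 0 \<psi> x = \<psi> x * bump_mass TYPE('n)" by (simp add: conv_def bump_mass_def)
    ultimately have "((\<lambda>s. conv G\<^sub>0 s \<psi> x) \<longlongrightarrow> \<psi> x * bump_mass TYPE('n)) (at_right 0)"
      by (metis continuous_within isCont_def filterlim_at_split)
    then show "(((\<lambda>s. conv G\<^sub>0 s \<psi> x) \<circ> real_of_ereal) \<longlongrightarrow> \<psi> x * bump_mass TYPE('n)) (at_right (ereal 0))"
      by (simp add: ereal_tendsto_simps)
    obtain C where C: "C \<ge> 0" "\<And>(s::real) F B x. s > 0 \<Longrightarrow> pcont F \<Longrightarrow> (\<And>x. \<bar>F x\<bar> \<le> B)
       \<Longrightarrow> \<bar>conv (G\<^sub>0 :: real^'n \<Rightarrow> real) s F x - (\<integral>x. F x \<partial>cube_measure) * (\<integral>z. (G\<^sub>0 :: real^'n \<Rightarrow> real) z \<partial>lborel)\<bar> \<le> C * B / s"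
      using conv_decay[OF kernel_mono[OF kernel_G0, of "Suc 0"]] by auto
    have "((\<lambda>s. conv G\<^sub>0 s \<psi> x - (\<integral>x. \<psi> x \<partial>cube_measure) * bump_mass TYPE('n)) \<longlongrightarrow> 0) at_top"
    proof (rule Lim_null_comparison)
      show "\<forall>\<^sub>F s in at_top. norm (conv G\<^sub>0 s \<psi> x - (\<integral>x. \<psi> x \<partial>cube_measure) * bump_mass TYPE('n)) \<le> C * B' / s"
        using eventually_gt_at_top[of 0]
        by eventually_elim (use C(2)[OF _ test_function_pcont[OF \<psi>] B'(2)] in \<open>simp add: bump_mass_def\<close>)
      show "((\<lambda>s. C * B' / s) \<longlongrightarrow> 0) at_top"
        by (intro tendsto_divide_0[OF tendsto_const] filterlim_at_top_imp_at_infinity filterlim_ident)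
    qed
    then have "((\<lambda>s. conv G\<^sub>0 s \<psi> x) \<longlongrightarrow> (\<integral>x. \<psi> x \<partial>cube_measure) * bump_mass TYPE('n)) at_top"
      by (subst (asm) LIM_zero_iff)
    then show "(((\<lambda>s. conv G\<^sub>0 s \<psi> x) \<circ> real_of_ereal) \<longlongrightarrow> (\<integral>x. \<psi> x \<partial>cube_measure) * bump_mass TYPE('n)) (at_left \<infinity>)"
      by (simp add: ereal_tendsto_simps)
  qed simp
  then show ?thesis by (simp add: interval_integral_to_infinity_eq algebra_simps)
qed

subsection \<open>Hoelder functions\<close>

text \<open>One number bounds both the supremum and the seminorm, so estimates carry no suprema.
  \<open>holder_space_imp_bd\<close> and \<open>holder_bd_imp_norm_le\<close> translate from and to
  the norm, the latter with a factor 2.\<close>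

definition holder_bd :: "real \<Rightarrow> real \<Rightarrow> (real^'n \<Rightarrow> 'b::real_normed_vector) \<Rightarrow> bool" where
  "holder_bd \<theta> N f \<longleftrightarrow> periodic f \<and> (\<forall>x. norm (f x) \<le> N) \<and> (\<forall>x y. norm (f x - f y) \<le> N * norm (x - y) powr \<theta>)"

lemma holder_bdD:
  assumes "holder_bd \<theta> N f"
  shows "periodic f" "norm (f x) \<le> N" "norm (f x - f y) \<le> N * norm (x - y) powr \<theta>" "N \<ge> 0"
proof -
  show "periodic f" "norm (f x) \<le> N" "norm (f x - f y) \<le> N * norm (x - y) powr \<theta>"
    using assms by (auto simp: holder_bd_def)
  have "norm (f 0) \<le> N" using assms by (auto simp: holder_bd_def)
  then show "N \<ge> 0" using norm_ge_zero order_trans by blast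
qed

lemma holder_bd_continuous:
  assumes f: "holder_bd \<theta> N f" and \<theta>: "\<theta> > 0"
  shows "continuous_on UNIV f"
  unfolding continuous_on_iff
proof (intro ballI allI impI)
  fix x and e :: real assume e: "e > 0"
  have N: "N \<ge> 0" by (rule holder_bdD(4)[OF f])
  define d where "d = (e / (N + 1)) powr (1 / \<theta>)"
  have d: "d > 0" using e N by (simp add: d_def)
  have "dist (f y) (f x) < e" if "dist y x < d" for y
  proof -
    have "norm (y - x) powr \<theta> \<le> d powr \<theta>"
      using that \<theta> by (intro powr_mono2) (auto simp: dist_norm)
    also have "d powr \<theta> = e / (N + 1)" using \<theta> e N by (simp add: d_def powr_powr)
    finally have "N * norm (y - x) powr \<theta> \<le> N * (e / (N + 1))" using N by (intro mult_left_mono)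
    also have "\<dots> < e" using e N by (simp add: field_simps)
    finally show ?thesis using holder_bdD(3)[OF f, of y x] by (simp add: dist_norm)
  qed
  then show "\<exists>d>0. \<forall>y\<in>UNIV. dist y x < d \<longrightarrow> dist (f y) (f x) < e" using d by blast
qed

lemma holder_bd_pcont:
  fixes f :: "real^'n \<Rightarrow> real"
  shows "holder_bd \<theta> N f \<Longrightarrow> \<theta> > 0 \<Longrightarrow> pcont f"
  unfolding pcont_def using holder_bd_continuous holder_bdD(1) by blast

lemma holder_bd_component:
  fixes u :: "real^'n \<Rightarrow> real^'m"
  assumes u: "holder_bd \<theta> N u"
  shows "holder_bd \<theta> N (\<lambda>x. u x $ i)"
proof -
  have "\<bar>u x $ i\<bar> \<le> N" for x
    using component_le_norm_cart[of "u x" i] holder_bdD(2)[OF u, of x] by linarith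
  moreover have "\<bar>u x $ i - u y $ i\<bar> \<le> N * norm (x - y) powr \<theta>" for x y
    using component_le_norm_cart[of "u x - u y" i] holder_bdD(3)[OF u, of x y] by simp
  moreover have "periodic (\<lambda>x. u x $ i)" using holder_bdD(1)[OF u] by (simp add: periodic_def)
  ultimately show ?thesis by (simp add: holder_bd_def)
qed

lemma holder_bd_mult:
  fixes f g :: "real^'n \<Rightarrow> real"
  assumes f: "holder_bd \<theta> N f" and g: "holder_bd \<theta> N g"
  shows "holder_bd \<theta> (2 * N\<^sup>2) (\<lambda>x. f x * g x)"
proof -
  have N: "N \<ge> 0" by (rule holder_bdD(4)[OF f])
  have "\<bar>f x * g x\<bar> \<le> 2 * N\<^sup>2" for x
  proof -
    have "\<bar>f x * g x\<bar> \<le> N * N"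
      unfolding abs_mult using holder_bdD(2)[OF f, of x] holder_bdD(2)[OF g, of x] N by (intro mult_mono) auto
    then show ?thesis using zero_le_square[of N] by (simp add: power2_eq_square)
  qed
  moreover have "\<bar>f x * g x - f y * g y\<bar> \<le> 2 * N\<^sup>2 * norm (x - y) powr \<theta>" for x y
  proof -
    have "f x * g x - f y * g y = f x * (g x - g y) + (f x - f y) * g y" by (simp add: algebra_simps)
    also have "\<bar>\<dots>\<bar> \<le> \<bar>f x\<bar> * \<bar>g x - g y\<bar> + \<bar>f x - f y\<bar> * \<bar>g y\<bar>"
      by (metis abs_mult abs_triangle_ineq)
    also have "\<dots> \<le> N * (N * norm (x - y) powr \<theta>) + (N * norm (x - y) powr \<theta>) * N"
      using holder_bdD(2,3)[OF f] holder_bdD(2,3)[OF g] N by (intro add_mono mult_mono) auto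
    finally show ?thesis by (simp add: power2_eq_square algebra_simps)
  qed
  moreover have "periodic (\<lambda>x. f x * g x)"
    using holder_bdD(1)[OF f] holder_bdD(1)[OF g] by (simp add: periodic_def)
  ultimately show ?thesis by (simp add: holder_bd_def)
qed

subsection \<open>Regularity of integrals over scales\<close>

text \<open>Split at \<open>r = norm (x - y)\<close>. Below \<open>r\<close> the two values are
  bounded separately, and \<open>s powr (\<alpha> - 1)\<close> integrates to
  \<open>r powr \<alpha> / \<alpha>\<close>; above \<open>r\<close> the Lipschitz bound is used, and
  \<open>r * s powr (\<alpha> - 2)\<close> integrates to a multiple of
  \<open>r powr \<alpha>\<close> because \<open>\<alpha> < 1\<close>.\<close>

lemma holder_of_scale_integral:
  fixes q :: "real \<Rightarrow> real^'n \<Rightarrow> real"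
  assumes meas: "\<And>x. (\<lambda>s. q s x) \<in> borel_measurable borel" and \<alpha>: "0 < \<alpha>" "\<alpha> < 1" and B: "B \<ge> 0"
    and small: "\<And>s x. 0 < s \<Longrightarrow> s \<le> 1 \<Longrightarrow> \<bar>q s x\<bar> \<le> B * s powr (\<alpha> - 1)"
    and large: "\<And>s x. 1 < s \<Longrightarrow> \<bar>q s x\<bar> \<le> B * s powr (- 2)"
    and lip: "\<And>s x y. 0 < s \<Longrightarrow> \<bar>q s x - q s y\<bar> \<le> B * s powr (\<alpha> - 2) * norm (x - y)"
  shows "set_integrable lborel {0<..} (\<lambda>s. q s x)"
    "\<bar>LBINT s:{0<..}. q s x\<bar> \<le> B * (1 / \<alpha> + 1)"
    "\<bar>(LBINT s:{0<..}. q s x) - (LBINT s:{0<..}. q s y)\<bar> \<le> B * (2 / \<alpha> + 1 / (1 - \<alpha>)) * norm (x - y) powr \<alpha>"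
proof -
  show int: "set_integrable lborel {0<..} (\<lambda>s. q s x)" for x
    by (rule scale_integral_bound(1)[where \<alpha> = \<alpha> and e = "- 2" and r = 1 and A = B and D = B])
      (use meas \<alpha> B small large in auto)
  have "\<bar>LBINT s:{0<..}. q s x\<bar> \<le> B * (1 powr \<alpha> / \<alpha>) + B * (- (1 powr (- 2 + 1)) / (- 2 + 1))"
    by (rule scale_integral_bound(2)[where \<alpha> = \<alpha> and e = "- 2" and r = 1 and A = B and D = B])
      (use meas \<alpha> B small large in auto)
  then show "\<bar>LBINT s:{0<..}. q s x\<bar> \<le> B * (1 / \<alpha> + 1)" by (simp add: algebra_simps)
  \<comment> \<open>As \<open>r\<close> may exceed 1, the small-scale bound is needed at all scales;
    beyond 1 it follows from the faster decay.\<close>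
  have all: "\<bar>q s x\<bar> \<le> B * s powr (\<alpha> - 1)" if "0 < s" for s x
  proof (cases "s \<le> 1")
    case False
    have "B * s powr (- 2) \<le> B * s powr (\<alpha> - 1)" using False \<alpha> B by (intro mult_left_mono powr_mono) auto
    then show ?thesis using large[of s x] False by simp
  qed (use small that in auto)
  show "\<bar>(LBINT s:{0<..}. q s x) - (LBINT s:{0<..}. q s y)\<bar> \<le> B * (2 / \<alpha> + 1 / (1 - \<alpha>)) * norm (x - y) powr \<alpha>"
  proof (cases "x = y")
    case False
    define r where "r = norm (x - y)"
    have r: "r > 0" using False by (simp add: r_def)
    have "(LBINT s:{0<..}. q s x) - (LBINT s:{0<..}. q s y) = (LBINT s:{0<..}. q s x - q s y)"
      by (rule set_integral_diff(2)[symmetric]) (rule int)+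
    also have "\<bar>\<dots>\<bar> \<le> (2 * B) * (r powr \<alpha> / \<alpha>) + (B * r) * (- (r powr ((\<alpha> - 2) + 1)) / ((\<alpha> - 2) + 1))"
    proof (rule scale_integral_bound(2))
      show "(\<lambda>s. q s x - q s y) \<in> borel_measurable borel" using meas by measurable
      fix s :: real
      show "\<bar>q s x - q s y\<bar> \<le> 2 * B * s powr (\<alpha> - 1)" if "0 < s" "s \<le> r"
        using all[OF that(1), of x] all[OF that(1), of y] by linarith
      show "\<bar>q s x - q s y\<bar> \<le> B * r * s powr (\<alpha> - 2)" if "r < s"
        using lip[of s x y] that r by (simp add: r_def algebra_simps)
    qed (use \<alpha> B r in auto)
    also have "(B * r) * (- (r powr ((\<alpha> - 2) + 1)) / ((\<alpha> - 2) + 1)) = B * (1 / (1 - \<alpha>)) * r powr \<alpha>"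
    proof -
      have "r powr \<alpha> = r * r powr (\<alpha> - 1)" using r powr_mult_base[of r "\<alpha> - 1"] by simp
      moreover have "- (r powr (\<alpha> - 1)) / (\<alpha> - 1) = r powr (\<alpha> - 1) / (1 - \<alpha>)"
        using \<alpha> by (simp add: field_simps)
      ultimately show ?thesis by simp
    qed
    finally show ?thesis by (simp add: r_def[symmetric] algebra_simps)
  qed simp
qed

lemma holder_bd_cmult:
  fixes f :: "real^'n \<Rightarrow> real"
  assumes f: "holder_bd \<alpha> N f" and c: "c \<ge> 0"
  shows "holder_bd \<alpha> (c * N) (\<lambda>x. c * f x)"
proof -
  have "\<bar>c * f x\<bar> \<le> c * N" for x
    using mult_left_mono[OF holder_bdD(2)[OF f, of x] c] c by (simp add: abs_mult)
  moreover have "\<bar>c * f x - c * f y\<bar> \<le> c * N * norm (x - y) powr \<alpha>" for x y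
    using mult_left_mono[OF holder_bdD(3)[OF f, of x y] c] c
    by (simp add: right_diff_distrib[symmetric] abs_mult mult.assoc)
  ultimately show ?thesis using holder_bdD(1)[OF f] by (simp add: holder_bd_def periodic_def)
qed

lemma holder_bd_mono:
  assumes f: "holder_bd \<alpha> N f" and le: "N \<le> N'"
  shows "holder_bd \<alpha> N' f"
  unfolding holder_bd_def
  using holder_bdD(1)[OF f] order_trans[OF holder_bdD(2)[OF f] le]
    order_trans[OF holder_bdD(3)[OF f] mult_right_mono[OF le powr_ge_zero]] by blast

text \<open>Dominates both constants of \<open>holder_of_scale_integral\<close>.\<close>

definition scale_const :: "real \<Rightarrow> real" where
  "scale_const \<alpha> = 2 / \<alpha> + 1 + 1 / (1 - \<alpha>)"

lemma scale_const_nonneg: "0 < \<alpha> \<Longrightarrow> \<alpha> < 1 \<Longrightarrow> scale_const \<alpha> \<ge> 0"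
  by (simp add: scale_const_def)

lemma holder_bd_scale_integral:
  fixes q :: "real \<Rightarrow> real^'n \<Rightarrow> real"
  assumes meas: "\<And>x. (\<lambda>s. q s x) \<in> borel_measurable borel" and per: "\<And>s. periodic (q s)"
    and \<alpha>: "0 < \<alpha>" "\<alpha> < 1" and B: "B \<ge> 0"
    and small: "\<And>s x. 0 < s \<Longrightarrow> s \<le> 1 \<Longrightarrow> \<bar>q s x\<bar> \<le> B * s powr (\<alpha> - 1)"
    and large: "\<And>s x. 1 < s \<Longrightarrow> \<bar>q s x\<bar> \<le> B * s powr (- 2)"
    and lip: "\<And>s x y. 0 < s \<Longrightarrow> \<bar>q s x - q s y\<bar> \<le> B * s powr (\<alpha> - 2) * norm (x - y)"
  shows "holder_bd \<alpha> (B * scale_const \<alpha>) (\<lambda>x. LBINT s:{0<..}. q s x)"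
proof -
  note H = holder_of_scale_integral[OF meas \<alpha> B small large lip]
  have le: "B * (1 / \<alpha> + 1) \<le> B * scale_const \<alpha>" "B * (2 / \<alpha> + 1 / (1 - \<alpha>)) \<le> B * scale_const \<alpha>"
    using B \<alpha> unfolding scale_const_def by (intro mult_left_mono; simp add: divide_right_mono add_increasing2)+
  have "\<bar>LBINT s:{0<..}. q s x\<bar> \<le> B * scale_const \<alpha>" for x
    using H(2)[of x] le(1) by linarith
  moreover have "\<bar>(LBINT s:{0<..}. q s x) - (LBINT s:{0<..}. q s y)\<bar> \<le> B * scale_const \<alpha> * norm (x - y) powr \<alpha>" for x y
    by (rule order_trans[OF H(3) mult_right_mono[OF le(2) powr_ge_zero]])
  moreover have "periodic (\<lambda>x. LBINT s:{0<..}. q s x)"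
    using per by (simp add: periodic_def)
  ultimately show ?thesis by (simp add: holder_bd_def)
qed

lemma set_integral_linear_combination:
  fixes g :: "'i \<Rightarrow> 'a \<Rightarrow> real"
  assumes "\<And>i. set_integrable M S (g i)"
  shows "set_integrable M S (\<lambda>s. \<Sum>i\<in>I. c i * g i s)"
    "(LINT s:S|M. (\<Sum>i\<in>I. c i * g i s)) = (\<Sum>i\<in>I. c i * (LINT s:S|M. g i s))"
proof -
  have e: "indicator S s *\<^sub>R (\<Sum>i\<in>I. c i * g i s) = (\<Sum>i\<in>I. c i * (indicator S s *\<^sub>R g i s))" for s
    by (simp add: sum_distrib_left algebra_simps)
  have i: "integrable M (\<lambda>s. c i * (indicator S s *\<^sub>R g i s))" for i
    using assms unfolding set_integrable_def by (rule integrable_mult_right)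
  show "set_integrable M S (\<lambda>s. \<Sum>i\<in>I. c i * g i s)"
    unfolding set_integrable_def e by (intro Bochner_Integration.integrable_sum i)
  show "(LINT s:S|M. (\<Sum>i\<in>I. c i * g i s)) = (\<Sum>i\<in>I. c i * (LINT s:S|M. g i s))"
    unfolding set_lebesgue_integral_def e
    by (subst Bochner_Integration.integral_sum[OF i]) (simp only: integral_mult_right_zero)
qed

text \<open>The first-order remainder at each scale is integrated over \<open>s\<close>, again split
  at \<open>r = norm h\<close>: the size of the gradient handles \<open>s \<le> r\<close>, its
  Lipschitz bound \<open>s > r\<close>. The total is a multiple of
  \<open>norm h powr \<alpha> * norm h\<close>, which is of smaller order than
  \<open>norm h\<close>.\<close>

lemma scale_integral_differentiable:
  fixes q :: "real \<Rightarrow> real^'n \<Rightarrow> real" and g :: "'n \<Rightarrow> real \<Rightarrow> real^'n \<Rightarrow> real"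
  assumes int: "\<And>x. set_integrable lborel {0<..} (\<lambda>s. q s x)" and measq: "\<And>x. (\<lambda>s. q s x) \<in> borel_measurable borel"
    and C1: "\<And>s. s > 0 \<Longrightarrow> C_k (Suc 0) (q s)" and pg: "\<And>s i x. s > 0 \<Longrightarrow> partial i (q s) x = g i s x"
    and meas: "\<And>i x. (\<lambda>s. g i s x) \<in> borel_measurable borel" and \<alpha>: "0 < \<alpha>" "\<alpha> < 1" and B: "B \<ge> 0"
    and small: "\<And>i s x. 0 < s \<Longrightarrow> s \<le> 1 \<Longrightarrow> \<bar>g i s x\<bar> \<le> B * s powr (\<alpha> - 1)"
    and large: "\<And>i s x. 1 < s \<Longrightarrow> \<bar>g i s x\<bar> \<le> B * s powr (- 2)"
    and lip: "\<And>i s x y. 0 < s \<Longrightarrow> \<bar>g i s x - g i s y\<bar> \<le> B * s powr (\<alpha> - 2) * norm (x - y)"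
  shows "((\<lambda>x. LBINT s:{0<..}. q s x) has_derivative (\<lambda>h. \<Sum>i\<in>UNIV. h $ i * (LBINT s:{0<..}. g i s x))) (at x)"
proof -
  have all: "\<bar>g i s x\<bar> \<le> B * s powr (\<alpha> - 1)" if "0 < s" for i s x
  proof (cases "s \<le> 1")
    case False
    have "B * s powr (- 2) \<le> B * s powr (\<alpha> - 1)" using False \<alpha> B by (intro mult_left_mono powr_mono) auto
    then show ?thesis using large[of s i x] False by simp
  qed (use small that in auto)
  have intg: "set_integrable lborel {0<..} (\<lambda>s. g i s x)" for i x
    by (rule scale_integral_bound(1)[where \<alpha> = \<alpha> and e = "- 2" and r = 1 and A = B and D = B])
      (use meas \<alpha> B small large in auto)
  define P where "P = (\<lambda>x. LBINT s:{0<..}. q s x)"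
  define L where "L = (\<lambda>h. \<Sum>i\<in>UNIV. h $ i * (LBINT s:{0<..}. g i s x))"
  define C where "C = CARD('n) * (B * (2 / \<alpha> + 1 / (1 - \<alpha>)))"
  have C0: "C \<ge> 0" using \<alpha> B by (simp add: C_def)
  define e where "e = (\<lambda>h s. q s (x + h) - q s x - (\<Sum>i\<in>UNIV. h $ i * g i s x))"
  \<comment> \<open>The mean value inequality for \<open>q s\<close> minus its linear part at
    \<open>x\<close>: the remainder is controlled by \<open>norm h\<close> times the oscillation
    \<open>D\<close> of the gradient on the ball of radius \<open>norm h\<close>.\<close>
  have taylor: "\<bar>e h s\<bar> \<le> CARD('n) * D * norm h" if s: "s > 0" and D: "\<And>i y. norm (y - x) \<le> norm h \<Longrightarrow> \<bar>g i s y - g i s x\<bar> \<le> D" for h s and D :: real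
  proof -
    define f where "f = (\<lambda>y. q s y - (\<Sum>i\<in>UNIV. y $ i * g i s x))"
    have df: "(f has_derivative (\<lambda>k. \<Sum>i\<in>UNIV. k $ i * (g i s y - g i s x))) (at y)" for y
    proof -
      have "(f has_derivative (\<lambda>k. (\<Sum>i\<in>UNIV. k $ i * partial i (q s) y) - (\<Sum>i\<in>UNIV. k $ i * g i s x))) (at y)"
        unfolding f_def
        by (intro has_derivative_diff C_k_Suc_has_derivative[OF C1[OF s]] has_derivative_sum has_derivative_mult_left
            bounded_linear_imp_has_derivative bounded_linear_vec_nth)
      then show ?thesis by (simp add: pg[OF s] sum_subtractf algebra_simps)
    qed
    have "norm (f (x + h) - f x) \<le> (CARD('n) * D) * norm ((x + h) - x)"
    proof (rule differentiable_bound[of "cball x (norm h)" f])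
      show "(f has_derivative (\<lambda>k. \<Sum>i\<in>UNIV. k $ i * (g i s y - g i s x))) (at y within cball x (norm h))" for y
        using df has_derivative_at_withinI by blast
      fix y assume y: "y \<in> cball x (norm h)"
      show "onorm (\<lambda>k. \<Sum>i\<in>UNIV. k $ i * (g i s y - g i s x)) \<le> CARD('n) * D"
      proof (rule onorm_le)
        fix k :: "real^'n"
        have "norm (\<Sum>i\<in>UNIV. k $ i * (g i s y - g i s x)) \<le> (\<Sum>i\<in>(UNIV::'n set). norm k * D)"
        proof (rule sum_norm_le)
          fix i
          have "\<bar>g i s y - g i s x\<bar> \<le> D" using y by (intro D) (simp add: dist_norm norm_minus_commute)
          then show "norm (k $ i * (g i s y - g i s x)) \<le> norm k * D"
            unfolding real_norm_def abs_mult using component_le_norm_cart[of k i] by (intro mult_mono) auto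
        qed
        then show "norm (\<Sum>i\<in>UNIV. k $ i * (g i s y - g i s x)) \<le> CARD('n) * D * norm k" by (simp add: algebra_simps)
      qed
    qed (auto simp: dist_norm)
    moreover have "f (x + h) - f x = e h s"
      by (simp add: f_def e_def sum_subtractf[symmetric] algebra_simps sum.distrib)
    ultimately show ?thesis by simp
  qed
  have rem: "\<bar>P (x + h) - P x - L h\<bar> \<le> C * norm h powr \<alpha> * norm h" for h
  proof (cases "h = 0")
    case False
    define r where "r = norm h"
    have r: "r > 0" using False by (simp add: r_def)
    have ig: "set_integrable lborel {0<..} (\<lambda>s. \<Sum>i\<in>UNIV. h $ i * g i s x)"
      by (rule set_integral_linear_combination(1)[where g = "\<lambda>i s. g i s x"]) (rule intg)
    have "L h = (LBINT s:{0<..}. \<Sum>i\<in>UNIV. h $ i * g i s x)"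
      unfolding L_def by (rule set_integral_linear_combination(2)[where g = "\<lambda>i s. g i s x", symmetric]) (rule intg)
    then have "P (x + h) - P x - L h = (LBINT s:{0<..}. e h s)"
      unfolding P_def e_def using int[of "x + h"] int[of x] ig by (simp add: set_integral_diff)
    also have "\<bar>\<dots>\<bar> \<le> (CARD('n) * (2 * B) * r) * (r powr \<alpha> / \<alpha>) + (CARD('n) * (B * r) * r) * (- (r powr ((\<alpha> - 2) + 1)) / ((\<alpha> - 2) + 1))"
    proof (rule scale_integral_bound(2))
      show "(\<lambda>s. e h s) \<in> borel_measurable borel" unfolding e_def using meas measq by measurable
      fix s :: real
      show "\<bar>e h s\<bar> \<le> CARD('n) * (2 * B) * r * s powr (\<alpha> - 1)" if "0 < s" "s \<le> r"
      proof -
        have "\<bar>e h s\<bar> \<le> CARD('n) * (2 * B * s powr (\<alpha> - 1)) * norm h"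
        proof (rule taylor[OF that(1)])
          fix i y show "\<bar>g i s y - g i s x\<bar> \<le> 2 * B * s powr (\<alpha> - 1)"
            using all[OF that(1), of i x] all[OF that(1), of i y] by linarith
        qed
        then show ?thesis by (simp add: r_def algebra_simps)
      qed
      show "\<bar>e h s\<bar> \<le> CARD('n) * (B * r) * r * s powr (\<alpha> - 2)" if "r < s"
      proof -
        have s: "s > 0" using that r by simp
        have "\<bar>e h s\<bar> \<le> CARD('n) * (B * s powr (\<alpha> - 2) * r) * norm h"
        proof (rule taylor[OF s])
          fix i y assume "norm (y - x) \<le> norm h"
          then have "B * s powr (\<alpha> - 2) * norm (y - x) \<le> B * s powr (\<alpha> - 2) * r"
            using B by (intro mult_left_mono) (auto simp: r_def)
          then show "\<bar>g i s y - g i s x\<bar> \<le> B * s powr (\<alpha> - 2) * r"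
            using lip[OF s, of i y x] by linarith
        qed
        then show ?thesis by (simp add: r_def algebra_simps)
      qed
    qed (use \<alpha> B r in auto)
    also have "\<dots> = C * r powr \<alpha> * r"
    proof -
      have "r powr \<alpha> = r * r powr (\<alpha> - 1)" using r powr_mult_base[of r "\<alpha> - 1"] by simp
      moreover have "- (r powr ((\<alpha> - 2) + 1)) / ((\<alpha> - 2) + 1) = r powr (\<alpha> - 1) / (1 - \<alpha>)"
        using \<alpha> by (simp add: field_simps)
      ultimately show ?thesis by (simp add: C_def algebra_simps)
    qed
    finally show ?thesis by (simp add: r_def)
  qed (simp add: L_def)
  have "(P has_derivative L) (at x)"
    unfolding has_derivative_at
  proof
    show "bounded_linear L" unfolding L_def
      by (intro bounded_linear_sum bounded_linear_mult_const bounded_linear_vec_nth)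
    show "(\<lambda>h. norm (P (x + h) - P x - L h) / norm h) \<midarrow>0\<rightarrow> 0"
    proof (rule Lim_null_comparison)
      show "\<forall>\<^sub>F h in at 0. norm (norm (P (x + h) - P x - L h) / norm h) \<le> C * norm h powr \<alpha>"
      proof (rule always_eventually, rule)
        fix h show "norm (norm (P (x + h) - P x - L h) / norm h) \<le> C * norm h powr \<alpha>"
          using rem[of h] C0 by (cases "h = 0") (auto simp: pos_divide_le_eq)
      qed
      have "((\<lambda>h::real^'n. C * norm h powr \<alpha>) \<longlongrightarrow> C * 0) (at 0)"
        using \<alpha> by (intro tendsto_mult tendsto_const tendsto_zero_powrI[where b = \<alpha>] tendsto_norm_zero tendsto_ident_at) auto
      then show "((\<lambda>h::real^'n. C * norm h powr \<alpha>) \<longlongrightarrow> 0) (at 0)" by simp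
    qed
  qed
  then show ?thesis by (simp add: P_def L_def)
qed

text \<open>The bounds dominate \<open>r\<close> by a function of \<open>s\<close> alone, which is
  integrable on the product because the cube has finite measure.\<close>

lemma scale_fubini:
  fixes r :: "real \<Rightarrow> real^'n \<Rightarrow> real"
  assumes meas: "(\<lambda>p. r (fst p) (snd p)) \<in> borel_measurable (borel \<Otimes>\<^sub>M borel)"
    and \<alpha>: "\<alpha> > 0" and B: "B \<ge> 0"
    and small: "\<And>s x. 0 < s \<Longrightarrow> s \<le> 1 \<Longrightarrow> \<bar>r s x\<bar> \<le> B * s powr (\<alpha> - 1)"
    and large: "\<And>s x. 1 < s \<Longrightarrow> \<bar>r s x\<bar> \<le> B * s powr (- 2)"
  shows "(\<integral>x. (LBINT s:{0<..}. r s x) \<partial>cube_measure) = (LBINT s:{0<..}. (\<integral>x. r s x \<partial>cube_measure))"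
proof -
  define dom where "dom = (\<lambda>s::real. if s \<le> 1 then B * s powr (\<alpha> - 1) else B * s powr (- 2))"
  have dom: "set_integrable lborel {0<..} dom"
    by (rule scale_integral_bound(1)[where \<alpha> = \<alpha> and e = "- 2" and r = 1 and A = B and D = B])
      (use \<alpha> B in \<open>auto simp: dom_def\<close>)
  interpret C: finite_measure "cube_measure :: (real^'n) measure" by unfold_locales
  interpret PS: pair_sigma_finite "lborel :: real measure" "cube_measure :: (real^'n) measure" by unfold_locales
  have idm: "(\<lambda>x. x) \<in> measurable (cube_measure :: (real^'n) measure) borel"
    unfolding cube_measure_def by (intro measurable_restrict_space1) simp
  have pm: "(\<lambda>p. (fst p, snd p)) \<in> measurable (lborel \<Otimes>\<^sub>M (cube_measure :: (real^'n) measure)) (borel \<Otimes>\<^sub>M borel)"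
    by (intro measurable_Pair measurable_compose[OF measurable_snd idm]) simp
  have m1: "(\<lambda>p. r (fst p) (snd p)) \<in> borel_measurable (lborel \<Otimes>\<^sub>M (cube_measure :: (real^'n) measure))"
    using measurable_compose[OF pm meas] by simp
  have m2: "(\<lambda>p. indicator {0<..} (fst p) * r (fst p) (snd p)) \<in> borel_measurable (lborel \<Otimes>\<^sub>M (cube_measure :: (real^'n) measure))"
    using m1 by measurable
  have di: "integrable (lborel \<Otimes>\<^sub>M (cube_measure :: (real^'n) measure)) (\<lambda>p. indicator {0<..} (fst p) * dom (fst p))"
  proof (rule PS.Fubini_integrable)
    have "(\<lambda>s. indicator {0<..} s * dom s) \<in> borel_measurable lborel"
      using dom by (auto simp: set_integrable_def dest: borel_measurable_integrable)
    then show "(\<lambda>p. indicator {0<..} (fst p) * dom (fst p)) \<in> borel_measurable (lborel \<Otimes>\<^sub>M (cube_measure :: (real^'n) measure))"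
      by (rule measurable_compose[OF measurable_fst])
    show "integrable lborel (\<lambda>s. \<integral>x. norm (indicator {0<..} (fst (s, x)) * dom (fst (s, x))) \<partial>(cube_measure :: (real^'n) measure))"
      using integrable_abs[OF dom[unfolded set_integrable_def]] by simp
    show "AE s in lborel. integrable (cube_measure :: (real^'n) measure) (\<lambda>x. indicator {0<..} (fst (s, x)) * dom (fst (s, x)))"
      by simp
  qed
  have "integrable (lborel \<Otimes>\<^sub>M (cube_measure :: (real^'n) measure)) (\<lambda>p. indicator {0<..} (fst p) * r (fst p) (snd p))"
  proof (rule Bochner_Integration.integrable_bound[OF di m2], rule AE_I2)
    fix p :: "real \<times> (real^'n)"
    show "norm (indicator {0<..} (fst p) * r (fst p) (snd p)) \<le> norm (indicator {0<..} (fst p) * dom (fst p))"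
      using small[of "fst p" "snd p"] large[of "fst p" "snd p"] B by (auto simp: indicator_def dom_def abs_mult)
  qed
  then have "integrable (lborel \<Otimes>\<^sub>M (cube_measure :: (real^'n) measure)) (\<lambda>(s, x). indicator {0<..} s * r s x)"
    unfolding case_prod_beta .
  from PS.Fubini_integral[OF this] show ?thesis by (simp add: set_lebesgue_integral_def)
qed

subsection \<open>The quadratic potential\<close>

text \<open>Formally \<open>s\<^sup>2\<close> times the double divergence of the tensor mollified
  with \<open>\<Psi>\<close>, with all derivatives put on the kernel. The kernel is a parameter
  because derivatives of \<open>quad \<Psi> u s\<close> are of the same form with
  \<open>partial k \<Psi>\<close>.\<close>

definition quad :: "(real^'n \<Rightarrow> real) \<Rightarrow> (real^'n \<Rightarrow> real^'n) \<Rightarrow> real \<Rightarrow> real^'n \<Rightarrow> real" where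
  "quad \<Psi> u s x = (\<Sum>i\<in>UNIV. \<Sum>j\<in>UNIV. conv (partial i (partial j \<Psi>)) s (\<lambda>y. u y $ i * u y $ j) x)"

text \<open>Formally \<open>s\<close> times the divergence of \<open>u\<close> mollified with
  \<open>K\<close>.\<close>

definition div_conv :: "(real^'n \<Rightarrow> real) \<Rightarrow> (real^'n \<Rightarrow> real^'n) \<Rightarrow> real \<Rightarrow> real^'n \<Rightarrow> real" where
  "div_conv K u s x = (\<Sum>i\<in>UNIV. conv (partial i K) s (\<lambda>y. u y $ i) x)"

lemma abs_double_sum_le:
  fixes a :: "'i \<Rightarrow> 'j \<Rightarrow> real"
  assumes "\<And>i j. \<bar>a i j\<bar> \<le> c i j * X"
  shows "\<bar>\<Sum>i\<in>I. \<Sum>j\<in>J. a i j\<bar> \<le> (\<Sum>i\<in>I. \<Sum>j\<in>J. c i j) * X"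
proof -
  have "\<bar>\<Sum>i\<in>I. \<Sum>j\<in>J. a i j\<bar> \<le> (\<Sum>i\<in>I. \<bar>\<Sum>j\<in>J. a i j\<bar>)" by (rule sum_abs)
  also have "\<dots> \<le> (\<Sum>i\<in>I. \<Sum>j\<in>J. \<bar>a i j\<bar>)" by (intro sum_mono sum_abs)
  also have "\<dots> \<le> (\<Sum>i\<in>I. \<Sum>j\<in>J. c i j * X)" by (intro sum_mono assms)
  finally show ?thesis by (simp add: sum_distrib_right)
qed

lemma holder_bd_components_pcont:
  fixes u :: "real^'n \<Rightarrow> real^'m"
  assumes u: "holder_bd \<theta> N u" and \<theta>: "\<theta> > 0"
  shows "pcont (\<lambda>y. u y $ i)" "pcont (\<lambda>y. u y $ i * u y $ j)"
  using holder_bd_pcont[OF holder_bd_component[OF u] \<theta>] pcont_mult by blast+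

lemma kernel_partial2: "kernel (Suc (Suc k)) \<Psi> \<Longrightarrow> kernel k (partial i (partial j \<Psi>))"
  by (intro kernel_partial)

lemma integral_kernel_partial2: "kernel (Suc (Suc 0)) \<Psi> \<Longrightarrow> (\<integral>z. partial i (partial j \<Psi>) z \<partial>lborel) = 0"
  by (intro integral_partial_kernel kernel_partial)

lemma pcont_quad:
  assumes u: "holder_bd \<theta> N u" "\<theta> > 0" and K: "kernel (Suc (Suc k)) \<Psi>"
  shows "pcont (quad \<Psi> u s)"
  unfolding quad_def[abs_def] by (intro pcont_sum pcont_conv[OF kernel_partial2[OF K]] holder_bd_components_pcont[OF u])

lemma measurable_quad2:
  assumes u: "holder_bd \<theta> N u" "\<theta> > 0" and K: "kernel (Suc (Suc k)) \<Psi>"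
  shows "(\<lambda>p. quad \<Psi> u (fst p) (snd p)) \<in> borel_measurable (borel \<Otimes>\<^sub>M borel)"
  unfolding quad_def by (intro borel_measurable_sum measurable_conv2[OF kernel_partial2[OF K]] holder_bd_components_pcont[OF u])

lemma measurable_quad:
  assumes u: "holder_bd \<theta> N u" "\<theta> > 0" and K: "kernel (Suc (Suc k)) \<Psi>"
  shows "(\<lambda>s. quad \<Psi> u s x) \<in> borel_measurable borel"
  unfolding quad_def by (intro borel_measurable_sum measurable_conv_scale[OF kernel_partial2[OF K]] holder_bd_components_pcont[OF u])

text \<open>Mean-zero kernels against Hoelder products: this gives the exponent
  \<open>\<theta>\<close> with no information on the divergence.\<close>

lemma quad_small:
  fixes \<Psi> :: "real^'n \<Rightarrow> real"
  assumes K: "kernel (Suc (Suc 0)) \<Psi>"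
  obtains C where "C \<ge> 0" "\<And>\<theta> N u s x. holder_bd \<theta> N u \<Longrightarrow> \<theta> > 0 \<Longrightarrow> s > 0 \<Longrightarrow> \<bar>quad \<Psi> u s x\<bar> \<le> C * N\<^sup>2 * s powr \<theta>"
proof (rule that[of "\<Sum>i\<in>UNIV. \<Sum>j\<in>UNIV. 2 * (\<integral>z. \<bar>partial i (partial j \<Psi>) z\<bar> \<partial>lborel)"])
  show "(\<Sum>i\<in>UNIV. \<Sum>j\<in>UNIV. 2 * (\<integral>z. \<bar>partial i (partial j \<Psi>) z\<bar> \<partial>lborel)) \<ge> 0"
    by (intro sum_nonneg mult_nonneg_nonneg integral_nonneg_AE) auto
  fix \<theta> N s :: real and u :: "real^'n \<Rightarrow> real^'n" and x :: "real^'n" assume u: "holder_bd \<theta> N u" "\<theta> > 0" and s: "s > 0"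
  have "\<bar>quad \<Psi> u s x\<bar> \<le> (\<Sum>i\<in>UNIV. \<Sum>j\<in>UNIV. 2 * (\<integral>z. \<bar>partial i (partial j \<Psi>) z\<bar> \<partial>lborel)) * (N\<^sup>2 * s powr \<theta>)"
    unfolding quad_def
  proof (rule abs_double_sum_le)
    fix i j
    have F: "holder_bd \<theta> (2 * N\<^sup>2) (\<lambda>y. u y $ i * u y $ j)"
      by (intro holder_bd_mult holder_bd_component u)
    have "\<bar>conv (partial i (partial j \<Psi>)) s (\<lambda>y. u y $ i * u y $ j) x\<bar> \<le> (2 * N\<^sup>2) * \<bar>s\<bar> powr \<theta> * (\<integral>z. \<bar>partial i (partial j \<Psi>) z\<bar> \<partial>lborel)"
      by (rule conv_Hoelder[OF kernel_partial2[OF K] integral_kernel_partial2[OF K] holder_bd_components_pcont(2)[OF u]])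
        (use holder_bdD(3)[OF F] u(2) in auto)
    then show "\<bar>conv (partial i (partial j \<Psi>)) s (\<lambda>y. u y $ i * u y $ j) x\<bar> \<le> 2 * (\<integral>z. \<bar>partial i (partial j \<Psi>) z\<bar> \<partial>lborel) * (N\<^sup>2 * s powr \<theta>)"
      using s by (simp add: algebra_simps)
  qed
  then show "\<bar>quad \<Psi> u s x\<bar> \<le> (\<Sum>i\<in>UNIV. \<Sum>j\<in>UNIV. 2 * (\<integral>z. \<bar>partial i (partial j \<Psi>) z\<bar> \<partial>lborel)) * N\<^sup>2 * s powr \<theta>"
    by (simp only: mult.assoc)
qed

text \<open>A third derivative of \<open>\<Psi>\<close> is spent on the \<open>1 / s\<close> of
  \<open>conv_decay\<close>.\<close>

lemma quad_large:
  fixes \<Psi> :: "real^'n \<Rightarrow> real"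
  assumes K: "kernel (Suc (Suc (Suc 0))) \<Psi>"
  obtains C where "C \<ge> 0" "\<And>\<theta> N u s x. holder_bd \<theta> N u \<Longrightarrow> \<theta> > 0 \<Longrightarrow> s > 0 \<Longrightarrow> \<bar>quad \<Psi> u s x\<bar> \<le> C * N\<^sup>2 / s"
proof -
  have K2: "kernel (Suc (Suc 0)) \<Psi>" by (rule kernel_mono[OF K]) simp
  have "\<exists>C\<ge>0. \<forall>s>0. \<forall>F B x. pcont F \<longrightarrow> (\<forall>x. \<bar>F x\<bar> \<le> B) \<longrightarrow> \<bar>conv (partial i (partial j \<Psi>)) s F x\<bar> \<le> C * B / s" for i j
  proof -
    obtain C where "C \<ge> 0" "\<And>(s::real) F B x. s > 0 \<Longrightarrow> pcont F \<Longrightarrow> (\<And>x. \<bar>F x\<bar> \<le> B)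
     \<Longrightarrow> \<bar>conv (partial i (partial j \<Psi>)) s F x - (\<integral>x. F x \<partial>cube_measure) * (\<integral>z. partial i (partial j \<Psi>) z \<partial>lborel)\<bar> \<le> C * B / s"
      using conv_decay[OF kernel_partial2[OF K], of i j] by metis
    then show ?thesis using integral_kernel_partial2[OF K2, of i j] by (intro exI[of _ C]) auto
  qed
  then obtain C where C: "\<And>i j. C i j \<ge> 0" "\<And>i j s F B x. s > 0 \<Longrightarrow> pcont F \<Longrightarrow> (\<And>x. \<bar>F x\<bar> \<le> B) \<Longrightarrow> \<bar>conv (partial i (partial j \<Psi>)) s F x\<bar> \<le> C i j * B / s"
    by metis
  show ?thesis
  proof (rule that[of "\<Sum>i\<in>UNIV. \<Sum>j\<in>UNIV. 2 * C i j"])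
    show "(\<Sum>i\<in>UNIV. \<Sum>j\<in>UNIV. 2 * C i j) \<ge> 0" by (intro sum_nonneg mult_nonneg_nonneg C) auto
    fix \<theta> N s :: real and u :: "real^'n \<Rightarrow> real^'n" and x :: "real^'n" assume u: "holder_bd \<theta> N u" "\<theta> > 0" and s: "s > 0"
    have "\<bar>quad \<Psi> u s x\<bar> \<le> (\<Sum>i\<in>UNIV. \<Sum>j\<in>UNIV. 2 * C i j) * (N\<^sup>2 / s)"
      unfolding quad_def
    proof (rule abs_double_sum_le)
      fix i j
      have F: "holder_bd \<theta> (2 * N\<^sup>2) (\<lambda>y. u y $ i * u y $ j)"
        by (intro holder_bd_mult holder_bd_component u)
      have "\<bar>conv (partial i (partial j \<Psi>)) s (\<lambda>y. u y $ i * u y $ j) x\<bar> \<le> C i j * (2 * N\<^sup>2) / s"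
        using holder_bdD(2)[OF F] by (intro C(2) s holder_bd_components_pcont[OF u]) auto
      then show "\<bar>conv (partial i (partial j \<Psi>)) s (\<lambda>y. u y $ i * u y $ j) x\<bar> \<le> 2 * C i j * (N\<^sup>2 / s)"
        by (simp add: algebra_simps)
    qed
    then show "\<bar>quad \<Psi> u s x\<bar> \<le> (\<Sum>i\<in>UNIV. \<Sum>j\<in>UNIV. 2 * C i j) * N\<^sup>2 / s" by simp
  qed
qed

text \<open>Brings the derivative of \<open>quad \<Psi>\<close> into the form of a
  \<open>quad\<close> with kernel \<open>partial k \<Psi>\<close>.\<close>

lemma partial_rotate:
  assumes "C_k (Suc (Suc (Suc 0))) \<Psi>"
  shows "partial k (partial i (partial j \<Psi>)) = partial i (partial j (partial k \<Psi>))"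
proof -
  have 1: "C_k 2 (partial j \<Psi>)" "C_k 2 \<Psi>" using assms C_k_partial[OF assms, of j] C_k_mono[OF assms, of 2]
    by (auto simp: numeral_2_eq_2 simp del: C_k.simps)
  have "partial k (partial j \<Psi>) = partial j (partial k \<Psi>)" using partial_commute[OF 1(2)] by blast
  moreover have "partial k (partial i (partial j \<Psi>)) = partial i (partial k (partial j \<Psi>))"
    using partial_commute[OF 1(1)] by blast
  ultimately show ?thesis by simp
qed

lemma C_k_quad:
  assumes u: "holder_bd \<theta> N u" "\<theta> > 0" and K: "kernel (Suc (Suc (Suc 0))) \<Psi>" and s: "s \<noteq> 0"
  shows "C_k (Suc 0) (quad \<Psi> u s)"
  unfolding quad_def[abs_def]
  by (intro C_k_sum C_k_conv_kernel kernel_partial2 K s holder_bd_components_pcont[OF u])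

lemma partial_quad:
  assumes u: "holder_bd \<theta> N u" "\<theta> > 0" and K: "kernel (Suc (Suc (Suc 0))) \<Psi>" and s: "s \<noteq> 0"
  shows "partial k (quad \<Psi> u s) x = quad (partial k \<Psi>) u s x / s"
proof -
  have c: "C_k (Suc 0) (conv (partial i (partial j \<Psi>)) s (\<lambda>y. u y $ i * u y $ j))" for i j
    by (intro C_k_conv_kernel kernel_partial2 K s holder_bd_components_pcont[OF u])
  have "partial k (quad \<Psi> u s) x = (\<Sum>i\<in>UNIV. \<Sum>j\<in>UNIV. partial k (conv (partial i (partial j \<Psi>)) s (\<lambda>y. u y $ i * u y $ j)) x)"
    unfolding quad_def[abs_def] by (subst partial_sum, intro C_k_sum c, subst partial_sum, rule c, rule refl)
  also have "\<dots> = (\<Sum>i\<in>UNIV. \<Sum>j\<in>UNIV. conv (partial i (partial j (partial k \<Psi>))) s (\<lambda>y. u y $ i * u y $ j) x / s)"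
    by (simp only: partial_conv_kernel[OF kernel_partial2[OF K] holder_bd_components_pcont(2)[OF u] s] partial_rotate[OF kernelD(2)[OF K]])
  finally show ?thesis by (simp add: quad_def sum_divide_distrib)
qed

text \<open>The commutator structure behind the double regularity: subtracting \<open>u x\<close> from both factors
  costs only terms in which a derivative of the kernel is paired with a single factor, i.e. with the divergence.\<close>

lemma conv_product:
  assumes K: "kernel k K" "(\<integral>z. K z \<partial>lborel) = 0" and f: "pcont f" and g: "pcont g"
  shows "conv K s (\<lambda>y. f y * g y) x = conv K s (\<lambda>y. (f y - f x) * (g y - g x)) x + f x * conv K s g x + g x * conv K s f x"
proof -
  have p: "pcont (\<lambda>y. (f y - f x) * (g y - g x))" "pcont (\<lambda>y. f x * g y)" "pcont (\<lambda>y. g x * f y)" "pcont (\<lambda>y. - (f x * g x))"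
    by (intro pcont_mult pcont_diff pcont_const f g)+
  have "(\<lambda>y. f y * g y) = (\<lambda>y. (((f y - f x) * (g y - g x) + f x * g y) + g x * f y) + - (f x * g x))"
    by (auto simp: algebra_simps)
  then show ?thesis
    using K(2) by (simp only: conv_add[OF K(1) pcont_add[OF pcont_add[OF p(1) p(2)] p(3)] p(4)] conv_add[OF K(1) pcont_add[OF p(1) p(2)] p(3)]
      conv_add[OF K(1) p(1) p(2)] conv_const conv_cmult)
qed

text \<open>After \<open>conv_product\<close> the terms with two increments are of order
  \<open>s powr (2 * \<theta>)\<close>. The two families of cross terms coincide, and each is a sum
  of components of \<open>u x\<close> times \<open>div_conv (partial j \<Psi>)\<close>, so a bound
  \<open>E\<close> at the point \<open>x\<close> suffices.\<close>

lemma quad_double: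
  fixes \<Psi> :: "real^'n \<Rightarrow> real"
  assumes K: "kernel (Suc (Suc 0)) \<Psi>"
  obtains C where "C \<ge> 0" "\<And>\<theta> N u s x E. holder_bd \<theta> N u \<Longrightarrow> \<theta> > 0 \<Longrightarrow> s > 0 \<Longrightarrow> (\<And>j. \<bar>div_conv (partial j \<Psi>) u s x\<bar> \<le> E)
    \<Longrightarrow> \<bar>quad \<Psi> u s x\<bar> \<le> C * (N\<^sup>2 * s powr (2 * \<theta>) + N * E)"
proof -
  define L where "L = (\<Sum>i\<in>UNIV. \<Sum>j\<in>UNIV. \<integral>z. \<bar>partial i (partial j \<Psi>) z\<bar> \<partial>lborel)"
  have L0: "L \<ge> 0" unfolding L_def by (intro sum_nonneg integral_nonneg_AE) auto
  have K2: "C_k 2 \<Psi>" using kernelD(2)[OF K] by (simp only: numeral_2_eq_2)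
  show ?thesis
  proof (rule that[of "L + 2 * CARD('n)"])
    show "L + 2 * CARD('n) \<ge> 0" using L0 by simp
    fix \<theta> N s E :: real and u and x :: "real^'n" assume u: "holder_bd \<theta> N u" "\<theta> > 0" and s: "s > 0"
      and E: "\<And>j. \<bar>div_conv (partial j \<Psi>) u s x\<bar> \<le> E"
    have N: "N \<ge> 0" by (rule holder_bdD(4)[OF u(1)])
    have E0: "E \<ge> 0" using E[of undefined] by linarith
    define S where "S = (\<Sum>i\<in>UNIV. \<Sum>j\<in>UNIV. conv (partial i (partial j \<Psi>)) s (\<lambda>y. (u y $ i - u x $ i) * (u y $ j - u x $ j)) x)"
    define T where "T = (\<Sum>j\<in>UNIV. u x $ j * div_conv (partial j \<Psi>) u s x)"
    have sym: "conv (partial i (partial j \<Psi>)) s F x = conv (partial j (partial i \<Psi>)) s F x" for i j F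
      using partial_commute[OF K2, of i j] by presburger
    have "quad \<Psi> u s x = S + (\<Sum>i\<in>UNIV. \<Sum>j\<in>UNIV. u x $ i * conv (partial i (partial j \<Psi>)) s (\<lambda>y. u y $ j) x)
       + (\<Sum>i\<in>UNIV. \<Sum>j\<in>UNIV. u x $ j * conv (partial i (partial j \<Psi>)) s (\<lambda>y. u y $ i) x)"
      unfolding quad_def S_def
        conv_product[OF kernel_partial2[OF K] integral_kernel_partial2[OF K] holder_bd_components_pcont(1)[OF u] holder_bd_components_pcont(1)[OF u]]
      by (simp only: sum.distrib)
    \<comment> \<open>Symmetry of second derivatives lets the outer derivative carry the index of
      the convolved component, as in \<open>div_conv\<close>; the second family needs only an
      exchange of the sums.\<close>
    also have "(\<Sum>i\<in>UNIV. \<Sum>j\<in>UNIV. u x $ i * conv (partial i (partial j \<Psi>)) s (\<lambda>y. u y $ j) x) = T"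
      unfolding T_def div_conv_def sum_distrib_left by (subst sym) (rule refl)
    also have "(\<Sum>i\<in>UNIV. \<Sum>j\<in>UNIV. u x $ j * conv (partial i (partial j \<Psi>)) s (\<lambda>y. u y $ i) x) = T"
      unfolding T_def div_conv_def sum_distrib_left by (rule sum.swap)
    finally have q: "quad \<Psi> u s x = S + T + T" .
    have "\<bar>S\<bar> \<le> L * (N\<^sup>2 * s powr (2 * \<theta>))"
      unfolding S_def L_def
    proof (rule abs_double_sum_le)
      fix i j
      have p: "pcont (\<lambda>y. (u y $ i - u x $ i) * (u y $ j - u x $ j))"
        by (intro pcont_mult pcont_diff pcont_const holder_bd_components_pcont[OF u])
      have "\<bar>conv (partial i (partial j \<Psi>)) s (\<lambda>y. (u y $ i - u x $ i) * (u y $ j - u x $ j)) x\<bar> \<le> N\<^sup>2 * \<bar>s\<bar> powr (2 * \<theta>) * (\<integral>z. \<bar>partial i (partial j \<Psi>) z\<bar> \<partial>lborel)"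
      proof (rule conv_Hoelder[OF kernel_partial2[OF K] integral_kernel_partial2[OF K] p])
        fix y
        have h: "\<bar>u y $ i - u x $ i\<bar> \<le> N * norm (y - x) powr \<theta>" for i
          using holder_bdD(3)[OF holder_bd_component[OF u(1)], of y i x] by simp
        have "\<bar>(u y $ i - u x $ i) * (u y $ j - u x $ j)\<bar> \<le> (N * norm (y - x) powr \<theta>) * (N * norm (y - x) powr \<theta>)"
          unfolding abs_mult by (intro mult_mono h mult_nonneg_nonneg N) auto
        also have "\<dots> = N\<^sup>2 * norm (y - x) powr (2 * \<theta>)"
          by (simp add: power2_eq_square powr_add[symmetric] algebra_simps mult_2)
        finally show "\<bar>(u y $ i - u x $ i) * (u y $ j - u x $ j) - (u x $ i - u x $ i) * (u x $ j - u x $ j)\<bar> \<le> N\<^sup>2 * norm (y - x) powr (2 * \<theta>)"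
          by simp
      qed (use u(2) in auto)
      then show "\<bar>conv (partial i (partial j \<Psi>)) s (\<lambda>y. (u y $ i - u x $ i) * (u y $ j - u x $ j)) x\<bar> \<le> (\<integral>z. \<bar>partial i (partial j \<Psi>) z\<bar> \<partial>lborel) * (N\<^sup>2 * s powr (2 * \<theta>))"
        using s by (simp add: algebra_simps)
    qed
    moreover have "\<bar>T\<bar> \<le> CARD('n) * (N * E)"
    proof -
      have "\<bar>T\<bar> \<le> (\<Sum>j\<in>UNIV. \<bar>u x $ j * div_conv (partial j \<Psi>) u s x\<bar>)" unfolding T_def by (rule sum_abs)
      also have "\<dots> \<le> (\<Sum>j\<in>(UNIV::'n set). N * E)"
      proof (rule sum_mono)
        fix j show "\<bar>u x $ j * div_conv (partial j \<Psi>) u s x\<bar> \<le> N * E"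
          unfolding abs_mult using holder_bdD(2)[OF holder_bd_component[OF u(1)], of x j] N by (intro mult_mono E) auto
      qed
      finally show ?thesis by simp
    qed
    moreover have "0 \<le> L * (N * E)" "0 \<le> CARD('n) * (N\<^sup>2 * s powr (2 * \<theta>))" using L0 N E0 by auto
    moreover have "\<bar>S + T + T\<bar> \<le> \<bar>S\<bar> + 2 * \<bar>T\<bar>" by linarith
    moreover have "(L + 2 * CARD('n)) * (N\<^sup>2 * s powr (2 * \<theta>) + N * E) = L * (N\<^sup>2 * s powr (2 * \<theta>)) + L * (N * E)
      + 2 * (CARD('n) * (N\<^sup>2 * s powr (2 * \<theta>))) + 2 * (CARD('n) * (N * E))"
      by (simp add: algebra_simps)
    ultimately show "\<bar>quad \<Psi> u s x\<bar> \<le> (L + 2 * CARD('n)) * (N\<^sup>2 * s powr (2 * \<theta>) + N * E)"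
      unfolding q by linarith
  qed
qed

subsection \<open>The pressure\<close>

definition pressure :: "(real^'n \<Rightarrow> real^'n) \<Rightarrow> real^'n \<Rightarrow> real" where
  "pressure u x = (1 / bump_mass TYPE('n)) * (LBINT s:{0<..}. quad \<Phi>\<^sub>0 u s x / s)"

lemma powr_div_self: "s > 0 \<Longrightarrow> s powr a / s = s powr (a - 1)" for s :: real
  by (simp add: powr_diff)

lemma div_div_powr: "s > 0 \<Longrightarrow> c / s / s = c * s powr (- 2)" for s :: real
  using powr_numeral[of s "num.Bit0 num.One"] by (simp add: powr_minus power2_eq_square field_simps)

lemma kernel_Phi0_k: "k \<le> 7 \<Longrightarrow> kernel k \<Phi>\<^sub>0"
  by (rule kernel_mono[OF kernel_Phi0])

lemma test_function_partial_commute: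
  "test_function f \<Longrightarrow> partial i (partial j f) = partial j (partial i f)"
  using partial_commute test_functionD(2) by blast

lemma laplacian_partial:
  assumes f: "test_function f"
  shows "laplacian (partial i f) = partial i (laplacian f)"
proof
  fix x
  note t = test_function_partial
  have "partial i (laplacian f) x = (\<Sum>k\<in>UNIV. partial i (partial k (partial k f)) x)"
    unfolding laplacian_def[abs_def] by (rule partial_sum) (intro test_functionD t f)
  also have "\<dots> = (\<Sum>k\<in>UNIV. partial k (partial k (partial i f)) x)"
    by (simp only: test_function_partial_commute[OF t[OF f], of i] test_function_partial_commute[OF f, of i])
  finally show "laplacian (partial i f) x = partial i (laplacian f) x" by (simp add: laplacian_def)
qed

text \<open>Collects what a scale integral needs: size at small scales, decay at large ones, and the
  derivative kernels that enter the Lipschitz estimate. The constant depends on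
  \<open>\<Psi>\<close> alone.\<close>

lemma quad_scale_bounds:
  fixes \<Psi> :: "real^'n \<Rightarrow> real"
  assumes K: "kernel (Suc (Suc (Suc (Suc 0)))) \<Psi>"
  shows "\<exists>C\<ge>0. \<forall>\<theta> N u s x. holder_bd \<theta> N u \<longrightarrow> \<theta> > 0 \<longrightarrow> s > 0 \<longrightarrow>
    \<bar>quad \<Psi> u s x / s\<bar> \<le> C * N\<^sup>2 * s powr (\<theta> - 1) \<and>
    \<bar>quad \<Psi> u s x / s\<bar> \<le> C * N\<^sup>2 * s powr (- 2) \<and>
    (\<forall>k. \<bar>quad (partial k \<Psi>) u s x\<bar> \<le> C * N\<^sup>2 * s powr \<theta>)"
proof -
  have K2: "kernel (Suc (Suc 0)) \<Psi>" and K3: "kernel (Suc (Suc (Suc 0))) \<Psi>" by (auto intro: kernel_mono[OF K])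
  obtain C1 where C1: "C1 \<ge> 0" "\<And>\<theta> N u s x. holder_bd \<theta> N u \<Longrightarrow> \<theta> > 0 \<Longrightarrow> s > 0 \<Longrightarrow> \<bar>quad \<Psi> u s x\<bar> \<le> C1 * N\<^sup>2 * s powr \<theta>"
    using quad_small[OF K2] by metis
  obtain C2 where C2: "C2 \<ge> 0" "\<And>\<theta> N u s x. holder_bd \<theta> N u \<Longrightarrow> \<theta> > 0 \<Longrightarrow> s > 0 \<Longrightarrow> \<bar>quad \<Psi> u s x\<bar> \<le> C2 * N\<^sup>2 / s"
    using quad_large[OF K3] by metis
  have "\<exists>C\<ge>0. \<forall>\<theta> N u s x. holder_bd \<theta> N u \<longrightarrow> \<theta> > 0 \<longrightarrow> s > 0 \<longrightarrow> \<bar>quad (partial k \<Psi>) u s x\<bar> \<le> C * N\<^sup>2 * s powr \<theta>" for k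
    using quad_small[OF kernel_partial[OF K3, of k]] by metis
  then obtain C3 where C3: "\<And>k. C3 k \<ge> 0" "\<And>k \<theta> N u s x. holder_bd \<theta> N u \<Longrightarrow> \<theta> > 0 \<Longrightarrow> s > 0 \<Longrightarrow> \<bar>quad (partial k \<Psi>) u s x\<bar> \<le> C3 k * N\<^sup>2 * s powr \<theta>"
    by metis
  define C where "C = C1 + C2 + (\<Sum>k\<in>UNIV. C3 k)"
  have S: "C3 k \<le> (\<Sum>k\<in>UNIV. C3 k)" for k by (rule member_le_sum) (auto simp: C3)
  have S0: "(\<Sum>k\<in>UNIV. C3 k) \<ge> 0" by (intro sum_nonneg C3)
  have le: "C1 \<le> C" "C2 \<le> C" "C3 k \<le> C" for k using S[of k] S0 C1 C2 by (auto simp: C_def)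
  show ?thesis
  proof (intro exI[of _ C] conjI allI impI)
    show "C \<ge> 0" using C1 C2 S0 by (simp add: C_def)
    fix \<theta> N s :: real and u :: "real^'n \<Rightarrow> real^'n" and x :: "real^'n" and k :: 'n assume u: "holder_bd \<theta> N u" "\<theta> > 0" and s: "s > 0"
    have mono: "c * N\<^sup>2 * r \<le> C * N\<^sup>2 * r" if "c \<le> C" "r \<ge> 0" for c r
      using that by (intro mult_right_mono) auto
    have "\<bar>quad \<Psi> u s x / s\<bar> \<le> (C1 * N\<^sup>2 * s powr \<theta>) / s"
      using divide_right_mono[OF C1(2)[OF u s, of x], of s] s by simp
    also have "\<dots> = C1 * N\<^sup>2 * s powr (\<theta> - 1)" by (simp only: times_divide_eq_right[symmetric] powr_div_self[OF s])
    also have "\<dots> \<le> C * N\<^sup>2 * s powr (\<theta> - 1)" by (rule mono[OF le(1)]) simp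
    finally show "\<bar>quad \<Psi> u s x / s\<bar> \<le> C * N\<^sup>2 * s powr (\<theta> - 1)" .
    have "\<bar>quad \<Psi> u s x / s\<bar> \<le> (C2 * N\<^sup>2 / s) / s"
      using divide_right_mono[OF C2(2)[OF u s, of x], of s] s by simp
    also have "\<dots> = C2 * N\<^sup>2 * s powr (- 2)" by (rule div_div_powr[OF s])
    also have "\<dots> \<le> C * N\<^sup>2 * s powr (- 2)" by (rule mono[OF le(2)]) simp
    finally show "\<bar>quad \<Psi> u s x / s\<bar> \<le> C * N\<^sup>2 * s powr (- 2)" .
    show "\<bar>quad (partial k \<Psi>) u s x\<bar> \<le> C * N\<^sup>2 * s powr \<theta>"
      using C3(2)[OF u s, of k x] mono[OF le(3)[of k], of "s powr \<theta>"] by simp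
  qed
qed

text \<open>Differentiating the convolutions costs \<open>1 / s\<close>, and the division by
  \<open>s\<close> another one.\<close>

lemma quad_Lipschitz:
  fixes \<Psi> :: "real^'n \<Rightarrow> real" and B :: real
  assumes u: "holder_bd \<theta> N u" "\<theta> > 0" and K: "kernel (Suc (Suc (Suc 0))) \<Psi>" and s: "s > 0"
    and B: "\<And>k x. \<bar>quad (partial k \<Psi>) u s x\<bar> \<le> B"
  shows "\<bar>quad \<Psi> u s x / s - quad \<Psi> u s y / s\<bar> \<le> CARD('n) * B * s powr (- 2) * norm (x - y)"
proof -
  have s0: "s \<noteq> 0" using s by simp
  have "\<bar>partial k (quad \<Psi> u s) z\<bar> \<le> B / s" for k z
    using B[of k z] s by (simp add: partial_quad[OF u K s0] divide_right_mono)
  from Lipschitz_partial[OF C_k_quad[OF u K s0] this, of x y]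
  have "\<bar>quad \<Psi> u s x - quad \<Psi> u s y\<bar> / s \<le> CARD('n) * (B / s) * norm (x - y) / s"
    using s by (intro divide_right_mono) auto
  also have "\<dots> = CARD('n) * norm (x - y) * (B / s / s)" by simp
  also have "\<dots> = CARD('n) * B * s powr (- 2) * norm (x - y)" unfolding div_div_powr[OF s] by simp
  finally show ?thesis using s by (simp add: diff_divide_distrib[symmetric])
qed

lemma periodic_quad_div:
  assumes u: "holder_bd \<theta> N u" "\<theta> > 0" and K: "kernel (Suc (Suc k)) \<Psi>"
  shows "periodic (\<lambda>x. quad \<Psi> u s x / s)"
  using pcontD(1)[OF pcont_quad[OF u K]] by (simp add: periodic_def)

text \<open>The scale integral with \<open>\<alpha> = \<theta>\<close>. It places the pressure in
  the class where uniqueness is proved and also supplies its sup bound in the \<open>C1\<close>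
  estimate.\<close>

lemma pressure_holder_bd:
  assumes \<theta>: "0 < \<theta>" "\<theta> < 1"
  obtains C where "C \<ge> 0" "\<And>N (u :: real^'n \<Rightarrow> real^'n). holder_bd \<theta> N u \<Longrightarrow> holder_bd \<theta> (C * N\<^sup>2) (pressure u)"
proof -
  have K: "kernel (Suc (Suc (Suc (Suc 0)))) (\<Phi>\<^sub>0 :: real^'n \<Rightarrow> real)" by (rule kernel_Phi0_k) simp
  have K3: "kernel (Suc (Suc (Suc 0))) (\<Phi>\<^sub>0 :: real^'n \<Rightarrow> real)" by (rule kernel_Phi0_k) simp
  define M where "M = bump_mass TYPE('n)"
  have M: "M > 0" unfolding M_def by (rule bump_mass_pos)
  obtain C where C0: "C \<ge> 0" "\<forall>\<theta> N u s x. holder_bd \<theta> N u \<longrightarrow> \<theta> > 0 \<longrightarrow> s > 0 \<longrightarrow>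
    \<bar>quad (\<Phi>\<^sub>0 :: real^'n \<Rightarrow> real) u s x / s\<bar> \<le> C * N\<^sup>2 * s powr (\<theta> - 1) \<and> \<bar>quad (\<Phi>\<^sub>0 :: real^'n \<Rightarrow> real) u s x / s\<bar> \<le> C * N\<^sup>2 * s powr (- 2) \<and>
    (\<forall>k. \<bar>quad (partial k (\<Phi>\<^sub>0 :: real^'n \<Rightarrow> real)) u s x\<bar> \<le> C * N\<^sup>2 * s powr \<theta>)"
    using quad_scale_bounds[OF K] by blast
  have C: "C \<ge> 0"
    "\<And>\<theta> N u s x. holder_bd \<theta> N u \<Longrightarrow> \<theta> > 0 \<Longrightarrow> s > 0 \<Longrightarrow> \<bar>quad (\<Phi>\<^sub>0 :: real^'n \<Rightarrow> real) u s x / s\<bar> \<le> C * N\<^sup>2 * s powr (\<theta> - 1)"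
    "\<And>\<theta> N u s x. holder_bd \<theta> N u \<Longrightarrow> \<theta> > 0 \<Longrightarrow> s > 0 \<Longrightarrow> \<bar>quad (\<Phi>\<^sub>0 :: real^'n \<Rightarrow> real) u s x / s\<bar> \<le> C * N\<^sup>2 * s powr (- 2)"
    "\<And>\<theta> N u s x k. holder_bd \<theta> N u \<Longrightarrow> \<theta> > 0 \<Longrightarrow> s > 0 \<Longrightarrow> \<bar>quad (partial k (\<Phi>\<^sub>0 :: real^'n \<Rightarrow> real)) u s x\<bar> \<le> C * N\<^sup>2 * s powr \<theta>"
    using C0 by blast+
  show ?thesis
  proof (rule that[of "(1 / M) * (CARD('n) * C * scale_const \<theta>)"])
    show "(1 / M) * (CARD('n) * C * scale_const \<theta>) \<ge> 0" using C(1) M scale_const_nonneg[OF \<theta>] by simp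
    fix N and u :: "real^'n \<Rightarrow> real^'n" assume u: "holder_bd \<theta> N u"
    define B where "B = CARD('n) * (C * N\<^sup>2)"
    have "1 * (C * N\<^sup>2) \<le> B" unfolding B_def using C(1) by (intro mult_right_mono) (auto simp: Suc_le_eq)
    then have CB: "C * N\<^sup>2 \<le> B" by simp
    have B0: "B \<ge> 0" using C(1) by (simp add: B_def)
    have meas: "(\<lambda>s. quad \<Phi>\<^sub>0 u s x / s) \<in> borel_measurable borel" for x
      using measurable_quad[OF u \<theta>(1) K, of x] by measurable
    have small: "\<bar>quad \<Phi>\<^sub>0 u s x / s\<bar> \<le> B * s powr (\<theta> - 1)" if "0 < s" for s x
      by (rule order_trans[OF C(2)[OF u \<theta>(1) that] mult_right_mono[OF CB powr_ge_zero]])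
    have large: "\<bar>quad \<Phi>\<^sub>0 u s x / s\<bar> \<le> B * s powr (- 2)" if "1 < s" for s x
      by (rule order_trans[OF C(3)[OF u \<theta>(1)] mult_right_mono[OF CB powr_ge_zero]]) (use that in simp)
    have lip: "\<bar>quad \<Phi>\<^sub>0 u s x / s - quad \<Phi>\<^sub>0 u s y / s\<bar> \<le> B * s powr (\<theta> - 2) * norm (x - y)" if s: "0 < s" for s x y
    proof -
      have "\<bar>quad \<Phi>\<^sub>0 u s x / s - quad \<Phi>\<^sub>0 u s y / s\<bar> \<le> CARD('n) * (C * N\<^sup>2 * s powr \<theta>) * s powr (- 2) * norm (x - y)"
        by (rule quad_Lipschitz[OF u \<theta>(1) K3 s C(4)[OF u \<theta>(1) s]])
      also have "\<dots> = B * (s powr \<theta> * s powr (- 2)) * norm (x - y)" by (simp add: B_def)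
      also have "s powr \<theta> * s powr (- 2) = s powr (\<theta> - 2)" by (simp add: powr_add[symmetric])
      finally show ?thesis .
    qed
    have "holder_bd \<theta> ((1 / M) * (B * scale_const \<theta>)) (\<lambda>x. (1 / M) * (LBINT s:{0<..}. quad \<Phi>\<^sub>0 u s x / s))"
      by (rule holder_bd_cmult[OF holder_bd_scale_integral[OF meas periodic_quad_div[OF u \<theta>(1) K] \<theta> B0 small large lip]])
        (use M in simp_all)
    then show "holder_bd \<theta> ((1 / M) * (CARD('n) * C * scale_const \<theta>) * N\<^sup>2) (pressure u)"
      unfolding pressure_def[abs_def] M_def[symmetric] B_def by (simp add: mult_ac)
  qed
qed

lemma integral_quad_cube:
  fixes u :: "real^'n \<Rightarrow> real^'n"
  assumes u: "holder_bd \<theta> N u" "\<theta> > 0" and K: "kernel (Suc (Suc 0)) \<Psi>"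
  shows "(\<integral>x. quad \<Psi> u s x \<partial>cube_measure) = 0"
proof -
  have p: "pcont (conv (partial i (partial j \<Psi>)) s (\<lambda>y. u y $ i * u y $ j))" for i j
    by (intro pcont_conv[OF kernel_partial2[OF K]] holder_bd_components_pcont[OF u])
  have "(\<integral>x. quad \<Psi> u s x \<partial>cube_measure) = (\<Sum>i\<in>UNIV. \<Sum>j\<in>UNIV. \<integral>x. conv (partial i (partial j \<Psi>)) s (\<lambda>y. u y $ i * u y $ j) x \<partial>cube_measure)"
    unfolding quad_def
    by (subst Bochner_Integration.integral_sum, intro integrable_cube_pcont pcont_sum p,
        subst Bochner_Integration.integral_sum, intro integrable_cube_pcont p, rule refl)
  also have "\<dots> = 0"
    by (simp add: integral_conv[OF kernel_partial2[OF K] holder_bd_components_pcont(2)[OF u]] integral_kernel_partial2[OF K])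
  finally show ?thesis .
qed

text \<open>Reduces integrals of the pressure against a function to a single scale.\<close>

lemma scale_quad_fubini:
  fixes u :: "real^'n \<Rightarrow> real^'n"
  assumes u: "holder_bd \<theta> N u" "0 < \<theta>" and \<phi>: "pcont \<phi>"
  shows "(\<integral>x. pressure u x * \<phi> x \<partial>cube_measure)
    = (LBINT s:{0<..}. (\<integral>x. quad \<Phi>\<^sub>0 u s x / s * \<phi> x \<partial>cube_measure)) / bump_mass TYPE('n)"
proof -
  have K: "kernel (Suc (Suc (Suc (Suc 0)))) (\<Phi>\<^sub>0 :: real^'n \<Rightarrow> real)" by (rule kernel_Phi0_k) simp
  obtain C where C0: "C \<ge> 0" "\<forall>\<theta> N u s x. holder_bd \<theta> N u \<longrightarrow> \<theta> > 0 \<longrightarrow> s > 0 \<longrightarrow>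
    \<bar>quad (\<Phi>\<^sub>0 :: real^'n \<Rightarrow> real) u s x / s\<bar> \<le> C * N\<^sup>2 * s powr (\<theta> - 1) \<and> \<bar>quad (\<Phi>\<^sub>0 :: real^'n \<Rightarrow> real) u s x / s\<bar> \<le> C * N\<^sup>2 * s powr (- 2) \<and>
    (\<forall>k. \<bar>quad (partial k (\<Phi>\<^sub>0 :: real^'n \<Rightarrow> real)) u s x\<bar> \<le> C * N\<^sup>2 * s powr \<theta>)"
    using quad_scale_bounds[OF K] by blast
  have C: "C \<ge> 0"
    "\<And>\<theta> N u s x. holder_bd \<theta> N u \<Longrightarrow> \<theta> > 0 \<Longrightarrow> s > 0 \<Longrightarrow> \<bar>quad (\<Phi>\<^sub>0 :: real^'n \<Rightarrow> real) u s x / s\<bar> \<le> C * N\<^sup>2 * s powr (\<theta> - 1)"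
    "\<And>\<theta> N u s x. holder_bd \<theta> N u \<Longrightarrow> \<theta> > 0 \<Longrightarrow> s > 0 \<Longrightarrow> \<bar>quad (\<Phi>\<^sub>0 :: real^'n \<Rightarrow> real) u s x / s\<bar> \<le> C * N\<^sup>2 * s powr (- 2)"
    using C0 by blast+
  obtain B where B: "B \<ge> 0" "\<And>x. \<bar>\<phi> x\<bar> \<le> B" using pcont_bounded[OF \<phi>] by blast
  have bound: "\<bar>a * \<phi> x\<bar> \<le> B * (C * N\<^sup>2) * r" if "\<bar>a\<bar> \<le> C * N\<^sup>2 * r" "r \<ge> 0" for a r x
  proof -
    have "\<bar>a * \<phi> x\<bar> \<le> (C * N\<^sup>2 * r) * B"
      unfolding abs_mult using that C(1) by (intro mult_mono B) auto
    then show ?thesis by (simp add: algebra_simps)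
  qed
  have "(\<integral>x. (LBINT s:{0<..}. quad \<Phi>\<^sub>0 u s x / s * \<phi> x) \<partial>cube_measure)
     = (LBINT s:{0<..}. (\<integral>x. quad \<Phi>\<^sub>0 u s x / s * \<phi> x \<partial>cube_measure))"
  proof (rule scale_fubini[where \<alpha> = \<theta> and B = "B * (C * N\<^sup>2)"])
    have "(\<lambda>p. \<phi> (snd p)) \<in> borel_measurable (borel \<Otimes>\<^sub>M borel)"
      by (rule measurable_compose[OF measurable_snd pcont_measurable[OF \<phi>]])
    then show "(\<lambda>p. quad \<Phi>\<^sub>0 u (fst p) (snd p) / fst p * \<phi> (snd p)) \<in> borel_measurable (borel \<Otimes>\<^sub>M borel)"
      using measurable_quad2[OF u K] by measurable
  qed (use u B C(1) bound[OF C(2)[OF u]] bound[OF C(3)[OF u]] in auto)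
  moreover have "pressure u x * \<phi> x = (LBINT s:{0<..}. quad \<Phi>\<^sub>0 u s x / s * \<phi> x) / bump_mass TYPE('n)" for x
  proof -
    have "(LBINT s:{0<..}. quad \<Phi>\<^sub>0 u s x / s * \<phi> x) = (LBINT s:{0<..}. quad \<Phi>\<^sub>0 u s x / s) * \<phi> x"
      unfolding set_lebesgue_integral_def real_scaleR_def mult.assoc[symmetric] by (rule integral_mult_left_zero)
    then show ?thesis unfolding pressure_def by (simp only: times_divide_eq_left mult_1_left)
  qed
  ultimately show ?thesis by simp
qed

lemma integral_pressure:
  fixes u :: "real^'n \<Rightarrow> real^'n"
  assumes u: "holder_bd \<theta> N u" "0 < \<theta>"
  shows "(\<integral>x. pressure u x \<partial>cube_measure) = 0"
proof -
  have K: "kernel (Suc (Suc 0)) (\<Phi>\<^sub>0 :: real^'n \<Rightarrow> real)" by (rule kernel_Phi0_k) simp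
  show ?thesis
    using scale_quad_fubini[OF u pcont_const[of 1]] integral_quad_cube[OF u K] by (simp add: set_lebesgue_integral_def)
qed

text \<open>Duality passes the convolution to \<open>laplacian \<phi>\<close>, at scale
  \<open>- s\<close>. Moving both derivatives off the kernel gives \<open>(- s) * (- s)\<close>,
  evenness of \<open>\<Phi>\<^sub>0\<close> restores the scale \<open>s\<close>, and the division by
  \<open>s\<close> leaves the one factor \<open>s\<close> that \<open>scale_representation\<close>
  requires.\<close>

lemma pair_quad_laplacian:
  fixes u :: "real^'n \<Rightarrow> real^'n"
  assumes u: "holder_bd \<theta> N u" "0 < \<theta>" and \<phi>: "test_function \<phi>" and s: "s > 0"
  shows "(\<integral>x. quad \<Phi>\<^sub>0 u s x / s * laplacian \<phi> x \<partial>cube_measure)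
    = (\<integral>x. (\<Sum>i\<in>UNIV. \<Sum>j\<in>UNIV. u x $ i * u x $ j * (s * conv \<Phi>\<^sub>0 s (laplacian (partial j (partial i \<phi>))) x)) \<partial>cube_measure)"
proof -
  have K2: "kernel (Suc (Suc 0)) (\<Phi>\<^sub>0 :: real^'n \<Rightarrow> real)" by (rule kernel_Phi0_k) simp
  have K1: "kernel (Suc 0) (\<Phi>\<^sub>0 :: real^'n \<Rightarrow> real)" by (rule kernel_Phi0_k) simp
  note t = test_function_partial
  have tl: "test_function (laplacian \<phi>)" by (rule test_function_laplacian[OF \<phi>])
  have s0: "- s \<noteq> 0" using s by simp
  have swap: "conv (partial i (partial j \<Phi>\<^sub>0)) (- s) (laplacian \<phi>) x = s * s * conv \<Phi>\<^sub>0 s (laplacian (partial j (partial i \<phi>))) x" for i j x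
  proof -
    have "conv (partial i (partial j \<Phi>\<^sub>0)) (- s) (laplacian \<phi>) x = - s * (- s * conv \<Phi>\<^sub>0 (- s) (partial j (partial i (laplacian \<phi>))) x)"
      using conv_partial_swap[OF kernel_partial[OF K2] test_functionD(1)[OF tl] test_functionD(2)[OF tl] s0, of i j x]
        conv_partial_swap[OF K1 test_functionD(1)[OF t[OF tl]] test_functionD(2)[OF t[OF tl]] s0, of j i x]
      by simp
    also have "partial j (partial i (laplacian \<phi>)) = laplacian (partial j (partial i \<phi>))"
      using laplacian_partial[OF \<phi>] laplacian_partial[OF t[OF \<phi>]] by simp
    also have "conv \<Phi>\<^sub>0 (- s) (laplacian (partial j (partial i \<phi>))) x = conv \<Phi>\<^sub>0 s (laplacian (partial j (partial i \<phi>))) x"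
      by (rule conv_even[OF K1 _ Phi0_even]) (intro test_function_pcont test_function_laplacian t \<phi>)
    finally show ?thesis by simp
  qed
  have pF: "pcont (\<lambda>y. u y $ i * u y $ j)" for i j by (rule holder_bd_components_pcont[OF u])
  have pl: "pcont (laplacian \<phi>)" by (rule test_function_pcont[OF tl])
  have pq: "pcont (\<lambda>x. conv (partial i (partial j \<Phi>\<^sub>0)) s (\<lambda>y. u y $ i * u y $ j) x * laplacian \<phi> x)" for i j
    by (intro pcont_mult pcont_conv[OF kernel_partial2[OF K2]] pF pl)
  have pr: "pcont (\<lambda>x. u x $ i * u x $ j * (s * conv \<Phi>\<^sub>0 s (laplacian (partial j (partial i \<phi>))) x))" for i j
    by (intro pcont_mult[OF pF] pcont_mult[OF pcont_const] pcont_conv[OF K2] test_function_pcont test_function_laplacian t \<phi>)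
  have "(\<integral>x. quad \<Phi>\<^sub>0 u s x / s * laplacian \<phi> x \<partial>cube_measure)
     = (\<integral>x. (\<Sum>i\<in>UNIV. \<Sum>j\<in>UNIV. conv (partial i (partial j \<Phi>\<^sub>0)) s (\<lambda>y. u y $ i * u y $ j) x * laplacian \<phi> x) \<partial>cube_measure) / s"
    by (simp add: quad_def sum_distrib_right)
  also have "\<dots> = (\<Sum>i\<in>UNIV. \<Sum>j\<in>UNIV. \<integral>x. conv (partial i (partial j \<Phi>\<^sub>0)) s (\<lambda>y. u y $ i * u y $ j) x * laplacian \<phi> x \<partial>cube_measure) / s"
    by (subst Bochner_Integration.integral_sum, intro integrable_cube_pcont pcont_sum pq,
        subst Bochner_Integration.integral_sum, intro integrable_cube_pcont pq, rule refl)
  also have "\<dots> = (\<Sum>i\<in>UNIV. \<Sum>j\<in>UNIV. \<integral>x. s * (u x $ i * u x $ j * (s * conv \<Phi>\<^sub>0 s (laplacian (partial j (partial i \<phi>))) x)) \<partial>cube_measure) / s"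
    by (simp only: conv_adjoint[OF kernel_partial2[OF K2] pF pl] swap) (simp only: mult.assoc mult.left_commute)
  also have "\<dots> = (\<Sum>i\<in>UNIV. \<Sum>j\<in>UNIV. \<integral>x. u x $ i * u x $ j * (s * conv \<Phi>\<^sub>0 s (laplacian (partial j (partial i \<phi>))) x) \<partial>cube_measure)"
    unfolding integral_mult_right_zero sum_distrib_left[symmetric] using s by simp
  also have "\<dots> = (\<integral>x. (\<Sum>i\<in>UNIV. \<Sum>j\<in>UNIV. u x $ i * u x $ j * (s * conv \<Phi>\<^sub>0 s (laplacian (partial j (partial i \<phi>))) x)) \<partial>cube_measure)"
    by (rule sym) (subst Bochner_Integration.integral_sum, intro integrable_cube_pcont pcont_sum pr,
        subst Bochner_Integration.integral_sum, intro integrable_cube_pcont pr, rule refl)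
  finally show ?thesis .
qed

text \<open>Once the kernels act on derivatives of \<open>\<phi>\<close>, the order of integration
  is exchanged back and each integral over scales is evaluated by
  \<open>scale_representation\<close>.\<close>

lemma pressure_equation:
  fixes u :: "real^'n \<Rightarrow> real^'n"
  assumes u: "holder_bd \<theta> N u" "0 < \<theta>" and \<phi>: "test_function \<phi>"
  shows "(\<integral>x. pressure u x * laplacian \<phi> x \<partial>cube_measure)
    = - (\<Sum>i\<in>UNIV. \<Sum>j\<in>UNIV. \<integral>x. u x $ i * u x $ j * partial j (partial i \<phi>) x \<partial>cube_measure)"
proof -
  have K: "kernel (Suc 0) (\<Phi>\<^sub>0 :: real^'n \<Rightarrow> real)" by (rule kernel_Phi0_k) simp
  define M where "M = bump_mass TYPE('n)"
  have M: "M > 0" unfolding M_def by (rule bump_mass_pos)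
  note t = test_function_partial
  have tij: "test_function (partial j (partial i \<phi>))" for i j by (intro t \<phi>)
  have pij: "pcont (laplacian (partial j (partial i \<phi>)))" for i j
    by (intro test_function_pcont test_function_laplacian tij)
  have pF: "pcont (\<lambda>y. u y $ i * u y $ j)" for i j by (rule holder_bd_components_pcont[OF u])
  define k where "k = (\<lambda>i j s x. s * conv \<Phi>\<^sub>0 s (laplacian (partial j (partial i \<phi>))) x)"
  define r where "r = (\<lambda>s x. \<Sum>i\<in>UNIV. \<Sum>j\<in>UNIV. u x $ i * u x $ j * k i j s x)"
  have "\<exists>B\<ge>0. (\<forall>s x. 0 < s \<longrightarrow> s \<le> 1 \<longrightarrow> \<bar>k i j s x\<bar> \<le> B * s powr (1 - 1)) \<and> (\<forall>s x. 0 < s \<longrightarrow> \<bar>k i j s x\<bar> \<le> B * s powr (- 2))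
     \<and> (\<forall>x. set_integrable lborel {0<..} (\<lambda>s. k i j s x))" for i j
    unfolding k_def by (rule scale_laplacian_bounds[OF tij])
  then obtain B where B: "\<And>i j. B i j \<ge> 0" "\<And>i j s x. 0 < s \<Longrightarrow> s \<le> 1 \<Longrightarrow> \<bar>k i j s x\<bar> \<le> B i j * s powr (1 - 1)"
    "\<And>i j s x. 0 < s \<Longrightarrow> \<bar>k i j s x\<bar> \<le> B i j * s powr (- 2)"
    "\<And>i j x. set_integrable lborel {0<..} (\<lambda>s. k i j s x)"
    by metis
  have F: "\<bar>u x $ i * u x $ j\<bar> \<le> 2 * N\<^sup>2" for x i j
    using holder_bdD(2)[OF holder_bd_mult[OF holder_bd_component[OF u(1)] holder_bd_component[OF u(1)]]] by simp
  define B' where "B' = (\<Sum>i\<in>UNIV. \<Sum>j\<in>UNIV. 2 * N\<^sup>2 * B i j)"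
  have rb: "\<bar>r s x\<bar> \<le> B' * X" if "\<And>i j. \<bar>k i j s x\<bar> \<le> B i j * X" "X \<ge> 0" for s x X
    unfolding r_def B'_def
  proof (rule abs_double_sum_le)
    fix i j
    have "\<bar>u x $ i * u x $ j * k i j s x\<bar> \<le> (2 * N\<^sup>2) * (B i j * X)"
      unfolding abs_mult[of "u x $ i * u x $ j"] by (intro mult_mono F that) auto
    then show "\<bar>u x $ i * u x $ j * k i j s x\<bar> \<le> 2 * N\<^sup>2 * B i j * X" by simp
  qed
  have "(\<integral>x. pressure u x * laplacian \<phi> x \<partial>cube_measure)
     = (LBINT s:{0<..}. (\<integral>x. quad \<Phi>\<^sub>0 u s x / s * laplacian \<phi> x \<partial>cube_measure)) / M"
    unfolding M_def by (rule scale_quad_fubini[OF u test_function_pcont[OF test_function_laplacian[OF \<phi>]]])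
  also have "(LBINT s:{0<..}. (\<integral>x. quad \<Phi>\<^sub>0 u s x / s * laplacian \<phi> x \<partial>cube_measure)) = (LBINT s:{0<..}. (\<integral>x. r s x \<partial>cube_measure))"
  proof (rule set_lebesgue_integral_cong)
    show "\<forall>s. s \<in> {0<..} \<longrightarrow> (\<integral>x. quad \<Phi>\<^sub>0 u s x / s * laplacian \<phi> x \<partial>cube_measure) = (\<integral>x. r s x \<partial>cube_measure)"
    proof (intro allI impI)
      fix s :: real assume "s \<in> {0<..}"
      then have "s > 0" by simp
      from pair_quad_laplacian[OF u \<phi> this]
      show "(\<integral>x. quad \<Phi>\<^sub>0 u s x / s * laplacian \<phi> x \<partial>cube_measure) = (\<integral>x. r s x \<partial>cube_measure)"
        unfolding r_def k_def .
    qed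
  qed simp
  also have "\<dots> = (\<integral>x. (LBINT s:{0<..}. r s x) \<partial>cube_measure)"
  proof (rule scale_fubini[where \<alpha> = 1 and B = B', symmetric])
    have "(\<lambda>p. u (snd p) $ i * u (snd p) $ j) \<in> borel_measurable (borel \<Otimes>\<^sub>M borel)" for i j
      by (rule measurable_compose[OF measurable_snd pcont_measurable[OF pF]])
    then show "(\<lambda>p. r (fst p) (snd p)) \<in> borel_measurable (borel \<Otimes>\<^sub>M borel)"
      unfolding r_def k_def using measurable_conv2[OF K pij] by measurable
    show "B' \<ge> 0" unfolding B'_def by (intro sum_nonneg mult_nonneg_nonneg B) auto
    fix s :: real and x :: "real^'n"
    show "\<bar>r s x\<bar> \<le> B' * s powr (1 - 1)" if "0 < s" "s \<le> 1"
      by (rule rb[OF B(2)[OF that] powr_ge_zero])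
    show "\<bar>r s x\<bar> \<le> B' * s powr (- 2)" if "1 < s"
    proof -
      have s: "0 < s" using that by simp
      show ?thesis by (rule rb[OF B(3)[OF s] powr_ge_zero])
    qed
  qed simp
  also have "\<dots> = (\<integral>x. M * (\<Sum>i\<in>UNIV. \<Sum>j\<in>UNIV. - (u x $ i * u x $ j * partial j (partial i \<phi>) x)) \<partial>cube_measure)"
  proof (rule arg_cong[where f = "integral\<^sup>L cube_measure"], rule ext)
    fix x
    have h1: "set_integrable lborel {0<..} (\<lambda>s. \<Sum>j\<in>UNIV. u x $ i * u x $ j * k i j s x)" for i
      by (rule set_integral_linear_combination(1)[where g = "\<lambda>j s. k i j s x"]) (rule B(4))
    have h2: "(LBINT s:{0<..}. (\<Sum>j\<in>UNIV. u x $ i * u x $ j * k i j s x)) = (\<Sum>j\<in>UNIV. u x $ i * u x $ j * (LBINT s:{0<..}. k i j s x))" for i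
      by (rule set_integral_linear_combination(2)[where g = "\<lambda>j s. k i j s x"]) (rule B(4))
    have "(LBINT s:{0<..}. r s x) = (LBINT s:{0<..}. (\<Sum>i\<in>UNIV. 1 * (\<Sum>j\<in>UNIV. u x $ i * u x $ j * k i j s x)))"
      unfolding r_def by (simp only: mult_1_left)
    also have "\<dots> = (\<Sum>i\<in>UNIV. 1 * (LBINT s:{0<..}. (\<Sum>j\<in>UNIV. u x $ i * u x $ j * k i j s x)))"
      by (rule set_integral_linear_combination(2)[where g = "\<lambda>i s. \<Sum>j\<in>UNIV. u x $ i * u x $ j * k i j s x"]) (rule h1)
    also have "\<dots> = (\<Sum>i\<in>UNIV. \<Sum>j\<in>UNIV. u x $ i * u x $ j * (LBINT s:{0<..}. k i j s x))"
      unfolding h2 mult_1_left ..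
    \<comment> \<open>The \<open>0\<close> is the mean of a derivative of a test function; the minus
      sign of the equation arises here.\<close>
    also have "\<dots> = (\<Sum>i\<in>UNIV. \<Sum>j\<in>UNIV. u x $ i * u x $ j * (M * (0 - partial j (partial i \<phi>) x)))"
      unfolding k_def M_def scale_representation[OF tij] integral_partial_cube[OF t[OF \<phi>]] ..
    finally show "(LBINT s:{0<..}. r s x) = M * (\<Sum>i\<in>UNIV. \<Sum>j\<in>UNIV. - (u x $ i * u x $ j * partial j (partial i \<phi>) x))"
      by (simp add: sum_distrib_left algebra_simps)
  qed
  also have "\<dots> = M * - (\<Sum>i\<in>UNIV. \<Sum>j\<in>UNIV. \<integral>x. u x $ i * u x $ j * partial j (partial i \<phi>) x \<partial>cube_measure)"
  proof -
    have p: "pcont (\<lambda>x. u x $ i * u x $ j * partial j (partial i \<phi>) x)" for i j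
      by (intro pcont_mult[OF pF] test_function_pcont tij)
    have "(\<integral>x. (\<Sum>i\<in>UNIV. \<Sum>j\<in>UNIV. u x $ i * u x $ j * partial j (partial i \<phi>) x) \<partial>cube_measure)
       = (\<Sum>i\<in>UNIV. \<Sum>j\<in>UNIV. \<integral>x. u x $ i * u x $ j * partial j (partial i \<phi>) x \<partial>cube_measure)"
      by (subst Bochner_Integration.integral_sum, intro integrable_cube_pcont pcont_sum p,
        subst Bochner_Integration.integral_sum, intro integrable_cube_pcont p, rule refl)
    then show ?thesis by (simp add: sum_negf)
  qed
  finally show ?thesis using M by simp
qed

subsection \<open>The pressure equation in the sense of distributions\<close>

lemma dist_laplacian_eq:
  assumes p: "pcont p" and \<phi>: "test_function \<phi>"
  shows "dist_laplacian (dist_of p) \<phi> = (\<integral>x. p x * laplacian \<phi> x \<partial>cube_measure)"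
proof -
  have pp: "pcont (\<lambda>x. p x * partial i (partial i \<phi>) x)" for i
    by (intro pcont_mult p test_function_pcont test_function_partial \<phi>)
  have "dist_laplacian (dist_of p) \<phi> = (\<Sum>i\<in>UNIV. \<integral>x. p x * partial i (partial i \<phi>) x \<partial>cube_measure)"
    by (simp add: dist_laplacian_def dist_partial_def dist_of_def integral_torus_pcont[OF pp])
  also have "\<dots> = (\<integral>x. p x * laplacian \<phi> x \<partial>cube_measure)"
    unfolding laplacian_def sum_distrib_left using integrable_cube_pcont[OF pp]
    by (subst Bochner_Integration.integral_sum) auto
  finally show ?thesis .
qed

lemma dist_div_div_tensor_eq:
  fixes u :: "real^'n \<Rightarrow> real^'n"
  assumes u: "holder_bd \<theta> N u" "0 < \<theta>" and \<phi>: "test_function \<phi>"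
  shows "dist_div_div_tensor u \<phi> = (\<Sum>i\<in>UNIV. \<Sum>j\<in>UNIV. \<integral>x. u x $ i * u x $ j * partial j (partial i \<phi>) x \<partial>cube_measure)"
proof -
  have "pcont (\<lambda>x. u x $ i * u x $ j * partial j (partial i \<phi>) x)" for i j
    by (intro pcont_mult[OF holder_bd_components_pcont(2)[OF u]] test_function_pcont test_function_partial \<phi>)
  then show ?thesis
    by (simp add: dist_div_div_tensor_def dist_partial_def dist_of_def integral_torus_pcont)
qed

section \<open>Passage to norms; existence and uniqueness of the pressure\<close>

lemma holder_bd_imp_space:
  assumes "holder_bd \<theta> N f"
  shows "f \<in> holder_space \<theta>"
proof -
  have "norm (f x - f y) / norm (x - y) powr \<theta> \<le> N" if "x \<noteq> y" for x y
    using holder_bdD(3)[OF assms, of x y] that by (simp add: pos_divide_le_eq)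
  then show ?thesis using holder_bdD(1,2)[OF assms] by (auto simp: holder_space_def)
qed

lemma sup_norm_le: "(\<And>x. norm (f x) \<le> N) \<Longrightarrow> sup_norm f \<le> N"
  unfolding sup_norm_def by (rule cSUP_least) auto

text \<open>The seminorm is a supremum over pairs of distinct points; bounding it in the reals
  requires that such pairs exist.\<close>

lemma ex_distinct: "\<exists>x y :: real^'n. x \<noteq> y"
  by (metis axis_eq_0_iff zero_neq_one)

lemma holder_seminorm_le:
  fixes f :: "real^'n \<Rightarrow> 'b::real_normed_vector"
  assumes "\<And>x y. norm (f x - f y) \<le> N * norm (x - y) powr \<theta>"
  shows "holder_seminorm \<theta> f \<le> N"
  unfolding holder_seminorm_def
proof (rule cSUP_least)
  show "{(x, y). x \<noteq> (y :: real^'n)} \<noteq> {}" using ex_distinct by auto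
  fix p :: "(real^'n) \<times> (real^'n)" assume "p \<in> {(x, y). x \<noteq> y}"
  then show "(case p of (x, y) \<Rightarrow> norm (f x - f y) / norm (x - y) powr \<theta>) \<le> N"
    using assms[of "fst p" "snd p"] by (auto simp: pos_divide_le_eq)
qed

text \<open>Membership makes the two suprema genuine bounds; both are nonnegative, so their sum
  dominates each of them.\<close>

lemma holder_space_imp_bd:
  fixes f :: "real^'n \<Rightarrow> 'b::real_normed_vector"
  assumes f: "f \<in> holder_space \<theta>"
  shows "holder_bd \<theta> (holder_norm \<theta> f) f"
proof -
  obtain M where M: "\<And>x. norm (f x) \<le> M" using f by (auto simp: holder_space_def)
  obtain K where K: "\<And>x y. x \<noteq> y \<Longrightarrow> norm (f x - f y) / norm (x - y) powr \<theta> \<le> K" using f by (auto simp: holder_space_def)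
  have s: "norm (f x) \<le> sup_norm f" for x
    unfolding sup_norm_def by (rule cSUP_upper) (auto intro!: bdd_aboveI2 M)
  have h: "norm (f x - f y) / norm (x - y) powr \<theta> \<le> holder_seminorm \<theta> f" if "x \<noteq> y" for x y
  proof -
    have "bdd_above ((\<lambda>(x, y). norm (f x - f y) / norm (x - y) powr \<theta>) ` {(x, y). x \<noteq> y})"
      using K by (intro bdd_aboveI2[where M = K]) auto
    from cSUP_upper[OF _ this, of "(x, y)"] show ?thesis using that by (simp add: holder_seminorm_def)
  qed
  have s0: "sup_norm f \<ge> 0" using s[of 0] norm_ge_zero[of "f 0"] by linarith
  obtain a b :: "real^'n" where ab: "a \<noteq> b" using ex_distinct by blast
  have h0: "holder_seminorm \<theta> f \<ge> 0" using h[OF ab] by (meson divide_nonneg_nonneg norm_ge_zero order_trans powr_ge_zero)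
  have "norm (f x - f y) \<le> holder_norm \<theta> f * norm (x - y) powr \<theta>" for x y
  proof (cases "x = y")
    case False
    then have "norm (f x - f y) \<le> holder_seminorm \<theta> f * norm (x - y) powr \<theta>"
      using h[OF False] by (simp add: pos_divide_le_eq)
    also have "\<dots> \<le> holder_norm \<theta> f * norm (x - y) powr \<theta>"
      using s0 by (intro mult_right_mono) (auto simp: holder_norm_def)
    finally show ?thesis .
  qed simp
  moreover have "norm (f x) \<le> holder_norm \<theta> f" for x using s[of x] h0 by (simp add: holder_norm_def)
  moreover have "periodic f" using f by (simp add: holder_space_def)
  ultimately show ?thesis by (simp add: holder_bd_def)
qed

lemma holder_bd_imp_norm_le: "holder_bd \<theta> N f \<Longrightarrow> holder_norm \<theta> f \<le> 2 * N"
  unfolding holder_norm_def using sup_norm_le[of f N] holder_seminorm_le[of f N \<theta>] holder_bdD(2,3) by fastforce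

lemma pressure_solution:
  fixes u :: "real^'n \<Rightarrow> real^'n"
  assumes u: "u \<in> holder_space \<theta>" and \<theta>: "0 < \<theta>" "\<theta> < 1"
  shows "zero_average_solution \<theta> u (pressure u)"
proof -
  note bd = holder_space_imp_bd[OF u]
  obtain C where "holder_bd \<theta> (C * (holder_norm \<theta> u)\<^sup>2) (pressure u)"
    using pressure_holder_bd[OF \<theta>] bd by metis
  note pbd = this
  have pc: "pcont (pressure u)" by (rule holder_bd_pcont[OF pbd \<theta>(1)])
  show ?thesis
    unfolding zero_average_solution_def dist_eq_def
    using holder_bd_imp_space[OF pbd] integral_pressure[OF bd \<theta>(1)]
      dist_laplacian_eq[OF pc] dist_div_div_tensor_eq[OF bd \<theta>(1)] pressure_equation[OF bd \<theta>(1)]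
    by (simp add: integral_torus_pcont[OF pc])
qed

text \<open>The right-hand side depends on \<open>u\<close> alone, so the difference of two
  solutions is weakly harmonic, continuous and of mean zero.\<close>

lemma zero_average_solution_unique:
  fixes u :: "real^'n \<Rightarrow> real^'n"
  assumes p: "zero_average_solution \<theta> u p" and p': "zero_average_solution \<theta> u p'" and \<theta>: "0 < \<theta>"
  shows "p = p'"
proof
  fix x
  have pc: "pcont r" if "zero_average_solution \<theta> u r" for r
    using holder_bd_pcont[OF holder_space_imp_bd \<theta>, of r] that by (simp add: zero_average_solution_def)
  have i: "integrable cube_measure (\<lambda>x. r x * f x)" if "zero_average_solution \<theta> u r" "pcont f" for r f
    by (intro integrable_cube_pcont pcont_mult pc that)
  have "p x - p' x = 0"
  proof (rule weakly_harmonic_zero)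
    show "pcont (\<lambda>x. p x - p' x)" by (intro pcont_diff pc p p')
    show "(\<integral>x. p x - p' x \<partial>cube_measure) = 0"
      using p p' integrable_cube_pcont[OF pc[OF p]] integrable_cube_pcont[OF pc[OF p']]
      by (simp add: zero_average_solution_def integral_torus_pcont[OF pc[OF p]] integral_torus_pcont[OF pc[OF p']])
    fix \<phi> :: "real^'n \<Rightarrow> real" assume \<phi>: "test_function \<phi>"
    have "(\<integral>x. p x * laplacian \<phi> x \<partial>cube_measure) = (\<integral>x. p' x * laplacian \<phi> x \<partial>cube_measure)"
      using p p' \<phi> unfolding zero_average_solution_def dist_eq_def
      by (simp add: dist_laplacian_eq[OF pc[OF p]] dist_laplacian_eq[OF pc[OF p']] minus_equation_iff[of _ "dist_div_div_tensor u \<phi>"])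
        (metis neg_equal_iff_equal)
    then show "(\<integral>x. (p x - p' x) * laplacian \<phi> x \<partial>cube_measure) = 0"
      using i[OF p, of "laplacian \<phi>"] i[OF p', of "laplacian \<phi>"] test_function_pcont[OF test_function_laplacian[OF \<phi>]]
      by (simp add: left_diff_distrib)
  qed
  then show "p x = p' x" by simp
qed

subsection \<open>Pairing with the divergence\<close>

text \<open>The integral against \<open>g\<close> stays with \<open>torus_measure\<close>, since
  nothing makes \<open>g\<close> Borel measurable.\<close>

lemma has_divergence_pairing:
  fixes u :: "real^'n \<Rightarrow> real^'n"
  assumes u: "holder_bd \<theta> N u" "0 < \<theta>" and g: "has_divergence u g" and \<phi>: "test_function \<phi>"
  shows "(\<Sum>i\<in>UNIV. \<integral>x. u x $ i * partial i \<phi> x \<partial>cube_measure) = - (\<integral>x. g x * \<phi> x \<partial>torus_measure)"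
proof -
  have "pcont (\<lambda>x. u x $ i * partial i \<phi> x)" for i
    by (intro pcont_mult holder_bd_components_pcont[OF u] test_function_pcont test_function_partial \<phi>)
  then have "dist_div u \<phi> = (\<Sum>i\<in>UNIV. - (\<integral>x. u x $ i * partial i \<phi> x \<partial>cube_measure))"
    by (simp add: dist_div_def dist_partial_def dist_of_def integral_torus_pcont)
  moreover have "dist_div u \<phi> = (\<integral>x. g x * \<phi> x \<partial>torus_measure)"
    using g \<phi> by (simp add: has_divergence_def dist_eq_def dist_of_def)
  ultimately show ?thesis by (simp add: sum_negf)
qed

lemma pcont_div_conv:
  assumes u: "holder_bd \<theta> N u" "0 < \<theta>" and K: "kernel (Suc k) K"
  shows "pcont (div_conv K u s)"
  unfolding div_conv_def[abs_def] by (intro pcont_sum pcont_conv[OF kernel_partial[OF K]] holder_bd_components_pcont[OF u])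

text \<open>Duality puts the kernel on \<open>\<phi>\<close> and the derivative on a test function;
  what remains is the weak divergence tested with \<open>conv K (- s) \<phi>\<close>. The sign of
  the reflected scale cancels that of the pairing.\<close>

lemma div_conv_duality:
  fixes u :: "real^'n \<Rightarrow> real^'n"
  assumes u: "holder_bd \<theta> N u" "0 < \<theta>" and g: "has_divergence u g" and \<phi>: "test_function \<phi>"
    and K: "kernel (Suc 0) K" and s: "s \<noteq> 0"
  shows "(\<integral>x. div_conv K u s x * \<phi> x \<partial>cube_measure) = s * (\<integral>x. g x * conv K (- s) \<phi> x \<partial>torus_measure)"
proof -
  note pu = holder_bd_components_pcont(1)[OF u]
  have p\<phi>: "pcont \<phi>" by (rule test_function_pcont[OF \<phi>])
  have pp: "pcont (\<lambda>x. conv (partial i K) s (\<lambda>y. u y $ i) x * \<phi> x)" for i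
    by (intro pcont_mult pcont_conv[OF kernel_partial[OF K]] pu p\<phi>)
  have swap: "conv (partial i K) (- s) \<phi> x = - s * partial i (conv K (- s) \<phi>) x" for i x
    using conv_partial_swap[OF K test_functionD(1)[OF \<phi>] test_functionD(2)[OF \<phi>], of "- s" i x]
      partial_conv[OF K test_functionD(1)[OF \<phi>] test_functionD(2)[OF \<phi>], of i "- s" x] s by simp
  have "(\<integral>x. div_conv K u s x * \<phi> x \<partial>cube_measure) = (\<Sum>i\<in>UNIV. \<integral>x. conv (partial i K) s (\<lambda>y. u y $ i) x * \<phi> x \<partial>cube_measure)"
    unfolding div_conv_def sum_distrib_right
    by (subst Bochner_Integration.integral_sum, intro integrable_cube_pcont pp, rule refl)
  also have "\<dots> = (\<Sum>i\<in>UNIV. \<integral>x. - s * (u x $ i * partial i (conv K (- s) \<phi>) x) \<partial>cube_measure)"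
    by (simp only: conv_adjoint[OF kernel_partial[OF K] pu p\<phi>] swap mult.left_commute)
  also have "\<dots> = - s * (\<Sum>i\<in>UNIV. \<integral>x. u x $ i * partial i (conv K (- s) \<phi>) x \<partial>cube_measure)"
    by (simp only: integral_mult_right_zero sum_distrib_left)
  also have "\<dots> = s * (\<integral>x. g x * conv K (- s) \<phi> x \<partial>torus_measure)"
    by (simp add: has_divergence_pairing[OF u g test_function_conv[OF K \<phi>]])
  finally show ?thesis .
qed

section \<open>Lebesgue bounds for pairings with the divergence\<close>

lemma emeasure_torus: "emeasure (torus_measure :: (real^'n) measure) (space torus_measure) = 1"
proof -
  have Q: "cbox 0 (One :: real^'n) \<in> sets lebesgue" using fmeasurableD[OF lmeasurable_cbox] .
  have sp: "space (torus_measure :: (real^'n) measure) = cbox 0 One"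
    by (simp add: torus_measure_def space_restrict_space)
  have "emeasure (torus_measure :: (real^'n) measure) (cbox 0 One) = emeasure lebesgue (cbox 0 (One :: real^'n))"
    unfolding torus_measure_def by (rule emeasure_restrict_space) (use Q in simp_all)
  also have "\<dots> = emeasure lborel (cbox 0 (One :: real^'n))" by (subst emeasure_completion[OF Q]) (simp add: main_part_sets)
  also have "\<dots> = 1" by (subst emeasure_lborel_cbox_eq) (auto simp: One_inner prod.neutral)
  finally show ?thesis using sp by simp
qed

lemma finite_measure_torus: "finite_measure (torus_measure :: (real^'n) measure)"
  by (rule finite_measureI) (simp add: emeasure_torus)

lemma pcont_torus_measurable: "pcont f \<Longrightarrow> f \<in> borel_measurable torus_measure"
  unfolding torus_measure_def
  by (intro measurable_restrict_space1 measurable_completion) (simp add: pcont_measurable)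

lemma integrable_torus_pcont:
  assumes "pcont f" shows "integrable torus_measure f"
proof -
  obtain B where "\<And>x. \<bar>f x\<bar> \<le> B" using pcont_bounded[OF assms] by blast
  then show ?thesis
    by (intro finite_measure.integrable_const_bound[OF finite_measure_torus, where B = B] pcont_torus_measurable[OF assms]) auto
qed

text \<open>Splitting \<open>|g| \<le> c + c\<^sup>1\<^sup>-\<^sup>r |g|\<^sup>r\<close> and optimising \<open>c\<close> replaces Hoelder's inequality.\<close>

lemma le_add_powr:
  fixes t c r :: real
  assumes "t \<ge> 0" "c > 0" "r > 1"
  shows "t \<le> c + c powr (1 - r) * t powr r"
proof (cases "t \<le> c")
  case False
  then have t: "t > 0" using assms by simp
  have "t = t powr (1 - r) * t powr r" using t by (simp add: powr_add[symmetric])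
  also have "\<dots> \<le> c powr (1 - r) * t powr r"
    using assms False by (intro mult_right_mono powr_mono2') auto
  finally show ?thesis using assms by simp
qed (use assms in \<open>simp add: add_increasing2\<close>)

text \<open>Stands in for interpolation between the bound \<open>L\<close> on the integral and the
  bound \<open>A / s powr d\<close> on the supremum of \<open>\<psi>\<close>: a share
  \<open>1 / r\<close> of the singular power survives.\<close>

lemma Lq_pairing_finite:
  fixes g \<psi> :: "real^'n \<Rightarrow> real"
  assumes gm: "g \<in> borel_measurable torus_measure" and gi: "integrable torus_measure (\<lambda>x. \<bar>g x\<bar> powr r)" and r: "r > 1"
    and \<psi>: "pcont \<psi>" and L: "(\<integral>x. \<bar>\<psi> x\<bar> \<partial>cube_measure) \<le> L" and A: "\<And>x. \<bar>\<psi> x\<bar> \<le> A / s powr d" "A \<ge> 0" and s: "s > 0"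
  shows "\<bar>\<integral>x. g x * \<psi> x \<partial>torus_measure\<bar> \<le> (L + A) * (\<integral>x. \<bar>g x\<bar> powr r \<partial>torus_measure) powr (1 / r) * s powr (- (d / r))"
proof -
  define I where "I = (\<integral>x. \<bar>g x\<bar> powr r \<partial>torus_measure)"
  have I0: "I \<ge> 0" unfolding I_def by (intro integral_nonneg_AE) auto
  have "0 \<le> (\<integral>x. \<bar>\<psi> x\<bar> \<partial>cube_measure)" by (intro integral_nonneg_AE) auto
  then have L0: "L \<ge> 0" using L by (rule order_trans)
  have \<psi>i: "integrable torus_measure (\<lambda>x. \<bar>\<psi> x\<bar>)" by (intro integrable_torus_pcont pcont_abs \<psi>)
  have L': "(\<integral>x. \<bar>\<psi> x\<bar> \<partial>torus_measure) \<le> L" using L integral_torus_pcont[OF pcont_abs[OF \<psi>]] by simp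
  have key: "\<bar>\<integral>x. g x * \<psi> x \<partial>torus_measure\<bar> \<le> c * L + c powr (1 - r) * (A / s powr d) * I" if c: "c > 0" for c
  proof -
    define h where "h = (\<lambda>x. c * \<bar>\<psi> x\<bar> + (c powr (1 - r) * (A / s powr d)) * \<bar>g x\<bar> powr r)"
    have hi: "integrable torus_measure h" unfolding h_def by (intro Bochner_Integration.integrable_add integrable_mult_right \<psi>i gi)
    have le: "\<bar>g x * \<psi> x\<bar> \<le> h x" for x
    proof -
      have "\<bar>g x * \<psi> x\<bar> \<le> (c + c powr (1 - r) * \<bar>g x\<bar> powr r) * \<bar>\<psi> x\<bar>"
        unfolding abs_mult using c r by (intro mult_right_mono le_add_powr) auto
      also have "\<dots> = c * \<bar>\<psi> x\<bar> + c powr (1 - r) * \<bar>g x\<bar> powr r * \<bar>\<psi> x\<bar>" by (rule distrib_right)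
      also have "\<dots> \<le> c * \<bar>\<psi> x\<bar> + c powr (1 - r) * \<bar>g x\<bar> powr r * (A / s powr d)"
        by (intro add_left_mono mult_left_mono A) auto
      finally show ?thesis by (simp add: h_def algebra_simps)
    qed
    have m: "(\<lambda>x. g x * \<psi> x) \<in> borel_measurable torus_measure"
      by (intro borel_measurable_times gm pcont_torus_measurable \<psi>)
    have gi: "integrable torus_measure (\<lambda>x. g x * \<psi> x)"
    proof (rule Bochner_Integration.integrable_bound[OF hi m], rule AE_I2)
      fix x show "norm (g x * \<psi> x) \<le> norm (h x)" using le[of x] by simp
    qed
    have "\<bar>\<integral>x. g x * \<psi> x \<partial>torus_measure\<bar> \<le> (\<integral>x. \<bar>g x * \<psi> x\<bar> \<partial>torus_measure)" by (rule integral_abs_bound)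
    also have "\<dots> \<le> (\<integral>x. h x \<partial>torus_measure)"
      by (intro Bochner_Integration.integral_mono integrable_abs gi hi le)
    also have "\<dots> = c * (\<integral>x. \<bar>\<psi> x\<bar> \<partial>torus_measure) + c powr (1 - r) * (A / s powr d) * I"
      unfolding h_def I_def using \<psi>i assms(2) by simp
    also have "\<dots> \<le> c * L + c powr (1 - r) * (A / s powr d) * I" using L' c by (intro add_right_mono mult_left_mono) auto
    finally show ?thesis .
  qed
  show ?thesis
  proof (cases "I = 0")
    case True
    \<comment> \<open>With a vanishing norm there is no optimal \<open>c\<close>, so
      \<open>c\<close> tends to 0; the \<open>+ 1\<close> avoids a division by 0.\<close>
    have "\<bar>\<integral>x. g x * \<psi> x \<partial>torus_measure\<bar> \<le> 0 + e" if e: "e > 0" for e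
    proof -
      have "\<bar>\<integral>x. g x * \<psi> x \<partial>torus_measure\<bar> \<le> (e / (L + 1)) * L" using key[of "e / (L + 1)"] e L0 True by simp
      also have "\<dots> \<le> e" using e L0 by (simp add: field_simps)
      finally show ?thesis by simp
    qed
    then have "\<bar>\<integral>x. g x * \<psi> x \<partial>torus_measure\<bar> \<le> 0" by (rule field_le_epsilon)
    then show ?thesis using True by (simp add: I_def[symmetric])
  next
    case False
    then have I: "I > 0" using I0 by simp
    define G where "G = I powr (1 / r)"
    have G: "G > 0" using I by (simp add: G_def)
    have IG: "I = G powr r" using I r by (simp add: G_def powr_powr)
    \<comment> \<open>The balance point: both terms become multiples of
      \<open>G * s powr (- (d / r))\<close>, with factors \<open>L\<close> and
      \<open>A\<close>.\<close>
    define c where "c = G * s powr (- (d / r))"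
    have c: "c > 0" using G s by (simp add: c_def)
    have "c powr (1 - r) * I = G * s powr (d - d / r)"
    proof -
      have "c powr (1 - r) = G powr (1 - r) * s powr (- (d / r) * (1 - r))"
        using G s by (simp add: c_def powr_mult powr_powr)
      moreover have "- (d / r) * (1 - r) = d - d / r" using r by (simp add: field_simps)
      moreover have "G powr (1 - r) * G powr r = G" using G by (simp add: powr_add[symmetric])
      ultimately show ?thesis unfolding IG by (metis mult.commute mult.left_commute)
    qed
    then have "c powr (1 - r) * (A / s powr d) * I = A * G * (s powr (d - d / r) / s powr d)"
      by (simp add: algebra_simps)
    also have "s powr (d - d / r) / s powr d = s powr (- (d / r))"
      using s by (simp add: powr_diff[symmetric])
    finally have "\<bar>\<integral>x. g x * \<psi> x \<partial>torus_measure\<bar> \<le> c * L + A * G * s powr (- (d / r))" using key[OF c] by simp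
    then show ?thesis unfolding I_def[symmetric] G_def[symmetric] by (simp add: c_def algebra_simps)
  qed
qed

text \<open>Needed to pass from the extended to the real essential supremum. The constant 0 has
  essential supremum 0 because the torus has positive measure.\<close>

lemma esssup_abs_nonneg:
  fixes g :: "real^'n \<Rightarrow> real"
  shows "0 \<le> esssup torus_measure (\<lambda>x. ereal \<bar>g x\<bar>)"
proof -
  have "esssup (torus_measure :: (real^'n) measure) (\<lambda>x. 0 :: ereal) \<le> esssup torus_measure (\<lambda>x. ereal \<bar>g x\<bar>)"
  proof (rule esssup_mono)
    show "(\<lambda>x. 0 :: ereal) \<in> borel_measurable (torus_measure :: (real^'n) measure)" by (rule measurable_const) simp
    show "0 \<le> ereal \<bar>g x\<bar>" for x by simp
  qed
  moreover have "esssup (torus_measure :: (real^'n) measure) (\<lambda>x. 0 :: ereal) = 0"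
    by (rule esssup_const) (unfold emeasure_torus, simp)
  ultimately show ?thesis by (rule subst[rotated])
qed

lemma Lq_norm_nonneg:
  fixes g :: "real^'n \<Rightarrow> real"
  shows "Lq_norm q g \<ge> 0"
proof (cases "q = \<infinity>")
  case True
  then show ?thesis using real_of_ereal_pos[OF esssup_abs_nonneg[of g]] by (simp only: Lq_norm_def simp_thms if_True)
next
  case False
  then show ?thesis by (simp only: Lq_norm_def simp_thms if_False powr_ge_zero)
qed

lemma Lq_spaceD:
  "g \<in> Lq_space q \<Longrightarrow> g \<in> borel_measurable torus_measure"
  "g \<in> Lq_space \<infinity> \<Longrightarrow> esssup torus_measure (\<lambda>x. ereal \<bar>g x\<bar>) < \<infinity>"
  "g \<in> Lq_space (ereal r) \<Longrightarrow> integrable torus_measure (\<lambda>x. \<bar>g x\<bar> powr r)"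
  unfolding Lq_space_def mem_Collect_eq
  by (elim conjE, assumption, simp only: simp_thms if_True, simp only: PInfty_neq_ereal ereal.distinct if_False real_of_ereal.simps)

lemma Lq_norm_infinity: "Lq_norm \<infinity> g = real_of_ereal (esssup torus_measure (\<lambda>x. ereal \<bar>g x\<bar>))"
  by (simp only: Lq_norm_def simp_thms if_True)

lemma Lq_norm_finite: "Lq_norm (ereal r) g = (\<integral>x. \<bar>g x\<bar> powr r \<partial>torus_measure) powr (1 / r)"
  by (simp only: Lq_norm_def PInfty_neq_ereal ereal.distinct if_False real_of_ereal.simps)

text \<open>For \<open>s \<le> 1\<close> a larger exponent only improves the power of
  \<open>s\<close>, so one threshold \<open>q\<^sub>0\<close> covers every \<open>q\<close> above
  it, infinity included.\<close>

lemma Lq_pairing: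
  fixes g \<psi> :: "real^'n \<Rightarrow> real"
  assumes g: "g \<in> Lq_space q" and q: "ereal q\<^sub>0 \<le> q" "q\<^sub>0 > 1"
    and \<psi>: "pcont \<psi>" and L: "(\<integral>x. \<bar>\<psi> x\<bar> \<partial>cube_measure) \<le> L" and A: "\<And>x. \<bar>\<psi> x\<bar> \<le> A / s powr d" "A \<ge> 0" and s: "0 < s" "s \<le> 1" and d: "d \<ge> 0"
  shows "\<bar>\<integral>x. g x * \<psi> x \<partial>torus_measure\<bar> \<le> (L + A) * Lq_norm q g * s powr (- (d / q\<^sub>0))"
proof -
  have gm: "g \<in> borel_measurable torus_measure" by (rule Lq_spaceD(1)[OF g])
  have "0 \<le> (\<integral>x. \<bar>\<psi> x\<bar> \<partial>cube_measure)" by (intro integral_nonneg_AE) auto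
  then have L0: "L \<ge> 0" using L by (rule order_trans)
  have G0: "Lq_norm q g \<ge> 0" by (rule Lq_norm_nonneg)
  show ?thesis
  proof (cases "q = \<infinity>")
    case False
    then obtain r where qr: "q = ereal r" using q by (cases q) auto
    have r: "r \<ge> q\<^sub>0" using q qr by simp
    have gi: "integrable torus_measure (\<lambda>x. \<bar>g x\<bar> powr r)" using g unfolding qr by (rule Lq_spaceD(3))
    have "\<bar>\<integral>x. g x * \<psi> x \<partial>torus_measure\<bar> \<le> (L + A) * Lq_norm q g * s powr (- (d / r))"
      unfolding qr Lq_norm_finite
      by (rule Lq_pairing_finite[OF gm gi _ \<psi> L A s(1)]) (use r q(2) in linarith)
    also have "\<dots> \<le> (L + A) * Lq_norm q g * s powr (- (d / q\<^sub>0))"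
    proof (intro mult_left_mono powr_mono')
      have "d / r \<le> d / q\<^sub>0" using r q d by (intro divide_left_mono) auto
      then show "- (d / q\<^sub>0) \<le> - (d / r)" by simp
    qed (use L0 A G0 s in auto)
    finally show ?thesis .
  next
    case True
    define G where "G = Lq_norm q g"
    define e where "e = esssup torus_measure (\<lambda>x. ereal \<bar>g x\<bar>)"
    have "e < \<infinity>" unfolding e_def by (rule Lq_spaceD(2)[OF g[unfolded True]])
    moreover have "e \<ge> 0" unfolding e_def by (rule esssup_abs_nonneg)
    ultimately have eG: "e = ereal G" unfolding G_def True Lq_norm_infinity e_def[symmetric] by (cases e) auto
    have AE: "AE x in torus_measure. \<bar>g x\<bar> \<le> G"
      using esssup_AE[of "\<lambda>x. ereal \<bar>g x\<bar>" torus_measure] unfolding e_def[symmetric] eG by simp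
    have \<psi>i: "integrable torus_measure (\<lambda>x. \<bar>\<psi> x\<bar>)" by (intro integrable_torus_pcont pcont_abs \<psi>)
    have le: "AE x in torus_measure. \<bar>g x * \<psi> x\<bar> \<le> G * \<bar>\<psi> x\<bar>"
      using AE by eventually_elim (simp add: abs_mult mult_right_mono)
    have m: "(\<lambda>x. g x * \<psi> x) \<in> borel_measurable torus_measure"
      by (intro borel_measurable_times gm pcont_torus_measurable \<psi>)
    have G\<psi>i: "integrable torus_measure (\<lambda>x. G * \<bar>\<psi> x\<bar>)" by (rule integrable_mult_right[OF \<psi>i])
    have gi: "integrable torus_measure (\<lambda>x. g x * \<psi> x)"
    proof (rule Bochner_Integration.integrable_bound[OF G\<psi>i m])
      show "AE x in torus_measure. norm (g x * \<psi> x) \<le> norm (G * \<bar>\<psi> x\<bar>)"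
        using le by eventually_elim simp
    qed
    have "\<bar>\<integral>x. g x * \<psi> x \<partial>torus_measure\<bar> \<le> (\<integral>x. \<bar>g x * \<psi> x\<bar> \<partial>torus_measure)" by (rule integral_abs_bound)
    also have "\<dots> \<le> (\<integral>x. G * \<bar>\<psi> x\<bar> \<partial>torus_measure)"
      by (intro integral_mono_AE integrable_abs gi G\<psi>i le)
    also have "\<dots> = G * (\<integral>x. \<bar>\<psi> x\<bar> \<partial>cube_measure)" by (simp add: integral_torus_pcont[OF pcont_abs[OF \<psi>]])
    also have "\<dots> \<le> G * (L + A)" using L A G0 by (intro mult_left_mono) (auto simp: G_def)
    also have "\<dots> = (L + A) * G * 1" by simp
    also have "\<dots> \<le> (L + A) * G * s powr (- (d / q\<^sub>0))"
    proof (rule mult_left_mono)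
      have "s powr 0 \<le> s powr (- (d / q\<^sub>0))" using s d q by (intro powr_mono') auto
      then show "1 \<le> s powr (- (d / q\<^sub>0))" using s by simp
    qed (use L0 A G0 in \<open>auto simp: G_def\<close>)
    finally show ?thesis by (simp add: G_def)
  qed
qed

text \<open>It suffices to integrate against probability densities \<open>\<phi>\<close>. Then
  \<open>conv K (- s) \<phi>\<close> has bounded L1 norm and supremum at most
  \<open>B / s powr CARD('n)\<close>, the input of \<open>Lq_pairing\<close>; the additional factor
  \<open>s\<close> comes from \<open>div_conv_duality\<close>.\<close>

lemma div_conv_Lq:
  fixes K :: "real^'n \<Rightarrow> real"
  assumes K: "kernel (Suc 0) K"
  shows "\<exists>C\<ge>0. \<forall>\<theta> N u q q\<^sub>0 g s x. holder_bd \<theta> N u \<longrightarrow> 0 < \<theta> \<longrightarrow> has_divergence u g \<longrightarrow> g \<in> Lq_space q \<longrightarrow> ereal q\<^sub>0 \<le> q \<longrightarrow> q\<^sub>0 > 1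
    \<longrightarrow> 0 < s \<longrightarrow> s \<le> 1 \<longrightarrow> \<bar>div_conv K u s x\<bar> \<le> C * Lq_norm q g * s powr (1 - CARD('n) / q\<^sub>0)"
proof -
  obtain B where B: "B \<ge> 0" "\<And>z. \<bar>K z\<bar> \<le> B" using kernel_bounded[OF K] by blast
  define L where "L = (\<integral>z. \<bar>K z\<bar> \<partial>lborel)"
  have L0: "L \<ge> 0" unfolding L_def by (intro integral_nonneg_AE) auto
  show ?thesis
  proof (intro exI[of _ "L + B"] conjI allI impI)
    show "L + B \<ge> 0" using L0 B by simp
    fix \<theta> N q\<^sub>0 s :: real and u :: "real^'n \<Rightarrow> real^'n" and q :: ereal and g and x :: "real^'n"
    assume u: "holder_bd \<theta> N u" "0 < \<theta>" and g: "has_divergence u g" "g \<in> Lq_space q" and q: "ereal q\<^sub>0 \<le> q" "q\<^sub>0 > 1" and s: "0 < s" "s \<le> 1"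
    show "\<bar>div_conv K u s x\<bar> \<le> (L + B) * Lq_norm q g * s powr (1 - CARD('n) / q\<^sub>0)"
    proof (rule sup_bound_by_test_functions[OF pcont_div_conv[OF u K]])
      fix \<phi> :: "real^'n \<Rightarrow> real" assume \<phi>: "test_function \<phi>" "\<And>x. \<phi> x \<ge> 0" "(\<integral>x. \<phi> x \<partial>cube_measure) = 1"
      have p\<phi>: "pcont \<phi>" by (rule test_function_pcont[OF \<phi>(1)])
      have "\<bar>\<integral>x. g x * conv K (- s) \<phi> x \<partial>torus_measure\<bar> \<le> (L + B) * Lq_norm q g * s powr (- (CARD('n) / q\<^sub>0))"
      proof (rule Lq_pairing[OF g(2) q pcont_conv[OF K p\<phi>] _ _ B(1) s])
        show "(\<integral>x. \<bar>conv K (- s) \<phi> x\<bar> \<partial>cube_measure) \<le> L"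
          using conv_L1[OF K p\<phi>, of "- s"] \<phi>(2,3) by (simp add: L_def)
        show "\<bar>conv K (- s) \<phi> x\<bar> \<le> B / s powr CARD('n)" for x
          using conv_sup[OF K B(2) p\<phi> \<phi>(2), of "- s" x] s \<phi>(3) by (simp add: powr_realpow)
      qed simp
      then have "s * \<bar>\<integral>x. g x * conv K (- s) \<phi> x \<partial>torus_measure\<bar> \<le> s * ((L + B) * Lq_norm q g * s powr (- (CARD('n) / q\<^sub>0)))"
        using s by (intro mult_left_mono) auto
      also have "\<dots> = (L + B) * Lq_norm q g * (s powr 1 * s powr (- (CARD('n) / q\<^sub>0)))" using s by simp
      also have "s powr 1 * s powr (- (CARD('n) / q\<^sub>0)) = s powr (1 - CARD('n) / q\<^sub>0)" unfolding powr_add[symmetric] by simp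
      finally show "\<bar>\<integral>x. div_conv K u s x * \<phi> x \<partial>cube_measure\<bar> \<le> (L + B) * Lq_norm q g * s powr (1 - CARD('n) / q\<^sub>0)"
        using div_conv_duality[OF u g(1) \<phi>(1) K, of s] s by (simp add: abs_mult)
    qed
  qed
qed

text \<open>Testing shows that \<open>div_conv K u s\<close> and \<open>s * conv K s g\<close>, both
  continuous, agree at every point; the cancellation of \<open>K\<close> then gains
  \<open>s powr \<beta>\<close>.\<close>

lemma div_conv_Hoelder:
  fixes K :: "real^'n \<Rightarrow> real"
  assumes K: "kernel (Suc 0) K" "(\<integral>z. K z \<partial>lborel) = 0"
    and u: "holder_bd \<theta> N u" "0 < \<theta>" and g: "has_divergence u g" "holder_bd \<beta> \<Gamma> g" "0 < \<beta>" and s: "0 < s"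
  shows "\<bar>div_conv K u s x\<bar> \<le> (\<integral>z. \<bar>K z\<bar> \<partial>lborel) * \<Gamma> * s powr (1 + \<beta>)"
proof -
  have pg: "pcont g" by (rule holder_bd_pcont[OF g(2,3)])
  have pw: "pcont (\<lambda>x. div_conv K u s x - s * conv K s g x)"
    by (intro pcont_diff pcont_div_conv[OF u K(1)] pcont_mult[OF pcont_const] pcont_conv[OF K(1) pg])
  have "\<bar>div_conv K u s x - s * conv K s g x\<bar> \<le> 0"
  proof (rule sup_bound_by_test_functions[OF pw])
    fix \<phi> :: "real^'n \<Rightarrow> real" assume \<phi>: "test_function \<phi>"
    have p\<phi>: "pcont \<phi>" by (rule test_function_pcont[OF \<phi>])
    have p1: "pcont (\<lambda>x. div_conv K u s x * \<phi> x)" and p2: "pcont (\<lambda>x. conv K s g x * \<phi> x)" and p3: "pcont (\<lambda>x. g x * conv K (- s) \<phi> x)"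
      by (intro pcont_mult pcont_div_conv[OF u K(1)] pcont_conv[OF K(1)] pg p\<phi>)+
    have "(\<integral>x. (div_conv K u s x - s * conv K s g x) * \<phi> x \<partial>cube_measure)
      = (\<integral>x. div_conv K u s x * \<phi> x - s * (conv K s g x * \<phi> x) \<partial>cube_measure)"
      by (simp only: left_diff_distrib mult.assoc)
    also have "\<dots> = (\<integral>x. div_conv K u s x * \<phi> x \<partial>cube_measure) - s * (\<integral>x. conv K s g x * \<phi> x \<partial>cube_measure)"
      using integrable_cube_pcont[OF p1] integrable_cube_pcont[OF p2] by simp
    also have "\<dots> = 0"
      using div_conv_duality[OF u g(1) \<phi> K(1), of s] s conv_adjoint[OF K(1) pg p\<phi>, of s] integral_torus_pcont[OF p3] by simp
    finally show "\<bar>\<integral>x. (div_conv K u s x - s * conv K s g x) * \<phi> x \<partial>cube_measure\<bar> \<le> 0" by simp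
  qed
  then have "div_conv K u s x = s * conv K s g x" by simp
  also have "\<bar>\<dots>\<bar> \<le> s * (\<Gamma> * \<bar>s\<bar> powr \<beta> * (\<integral>z. \<bar>K z\<bar> \<partial>lborel))"
    unfolding abs_mult using s
    by (intro mult_mono conv_Hoelder[OF K pg]) (use holder_bdD(3,4)[OF g(2)] g(3) in auto)
  also have "\<dots> = (\<integral>z. \<bar>K z\<bar> \<partial>lborel) * \<Gamma> * (s powr 1 * s powr \<beta>)" using s by simp
  also have "s powr 1 * s powr \<beta> = s powr (1 + \<beta>)" by (rule powr_add[symmetric])
  finally show ?thesis .
qed

subsection \<open>Double regularity\<close>

text \<open>In \<open>R N u G\<close> the number \<open>N\<close> bounds the Hoelder norm of \<open>u\<close> and \<open>G\<close> measures its divergence. The two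
  parts of the theorem differ only in how the divergence yields the same gain \<open>s powr (2 * \<theta>)\<close>.\<close>

locale divergence_control =
  fixes R :: "real \<Rightarrow> (real^'n \<Rightarrow> real^'n) \<Rightarrow> real \<Rightarrow> bool" and \<theta> :: real
  assumes \<theta>: "0 < \<theta>" "\<theta> < 1"
    and bd: "\<And>N u G. R N u G \<Longrightarrow> holder_bd \<theta> N u" and G_nonneg: "\<And>N u G. R N u G \<Longrightarrow> G \<ge> 0"
    and div_bound: "\<And>K. kernel (Suc 0) K \<Longrightarrow> (\<integral>z. K z \<partial>lborel) = 0 \<Longrightarrow>
      \<exists>c\<ge>0. \<forall>N u G s x. R N u G \<longrightarrow> 0 < s \<longrightarrow> s \<le> 1 \<longrightarrow> \<bar>div_conv K u s x\<bar> \<le> c * G * s powr (2 * \<theta>)"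
begin

text \<open>Up to scale 1 the divergence enters through \<open>quad_double\<close>. Beyond 1 the
  claimed power of \<open>s\<close> is at least 1 and the decay of \<open>quad_large\<close>
  suffices.\<close>

lemma quad_bound:
  assumes K: "kernel (Suc (Suc (Suc 0))) \<Psi>"
  shows "\<exists>C\<ge>0. \<forall>N u G s x. R N u G \<longrightarrow> 0 < s \<longrightarrow> \<bar>quad \<Psi> u s x\<bar> \<le> C * (N\<^sup>2 + G\<^sup>2) * s powr (2 * \<theta>)"
proof -
  have K2: "kernel (Suc (Suc 0)) \<Psi>" and K1: "kernel (Suc 0) \<Psi>" by (auto intro: kernel_mono[OF K])
  have Kj: "kernel (Suc 0) (partial j \<Psi>)" for j by (rule kernel_partial[OF K2])
  have "\<exists>c\<ge>0. \<forall>N u G s x. R N u G \<longrightarrow> 0 < s \<longrightarrow> s \<le> 1 \<longrightarrow> \<bar>div_conv (partial j \<Psi>) u s x\<bar> \<le> c * G * s powr (2 * \<theta>)" for j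
    by (rule div_bound[OF Kj integral_partial_kernel[OF K1]])
  then obtain c where c: "\<And>j. c j \<ge> 0"
    "\<And>j N u G s x. R N u G \<Longrightarrow> 0 < s \<Longrightarrow> s \<le> 1 \<Longrightarrow> \<bar>div_conv (partial j \<Psi>) u s x\<bar> \<le> c j * G * s powr (2 * \<theta>)"
    by metis
  define e where "e = (\<Sum>j\<in>UNIV. c j)"
  have e0: "e \<ge> 0" unfolding e_def by (intro sum_nonneg c)
  have ce: "c j \<le> e" for j unfolding e_def by (rule member_le_sum) (auto simp: c)
  obtain C1 where C1: "C1 \<ge> 0" "\<And>\<theta> N u s x E. holder_bd \<theta> N u \<Longrightarrow> \<theta> > 0 \<Longrightarrow> s > 0 \<Longrightarrow> (\<And>j. \<bar>div_conv (partial j \<Psi>) u s x\<bar> \<le> E)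
    \<Longrightarrow> \<bar>quad \<Psi> u s x\<bar> \<le> C1 * (N\<^sup>2 * s powr (2 * \<theta>) + N * E)"
    using quad_double[OF K2] by metis
  obtain C2 where C2: "C2 \<ge> 0" "\<And>\<theta> N u s x. holder_bd \<theta> N u \<Longrightarrow> \<theta> > 0 \<Longrightarrow> s > 0 \<Longrightarrow> \<bar>quad \<Psi> u s x\<bar> \<le> C2 * N\<^sup>2 / s"
    using quad_large[OF K] by metis
  show ?thesis
  proof (intro exI[of _ "C1 * (1 + e) + C2"] conjI allI impI)
    show "C1 * (1 + e) + C2 \<ge> 0" using C1(1) C2(1) e0 by simp
    fix N G s :: real and u :: "real^'n \<Rightarrow> real^'n" and x :: "real^'n" assume R: "R N u G" and s: "0 < s"
    note hb = bd[OF R]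
    have N: "N \<ge> 0" by (rule holder_bdD(4)[OF hb])
    have G: "G \<ge> 0" by (rule G_nonneg[OF R])
    define W where "W = N\<^sup>2 + G\<^sup>2"
    have W: "N\<^sup>2 \<le> W" "N * G \<le> W" "W \<ge> 0"
    proof -
      \<comment> \<open>The cross term \<open>N * G\<close> from \<open>quad_double\<close> is
        absorbed into the sum of squares that the theorem has on its right-hand side.\<close>
      have "2 * (N * G) \<le> W" using sum_squares_bound[of N G] by (simp add: W_def mult.assoc)
      moreover have "0 \<le> N * G" using N G by simp
      ultimately show "N * G \<le> W" by linarith
    qed (simp_all add: W_def)
    define S where "S = s powr (2 * \<theta>)"
    have S: "S \<ge> 0" by (simp add: S_def)
    have "\<bar>quad \<Psi> u s x\<bar> \<le> C1 * (1 + e) * W * S + C2 * W * S"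
    proof (cases "s \<le> 1")
      case True
      have "\<bar>div_conv (partial j \<Psi>) u s x\<bar> \<le> e * G * S" for j
        using order_trans[OF c(2)[OF R s True, of j x] mult_right_mono[OF mult_right_mono[OF ce[of j] G] powr_ge_zero]]
        by (simp only: S_def)
      from C1(2)[OF hb \<theta>(1) s this] have "\<bar>quad \<Psi> u s x\<bar> \<le> C1 * (N\<^sup>2 * S + N * (e * G * S))"
        by (simp only: S_def)
      also have "\<dots> = C1 * ((N\<^sup>2 + e * (N * G)) * S)" by (simp add: algebra_simps)
      also have "\<dots> \<le> C1 * ((W + e * W) * S)"
        using W e0 S C1(1) by (intro mult_left_mono mult_right_mono add_mono) auto
      also have "\<dots> = C1 * (1 + e) * W * S" by (simp add: algebra_simps)
      finally show ?thesis using C2(1) W S by (smt (verit) mult_nonneg_nonneg)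
    next
      case False
      have S1: "1 \<le> S" unfolding S_def using False \<theta>(1) by (intro ge_one_powr_ge_zero) auto
      have "\<bar>quad \<Psi> u s x\<bar> \<le> C2 * N\<^sup>2 / s" by (rule C2(2)[OF hb \<theta>(1) s])
      also have "\<dots> \<le> C2 * N\<^sup>2" using divide_left_mono[of 1 s "C2 * N\<^sup>2"] False C2(1) by simp
      also have "\<dots> \<le> C2 * W" using W C2(1) by (intro mult_left_mono)
      also have "\<dots> \<le> C2 * W * S" using mult_left_mono[OF S1, of "C2 * W"] C2(1) W by simp
      finally show ?thesis using C1(1) e0 W S by (smt (verit) mult_nonneg_nonneg)
    qed
    then show "\<bar>quad \<Psi> u s x\<bar> \<le> (C1 * (1 + e) + C2) * (N\<^sup>2 + G\<^sup>2) * s powr (2 * \<theta>)"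
      unfolding W_def S_def by (simp add: distrib_right)
  qed
qed

text \<open>Applied to \<open>\<Phi>\<^sub>0\<close> for \<open>\<theta>\<close> below 1/2 and to
  \<open>partial k \<Phi>\<^sub>0\<close> above. The Lipschitz part uses \<open>quad_bound\<close>
  for \<open>partial k \<Psi>\<close>, hence one more derivative of the kernel.\<close>

lemma quad_bounds_all:
  assumes K: "kernel (Suc (Suc (Suc (Suc 0)))) \<Psi>"
  shows "\<exists>C\<ge>0. \<forall>N u G s x. R N u G \<longrightarrow> 0 < s \<longrightarrow>
    \<bar>quad \<Psi> u s x\<bar> \<le> C * (N\<^sup>2 + G\<^sup>2) * s powr (2 * \<theta>) \<and>
    \<bar>quad \<Psi> u s x / s\<bar> \<le> C * (N\<^sup>2 + G\<^sup>2) * s powr (- 2) \<and>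
    (\<forall>y. \<bar>quad \<Psi> u s x / s - quad \<Psi> u s y / s\<bar> \<le> C * (N\<^sup>2 + G\<^sup>2) * s powr (2 * \<theta> - 2) * norm (x - y))"
proof -
  have K3: "kernel (Suc (Suc (Suc 0))) \<Psi>" by (rule kernel_mono[OF K]) simp
  obtain C1 where C1: "C1 \<ge> 0" "\<And>N u G s x. R N u G \<Longrightarrow> 0 < s \<Longrightarrow> \<bar>quad \<Psi> u s x\<bar> \<le> C1 * (N\<^sup>2 + G\<^sup>2) * s powr (2 * \<theta>)"
    using quad_bound[OF K3] by metis
  obtain C2 where C2: "C2 \<ge> 0" "\<And>\<theta> N u s x. holder_bd \<theta> N u \<Longrightarrow> \<theta> > 0 \<Longrightarrow> s > 0 \<Longrightarrow> \<bar>quad \<Psi> u s x / s\<bar> \<le> C2 * N\<^sup>2 * s powr (- 2)"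
    using quad_scale_bounds[OF K] by metis
  have "\<exists>C\<ge>0. \<forall>N u G s x. R N u G \<longrightarrow> 0 < s \<longrightarrow> \<bar>quad (partial k \<Psi>) u s x\<bar> \<le> C * (N\<^sup>2 + G\<^sup>2) * s powr (2 * \<theta>)" for k
    by (rule quad_bound[OF kernel_partial[OF K]])
  then obtain C3 where C3: "\<And>k. C3 k \<ge> 0" "\<And>k N u G s x. R N u G \<Longrightarrow> 0 < s \<Longrightarrow> \<bar>quad (partial k \<Psi>) u s x\<bar> \<le> C3 k * (N\<^sup>2 + G\<^sup>2) * s powr (2 * \<theta>)"
    by metis
  define D where "D = (\<Sum>k\<in>UNIV. C3 k)"
  have D0: "D \<ge> 0" unfolding D_def by (intro sum_nonneg C3)
  have D: "C3 k \<le> D" for k unfolding D_def by (rule member_le_sum) (auto simp: C3)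
  define C where "C = C1 + C2 + CARD('n) * D"
  have le: "C1 \<le> C" "C2 \<le> C" "CARD('n) * D \<le> C" using C1(1) C2(1) D0 by (auto simp: C_def)
  show ?thesis
  proof (intro exI[of _ C] conjI allI impI)
    show "C \<ge> 0" using C1(1) C2(1) D0 by (simp add: C_def)
    fix N G s :: real and u :: "real^'n \<Rightarrow> real^'n" and x y :: "real^'n" assume R: "R N u G" and s: "0 < s"
    define W where "W = N\<^sup>2 + G\<^sup>2"
    have W: "N\<^sup>2 \<le> W" "W \<ge> 0" by (auto simp: W_def)
    have mono: "c * W * r \<le> C * W * r" if "c \<le> C" "r \<ge> 0" for c r
      using that W by (intro mult_right_mono) auto
    show "\<bar>quad \<Psi> u s x\<bar> \<le> C * (N\<^sup>2 + G\<^sup>2) * s powr (2 * \<theta>)"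
      using order_trans[OF C1(2)[OF R s] mono[OF le(1) powr_ge_zero, unfolded W_def]] .
    have "\<bar>quad \<Psi> u s x / s\<bar> \<le> C2 * N\<^sup>2 * s powr (- 2)" by (rule C2(2)[OF bd[OF R] \<theta>(1) s])
    also have "\<dots> \<le> C2 * W * s powr (- 2)" using W C2(1) by (intro mult_right_mono mult_left_mono) auto
    also have "\<dots> \<le> C * W * s powr (- 2)" by (rule mono[OF le(2) powr_ge_zero])
    finally show "\<bar>quad \<Psi> u s x / s\<bar> \<le> C * (N\<^sup>2 + G\<^sup>2) * s powr (- 2)" by (simp only: W_def)
    have "\<bar>quad (partial k \<Psi>) u s z\<bar> \<le> D * W * s powr (2 * \<theta>)" for k z
      unfolding W_def
      by (rule order_trans[OF C3(2)[OF R s] mult_right_mono[OF mult_right_mono[OF D W(2)[unfolded W_def]] powr_ge_zero]])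
    from quad_Lipschitz[OF bd[OF R] \<theta>(1) K3 s this, of x y]
    have "\<bar>quad \<Psi> u s x / s - quad \<Psi> u s y / s\<bar> \<le> CARD('n) * (D * W * s powr (2 * \<theta>)) * s powr (- 2) * norm (x - y)" .
    also have "\<dots> = CARD('n) * D * W * (s powr (2 * \<theta>) * s powr (- 2)) * norm (x - y)" by (simp only: mult.assoc)
    also have "s powr (2 * \<theta>) * s powr (- 2) = s powr (2 * \<theta> - 2)" by (simp add: powr_add[symmetric])
    also have "CARD('n) * D * W * s powr (2 * \<theta> - 2) * norm (x - y) \<le> C * W * s powr (2 * \<theta> - 2) * norm (x - y)"
      by (intro mult_right_mono mono[OF le(3) powr_ge_zero]) simp
    finally show "\<bar>quad \<Psi> u s x / s - quad \<Psi> u s y / s\<bar> \<le> C * (N\<^sup>2 + G\<^sup>2) * s powr (2 * \<theta> - 2) * norm (x - y)"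
      by (simp only: W_def)
  qed
qed

text \<open>As \<open>2 * \<theta> < 1\<close>, the doubled exponent is itself admissible in the
  scale integral.\<close>

lemma pressure_double_low:
  assumes low: "2 * \<theta> < 1"
  shows "\<exists>C\<ge>0. \<forall>N u G. R N u G \<longrightarrow> holder_bd (2 * \<theta>) (C * (N\<^sup>2 + G\<^sup>2)) (pressure u)"
proof -
  have K: "kernel (Suc (Suc (Suc (Suc 0)))) (\<Phi>\<^sub>0 :: real^'n \<Rightarrow> real)" by (rule kernel_Phi0_k) simp
  define M where "M = bump_mass TYPE('n)"
  have M: "M > 0" unfolding M_def by (rule bump_mass_pos)
  obtain C where C0: "C \<ge> 0" "\<forall>N u G s x. R N u G \<longrightarrow> 0 < s \<longrightarrow>
    \<bar>quad (\<Phi>\<^sub>0 :: real^'n \<Rightarrow> real) u s x\<bar> \<le> C * (N\<^sup>2 + G\<^sup>2) * s powr (2 * \<theta>) \<and>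
    \<bar>quad (\<Phi>\<^sub>0 :: real^'n \<Rightarrow> real) u s x / s\<bar> \<le> C * (N\<^sup>2 + G\<^sup>2) * s powr (- 2) \<and>
    (\<forall>y. \<bar>quad (\<Phi>\<^sub>0 :: real^'n \<Rightarrow> real) u s x / s - quad \<Phi>\<^sub>0 u s y / s\<bar> \<le> C * (N\<^sup>2 + G\<^sup>2) * s powr (2 * \<theta> - 2) * norm (x - y))"
    using quad_bounds_all[OF K] by blast
  have \<alpha>: "0 < 2 * \<theta>" using \<theta>(1) by simp
  show ?thesis
  proof (intro exI[of _ "(1 / M) * (C * scale_const (2 * \<theta>))"] conjI allI impI)
    show "(1 / M) * (C * scale_const (2 * \<theta>)) \<ge> 0" using C0(1) M scale_const_nonneg[OF \<alpha> low] by simp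
    fix N u G assume R: "R N u G"
    note hb = bd[OF R]
    define W where "W = N\<^sup>2 + G\<^sup>2"
    have W: "W \<ge> 0" by (simp add: W_def)
    define B where "B = C * W"
    have B0: "B \<ge> 0" using C0(1) W by (simp add: B_def)
    have meas: "(\<lambda>s. quad \<Phi>\<^sub>0 u s x / s) \<in> borel_measurable borel" for x
      using measurable_quad[OF hb \<theta>(1) K, of x] by measurable
    have small: "\<bar>quad \<Phi>\<^sub>0 u s x / s\<bar> \<le> B * s powr (2 * \<theta> - 1)" if s: "0 < s" for s x
    proof -
      have "\<bar>quad \<Phi>\<^sub>0 u s x\<bar> \<le> B * s powr (2 * \<theta>)" using C0(2) R s unfolding B_def W_def by blast
      from divide_right_mono[OF this, of s] s have "\<bar>quad \<Phi>\<^sub>0 u s x / s\<bar> \<le> B * s powr (2 * \<theta>) / s" by simp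
      also have "\<dots> = B * s powr (2 * \<theta> - 1)" by (simp only: times_divide_eq_right[symmetric] powr_div_self[OF s])
      finally show ?thesis .
    qed
    have large: "\<bar>quad \<Phi>\<^sub>0 u s x / s\<bar> \<le> B * s powr (- 2)" if "1 < s" for s x
    proof -
      have s: "0 < s" using that by simp
      show ?thesis using C0(2) R s unfolding B_def W_def by blast
    qed
    have lip: "\<bar>quad \<Phi>\<^sub>0 u s x / s - quad \<Phi>\<^sub>0 u s y / s\<bar> \<le> B * s powr (2 * \<theta> - 2) * norm (x - y)" if s: "0 < s" for s x y
      using C0(2) R s unfolding B_def W_def by blast
    have "holder_bd (2 * \<theta>) ((1 / M) * (B * scale_const (2 * \<theta>))) (\<lambda>x. (1 / M) * (LBINT s:{0<..}. quad \<Phi>\<^sub>0 u s x / s))"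
      by (rule holder_bd_cmult[OF holder_bd_scale_integral[OF meas periodic_quad_div[OF hb \<theta>(1) K] \<alpha> low B0 small large lip]])
        (use M in simp_all)
    then show "holder_bd (2 * \<theta>) ((1 / M) * (C * scale_const (2 * \<theta>)) * (N\<^sup>2 + G\<^sup>2)) (pressure u)"
      unfolding pressure_def[abs_def] M_def[symmetric] B_def W_def by (simp add: mult_ac)
  qed
qed

text \<open>As \<open>2 * \<theta> > 1\<close>, the small-scale bound leaves room for one
  derivative: the gradient of the integrand is of order \<open>s powr (2 * \<theta> - 2)\<close>,
  that is \<open>s powr (\<beta> - 1)\<close> with \<open>\<beta> = 2 * \<theta> - 1\<close> between
  0 and 1, so the scale integrals apply to it.\<close>

lemma pressure_double_high:
  assumes high: "1 < 2 * \<theta>"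
  shows "\<exists>C\<ge>0. \<forall>N u G. R N u G \<longrightarrow> (\<forall>x. \<bar>pressure u x\<bar> \<le> C * (N\<^sup>2 + G\<^sup>2)) \<and> pressure u differentiable_on UNIV \<and>
    (\<forall>k. holder_bd (2 * \<theta> - 1) (C * (N\<^sup>2 + G\<^sup>2)) (partial k (pressure u)))"
proof -
  have K: "kernel (Suc (Suc (Suc (Suc 0)))) (\<Phi>\<^sub>0 :: real^'n \<Rightarrow> real)" by (rule kernel_Phi0_k) simp
  have K3: "kernel (Suc (Suc (Suc 0))) (\<Phi>\<^sub>0 :: real^'n \<Rightarrow> real)" by (rule kernel_Phi0_k) simp
  have Kk: "kernel (Suc (Suc (Suc (Suc 0)))) (partial k (\<Phi>\<^sub>0 :: real^'n \<Rightarrow> real))" for k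
    by (rule kernel_partial, rule kernel_Phi0_k) simp
  define M where "M = bump_mass TYPE('n)"
  have M: "M > 0" unfolding M_def by (rule bump_mass_pos)
  define \<beta> where "\<beta> = 2 * \<theta> - 1"
  have \<beta>: "0 < \<beta>" "\<beta> < 1" using high \<theta>(2) by (auto simp: \<beta>_def)
  \<comment> \<open>The supremum of the pressure itself is taken from the plain Hoelder
    estimate.\<close>
  obtain C1 where C1: "C1 \<ge> 0" "\<And>N (u :: real^'n \<Rightarrow> real^'n). holder_bd \<theta> N u \<Longrightarrow> holder_bd \<theta> (C1 * N\<^sup>2) (pressure u)"
    using pressure_holder_bd[OF \<theta>] by metis
  obtain C2 where C2: "C2 \<ge> 0" "\<forall>\<theta> N u s x. holder_bd \<theta> N u \<longrightarrow> \<theta> > 0 \<longrightarrow> s > 0 \<longrightarrow>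
    \<bar>quad (\<Phi>\<^sub>0 :: real^'n \<Rightarrow> real) u s x / s\<bar> \<le> C2 * N\<^sup>2 * s powr (\<theta> - 1) \<and> \<bar>quad (\<Phi>\<^sub>0 :: real^'n \<Rightarrow> real) u s x / s\<bar> \<le> C2 * N\<^sup>2 * s powr (- 2)"
    using quad_scale_bounds[OF K] by blast
  have "\<exists>C\<ge>0. \<forall>N u G s x. R N u G \<longrightarrow> 0 < s \<longrightarrow>
    \<bar>quad (partial k (\<Phi>\<^sub>0 :: real^'n \<Rightarrow> real)) u s x\<bar> \<le> C * (N\<^sup>2 + G\<^sup>2) * s powr (2 * \<theta>) \<and>
    \<bar>quad (partial k (\<Phi>\<^sub>0 :: real^'n \<Rightarrow> real)) u s x / s\<bar> \<le> C * (N\<^sup>2 + G\<^sup>2) * s powr (- 2) \<and>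
    (\<forall>y. \<bar>quad (partial k (\<Phi>\<^sub>0 :: real^'n \<Rightarrow> real)) u s x / s - quad (partial k \<Phi>\<^sub>0) u s y / s\<bar> \<le> C * (N\<^sup>2 + G\<^sup>2) * s powr (2 * \<theta> - 2) * norm (x - y))" for k
    by (rule quad_bounds_all[OF Kk])
  then obtain C3 where C3: "\<And>k. C3 k \<ge> 0"
    "\<And>k N u G s x. R N u G \<Longrightarrow> 0 < s \<Longrightarrow> \<bar>quad (partial k (\<Phi>\<^sub>0 :: real^'n \<Rightarrow> real)) u s x\<bar> \<le> C3 k * (N\<^sup>2 + G\<^sup>2) * s powr (2 * \<theta>)"
    "\<And>k N u G s x. R N u G \<Longrightarrow> 0 < s \<Longrightarrow> \<bar>quad (partial k (\<Phi>\<^sub>0 :: real^'n \<Rightarrow> real)) u s x / s\<bar> \<le> C3 k * (N\<^sup>2 + G\<^sup>2) * s powr (- 2)"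
    "\<And>k N u G s x y. R N u G \<Longrightarrow> 0 < s \<Longrightarrow> \<bar>quad (partial k (\<Phi>\<^sub>0 :: real^'n \<Rightarrow> real)) u s x / s - quad (partial k \<Phi>\<^sub>0) u s y / s\<bar> \<le> C3 k * (N\<^sup>2 + G\<^sup>2) * s powr (2 * \<theta> - 2) * norm (x - y)"
    by metis
  define D where "D = (\<Sum>k\<in>UNIV. C3 k)"
  have D0: "D \<ge> 0" unfolding D_def by (intro sum_nonneg C3)
  have D: "C3 k \<le> D" for k unfolding D_def by (rule member_le_sum) (auto simp: C3)
  define E where "E = (1 / M) * (D * scale_const \<beta>)"
  have E0: "E \<ge> 0" using D0 M scale_const_nonneg[OF \<beta>] by (simp add: E_def)
  show ?thesis
  proof (intro exI[of _ "C1 + E"] conjI)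
    show "C1 + E \<ge> 0" using C1(1) E0 by simp
    show "\<forall>N u G. R N u G \<longrightarrow> (\<forall>x. \<bar>pressure u x\<bar> \<le> (C1 + E) * (N\<^sup>2 + G\<^sup>2)) \<and> pressure u differentiable_on UNIV \<and>
      (\<forall>k. holder_bd (2 * \<theta> - 1) ((C1 + E) * (N\<^sup>2 + G\<^sup>2)) (partial k (pressure u)))"
    proof (intro allI impI)
      fix N u G assume R: "R N u G"
      note hb = bd[OF R]
      define W where "W = N\<^sup>2 + G\<^sup>2"
      have W: "N\<^sup>2 \<le> W" "W \<ge> 0" by (auto simp: W_def)
      define C where "C = C1 + E"
      have mono: "c * W \<le> C * W" if "c = C1 \<or> c = E" for c
        using that C1(1) E0 W(2) unfolding C_def by (intro mult_right_mono) auto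
      have p_sup: "\<bar>pressure u x\<bar> \<le> C * W" for x
      proof -
        have "\<bar>pressure u x\<bar> \<le> C1 * N\<^sup>2" using holder_bdD(2)[OF C1(2)[OF hb], of x] by simp
        also have "\<dots> \<le> C1 * W" using W C1(1) by (intro mult_left_mono)
        also have "\<dots> \<le> C * W" by (rule mono) simp
        finally show ?thesis .
      qed
      define B where "B = D * W"
      have B0: "B \<ge> 0" using D0 W by (simp add: B_def)
      have C3B: "C3 k * (N\<^sup>2 + G\<^sup>2) * r \<le> B * r" if "r \<ge> 0" for k r
        unfolding B_def W_def[symmetric] using that D W(2) by (intro mult_right_mono) auto
      \<comment> \<open>Written as a multiple by \<open>1 / s\<close> so that
        \<open>partial_cmult\<close> applies; in \<open>g\<close> the second division by
        \<open>s\<close> stems from \<open>partial_quad\<close>.\<close>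
      define q where "q = (\<lambda>s x. (1 / s) * quad \<Phi>\<^sub>0 u s x)"
      define g where "g = (\<lambda>k s x. (1 / s) * (quad (partial k \<Phi>\<^sub>0) u s x / s))"
      have q_eq: "q s x = quad \<Phi>\<^sub>0 u s x / s" for s x by (simp add: q_def)
      have measq: "(\<lambda>s. q s x) \<in> borel_measurable borel" for x
        unfolding q_def using measurable_quad[OF hb \<theta>(1) K, of x] by measurable
      have meas: "(\<lambda>s. g k s x) \<in> borel_measurable borel" for k x
        unfolding g_def using measurable_quad[OF hb \<theta>(1) Kk, of k x] by measurable
      have intq: "set_integrable lborel {0<..} (\<lambda>s. q s x)" for x
      proof (rule scale_integral_bound(1)[OF measq \<theta>(1), where e = "- 2" and r = 1 and A = "C2 * N\<^sup>2" and D = "C2 * N\<^sup>2"])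
        fix s :: real
        show "\<bar>q s x\<bar> \<le> C2 * N\<^sup>2 * s powr (\<theta> - 1)" if "0 < s" "s \<le> 1"
          unfolding q_eq using C2(2) hb \<theta>(1) that(1) by blast
        show "\<bar>q s x\<bar> \<le> C2 * N\<^sup>2 * s powr (- 2)" if "1 < s"
        proof -
          have "0 < s" using that by simp
          then show ?thesis unfolding q_eq using C2(2) hb \<theta>(1) by blast
        qed
      qed (use C2(1) in auto)
      have q_C1: "C_k (Suc 0) (q s)" if "s > 0" for s
        unfolding q_def using that by (intro C_k_cmult C_k_quad[OF hb \<theta>(1) K3]) simp
      have q_partial: "partial k (q s) x = g k s x" if s: "s > 0" for s k x
      proof -
        have s0: "s \<noteq> 0" using s by simp
        show ?thesis unfolding q_def g_def
          by (subst partial_cmult[OF C_k_quad[OF hb \<theta>(1) K3 s0]]) (simp only: partial_quad[OF hb \<theta>(1) K3 s0])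
      qed
      have inv_s: "\<bar>(1 / s) * t\<bar> = \<bar>t\<bar> / s" if "s > 0" for s t :: real using that by (simp add: abs_mult)
      have small: "\<bar>g k s x\<bar> \<le> B * s powr (\<beta> - 1)" if s: "0 < s" for k s x
      proof -
        have "\<bar>quad (partial k \<Phi>\<^sub>0) u s x\<bar> \<le> B * s powr (2 * \<theta>)"
          by (rule order_trans[OF C3(2)[OF R s] C3B[OF powr_ge_zero]])
        then have "\<bar>quad (partial k \<Phi>\<^sub>0) u s x\<bar> / s / s \<le> B * s powr (2 * \<theta>) / s / s"
          using s by (intro divide_right_mono) auto
        also have "\<dots> = B * (s powr (2 * \<theta>) * s powr (- 2))" unfolding div_div_powr[OF s] by (rule mult.assoc)
        also have "s powr (2 * \<theta>) * s powr (- 2) = s powr (\<beta> - 1)" by (simp add: powr_add[symmetric] \<beta>_def)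
        finally show ?thesis unfolding g_def inv_s[OF s] using s by simp
      qed
      have large: "\<bar>g k s x\<bar> \<le> B * s powr (- 2)" if s1: "1 < s" for k s x
      proof -
        have s: "0 < s" using s1 by simp
        have "\<bar>quad (partial k \<Phi>\<^sub>0) u s x / s\<bar> \<le> B * s powr (- 2)"
          by (rule order_trans[OF C3(3)[OF R s] C3B[OF powr_ge_zero]])
        moreover have "\<bar>quad (partial k \<Phi>\<^sub>0) u s x / s\<bar> / s \<le> \<bar>quad (partial k \<Phi>\<^sub>0) u s x / s\<bar> / 1"
          using s1 by (intro divide_left_mono) auto
        ultimately show ?thesis unfolding g_def inv_s[OF s] by simp
      qed
      have lip: "\<bar>g k s x - g k s y\<bar> \<le> B * s powr (\<beta> - 2) * norm (x - y)" if s: "0 < s" for k s x y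
      proof -
        have "g k s x - g k s y = (1 / s) * (quad (partial k \<Phi>\<^sub>0) u s x / s - quad (partial k \<Phi>\<^sub>0) u s y / s)"
          unfolding g_def by (rule right_diff_distrib[symmetric])
        then have "\<bar>g k s x - g k s y\<bar> = \<bar>quad (partial k \<Phi>\<^sub>0) u s x / s - quad (partial k \<Phi>\<^sub>0) u s y / s\<bar> / s"
          by (simp only: inv_s[OF s])
        also have "\<dots> \<le> (C3 k * (N\<^sup>2 + G\<^sup>2) * s powr (2 * \<theta> - 2) * norm (x - y)) / s"
          using s by (intro divide_right_mono C3(4)[OF R s]) auto
        also have "\<dots> \<le> (B * s powr (2 * \<theta> - 2) * norm (x - y)) / s"
          using s by (intro divide_right_mono mult_right_mono[OF C3B[OF powr_ge_zero]]) auto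
        also have "\<dots> = B * (s powr (2 * \<theta> - 2) / s) * norm (x - y)" by simp
        also have "s powr (2 * \<theta> - 2) / s = s powr (\<beta> - 2)" unfolding powr_div_self[OF s] by (simp add: \<beta>_def)
        finally show ?thesis .
      qed
      note Der = scale_integral_differentiable[OF intq measq q_C1 q_partial meas \<beta> B0 small large lip]
      define P where "P = (\<lambda>k x. (1 / M) * (LBINT s:{0<..}. g k s x))"
      have pr_eq: "pressure u = (\<lambda>x. (1 / M) * (LBINT s:{0<..}. q s x))"
        by (rule ext) (simp only: pressure_def M_def q_eq)
      have D': "(pressure u has_derivative (\<lambda>h. \<Sum>i\<in>UNIV. h $ i * P i x)) (at x)" for x
      proof -
        have "(pressure u has_derivative (\<lambda>h. (1 / M) * (\<Sum>i\<in>UNIV. h $ i * (LBINT s:{0<..}. g i s x)))) (at x)"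
          unfolding pr_eq by (rule has_derivative_mult_right[OF Der])
        then show ?thesis by (simp add: P_def sum_distrib_left mult.left_commute)
      qed
      have part: "partial k (pressure u) = P k" for k
        by (rule ext, subst partial_eq[OF D'], rule sum_axis)
      have "holder_bd \<beta> (C * W) (P k)" for k
      proof -
        have "periodic (g k s)" for s
          unfolding g_def using periodicD[OF periodic_quad_div[OF hb \<theta>(1) Kk]] by (intro periodicI) simp
        from holder_bd_scale_integral[OF meas this \<beta> B0 small large lip]
        have "holder_bd \<beta> (B * scale_const \<beta>) (\<lambda>x. LBINT s:{0<..}. g k s x)" .
        from holder_bd_cmult[OF this, of "1 / M"]
        have "holder_bd \<beta> (E * W) (P k)" using M by (simp add: P_def[abs_def] E_def B_def mult_ac)
        then show ?thesis by (rule holder_bd_mono[OF _ mono]) simp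
      qed
      moreover have "pressure u differentiable_on UNIV"
        using D' by (auto simp: differentiable_on_def differentiable_def)
      ultimately show "(\<forall>x. \<bar>pressure u x\<bar> \<le> (C1 + E) * (N\<^sup>2 + G\<^sup>2)) \<and> pressure u differentiable_on UNIV \<and>
        (\<forall>k. holder_bd (2 * \<theta> - 1) ((C1 + E) * (N\<^sup>2 + G\<^sup>2)) (partial k (pressure u)))"
        using p_sup unfolding part C_def[symmetric] W_def[symmetric] \<beta>_def[symmetric] by blast
    qed
  qed
qed

end

section \<open>The two kinds of divergence control, and the theorem\<close>

lemma divergence_control_Lq:
  fixes q :: ereal
  assumes \<theta>: "0 < \<theta>" "\<theta> < 1/2" and q: "ereal (2 * real CARD('n) / (1 - 2 * \<theta>)) \<le> q"
  shows "divergence_control (\<lambda>N (u :: real^'n \<Rightarrow> real^'n) G. holder_bd \<theta> N u \<and> (\<exists>g. has_divergence u g \<and> g \<in> Lq_space q \<and> G = Lq_norm q g)) \<theta>"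
proof
  show "0 < \<theta>" "\<theta> < 1" using \<theta> by auto
  fix K :: "real^'n \<Rightarrow> real" assume K: "kernel (Suc 0) K"
  define d where "d = real CARD('n)"
  define q\<^sub>0 where "q\<^sub>0 = 2 * d / (1 - 2 * \<theta>)"
  have d: "d \<ge> 1" by (simp add: d_def Suc_le_eq)
  have q0: "q\<^sub>0 > 1" using \<theta> d by (simp add: q\<^sub>0_def field_simps)
  \<comment> \<open>Here \<open>d / q\<^sub>0 = (1 - 2 * \<theta>) / 2\<close>. For
    \<open>\<theta> < 1/2\<close> the exponent \<open>1/2 + \<theta>\<close> exceeds
    \<open>2 * \<theta>\<close>, so for \<open>s \<le> 1\<close> the required bound follows.\<close>
  have ex: "1 - d / q\<^sub>0 = 1 / 2 + \<theta>" using \<theta> d by (simp add: q\<^sub>0_def field_simps)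
  obtain C where C: "C \<ge> 0" "\<And>\<theta> N u q q\<^sub>0 g s x. holder_bd \<theta> N u \<Longrightarrow> 0 < \<theta> \<Longrightarrow> has_divergence u g \<Longrightarrow> g \<in> Lq_space q \<Longrightarrow> ereal q\<^sub>0 \<le> q \<Longrightarrow> q\<^sub>0 > 1
    \<Longrightarrow> 0 < s \<Longrightarrow> s \<le> 1 \<Longrightarrow> \<bar>div_conv K u s x\<bar> \<le> C * Lq_norm q g * s powr (1 - CARD('n) / q\<^sub>0)"
    using div_conv_Lq[OF K] by metis
  show "\<exists>c\<ge>0. \<forall>N u G s x. holder_bd \<theta> N u \<and> (\<exists>g. has_divergence u g \<and> g \<in> Lq_space q \<and> G = Lq_norm q g) \<longrightarrow>
    0 < s \<longrightarrow> s \<le> 1 \<longrightarrow> \<bar>div_conv K u s x\<bar> \<le> c * G * s powr (2 * \<theta>)"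
  proof (intro exI[of _ C] conjI allI impI C(1))
    fix N G s :: real and u :: "real^'n \<Rightarrow> real^'n" and x :: "real^'n"
    assume *: "holder_bd \<theta> N u \<and> (\<exists>g. has_divergence u g \<and> g \<in> Lq_space q \<and> G = Lq_norm q g)" and s: "0 < s" "s \<le> 1"
    then obtain g where g: "has_divergence u g" "g \<in> Lq_space q" "G = Lq_norm q g" by blast
    have "\<bar>div_conv K u s x\<bar> \<le> C * G * s powr (1 - d / q\<^sub>0)"
      unfolding g(3) d_def by (rule C(2)[OF conjunct1[OF *] \<theta>(1) g(1,2) _ q0 s]) (use q in \<open>simp only: q\<^sub>0_def d_def\<close>)
    also have "\<dots> \<le> C * G * s powr (2 * \<theta>)"
      unfolding ex using s \<theta> C(1) Lq_norm_nonneg[of q g] g(3) by (intro mult_left_mono powr_mono') auto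
    finally show "\<bar>div_conv K u s x\<bar> \<le> C * G * s powr (2 * \<theta>)" .
  qed
qed (use Lq_norm_nonneg in blast)+

text \<open>With \<open>\<beta> = 2 * \<theta> - 1\<close>, which is positive here, the exponent
  \<open>1 + \<beta>\<close> of \<open>div_conv_Hoelder\<close> is exactly
  \<open>2 * \<theta>\<close>.\<close>

lemma divergence_control_Hoelder:
  assumes \<theta>: "1/2 < \<theta>" "\<theta> < 1"
  shows "divergence_control (\<lambda>N (u :: real^'n \<Rightarrow> real^'n) G. holder_bd \<theta> N u \<and> (\<exists>g. has_divergence u g \<and> holder_bd (2 * \<theta> - 1) G g)) \<theta>"
proof
  show \<theta>0: "0 < \<theta>" "\<theta> < 1" using \<theta> by auto
  fix K :: "real^'n \<Rightarrow> real" assume K: "kernel (Suc 0) K" "(\<integral>z. K z \<partial>lborel) = 0"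
  show "\<exists>c\<ge>0. \<forall>N u G s x. holder_bd \<theta> N u \<and> (\<exists>g. has_divergence u g \<and> holder_bd (2 * \<theta> - 1) G g) \<longrightarrow>
    0 < s \<longrightarrow> s \<le> 1 \<longrightarrow> \<bar>div_conv K u s x\<bar> \<le> c * G * s powr (2 * \<theta>)"
  proof (intro exI[of _ "\<integral>z. \<bar>K z\<bar> \<partial>lborel"] conjI allI impI)
    show "0 \<le> (\<integral>z. \<bar>K z\<bar> \<partial>lborel)" by (intro integral_nonneg_AE) auto
    fix N G s :: real and u :: "real^'n \<Rightarrow> real^'n" and x :: "real^'n"
    assume *: "holder_bd \<theta> N u \<and> (\<exists>g. has_divergence u g \<and> holder_bd (2 * \<theta> - 1) G g)" and s: "0 < s"
    then obtain g where g: "has_divergence u g" "holder_bd (2 * \<theta> - 1) G g" by blast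
    have "\<bar>div_conv K u s x\<bar> \<le> (\<integral>z. \<bar>K z\<bar> \<partial>lborel) * G * s powr (1 + (2 * \<theta> - 1))"
      by (rule div_conv_Hoelder[OF K conjunct1[OF *] \<theta>0(1) g _ s]) (use \<theta> in simp)
    then show "\<bar>div_conv K u s x\<bar> \<le> (\<integral>z. \<bar>K z\<bar> \<partial>lborel) * G * s powr (2 * \<theta>)" by simp
  qed
qed (use holder_bdD(4) in blast)+

theorem theorem1p4:
  fixes \<theta> :: real
  assumes "CARD('n::finite) \<ge> 2" and "0 < \<theta>" and "\<theta> < 1"
  shows
    "(\<forall>u :: real^'n \<Rightarrow> real^'n. u \<in> holder_space \<theta> \<longrightarrow> (\<exists>!p. zero_average_solution \<theta> u p)) \<and>
     (\<forall>q :: ereal. \<theta> < 1/2 \<and> ereal (2 * real CARD('n) / (1 - 2 * \<theta>)) \<le> q \<longrightarrow>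
       (\<exists>C>0. \<forall>(u :: real^'n \<Rightarrow> real^'n) p g.
          u \<in> holder_space \<theta> \<and> zero_average_solution \<theta> u p \<and> has_divergence u g \<and> g \<in> Lq_space q \<longrightarrow>
          p \<in> holder_space (2 * \<theta>) \<and>
          holder_norm (2 * \<theta>) p \<le> C * ((holder_norm \<theta> u)\<^sup>2 + (Lq_norm q g)\<^sup>2))) \<and>
     (1/2 < \<theta> \<longrightarrow>
       (\<exists>C>0. \<forall>(u :: real^'n \<Rightarrow> real^'n) p g.
          u \<in> holder_space \<theta> \<and> zero_average_solution \<theta> u p \<and> has_divergence u g \<and>
          g \<in> holder_space (2 * \<theta> - 1) \<longrightarrow>
          p \<in> C1_holder_space (2 * \<theta> - 1) \<and>
          C1_holder_norm (2 * \<theta> - 1) p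
            \<le> C * ((holder_norm \<theta> u)\<^sup>2 + (holder_norm (2 * \<theta> - 1) g)\<^sup>2)))"
proof (intro conjI allI impI)
  note \<theta> = assms(2,3)
  \<comment> \<open>Uniqueness identifies every solution with \<open>pressure u\<close>, so both
    estimates need proof for that function only.\<close>
  have sol: "p = pressure u" if "u \<in> holder_space \<theta>" "zero_average_solution \<theta> u p" for u :: "real^'n \<Rightarrow> real^'n" and p
    by (rule zero_average_solution_unique[OF that(2) pressure_solution[OF that(1) \<theta>] \<theta>(1)])
  show "\<exists>!p. zero_average_solution \<theta> u p" if "u \<in> holder_space \<theta>" for u :: "real^'n \<Rightarrow> real^'n"
    using pressure_solution[OF that \<theta>] sol[OF that] by blast
  show "\<exists>C>0. \<forall>(u :: real^'n \<Rightarrow> real^'n) p g.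
          u \<in> holder_space \<theta> \<and> zero_average_solution \<theta> u p \<and> has_divergence u g \<and> g \<in> Lq_space q \<longrightarrow>
          p \<in> holder_space (2 * \<theta>) \<and>
          holder_norm (2 * \<theta>) p \<le> C * ((holder_norm \<theta> u)\<^sup>2 + (Lq_norm q g)\<^sup>2)"
    if q: "\<theta> < 1/2 \<and> ereal (2 * real CARD('n) / (1 - 2 * \<theta>)) \<le> q" for q :: ereal
  proof -
    have low: "2 * \<theta> < 1" using q by simp
    obtain C where C: "C \<ge> 0" "\<And>N (u :: real^'n \<Rightarrow> real^'n) G. holder_bd \<theta> N u \<and> (\<exists>g. has_divergence u g \<and> g \<in> Lq_space q \<and> G = Lq_norm q g)
      \<Longrightarrow> holder_bd (2 * \<theta>) (C * (N\<^sup>2 + G\<^sup>2)) (pressure u)"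
      using divergence_control.pressure_double_low[OF divergence_control_Lq[OF \<theta>(1) conjunct1[OF q] conjunct2[OF q]] low] by blast
    show ?thesis
    \<comment> \<open>The factor 2 comes from \<open>holder_bd_imp_norm_le\<close>; the
      \<open>+ 1\<close> makes the constant positive when \<open>C = 0\<close>.\<close>
    proof (intro exI[of _ "2 * C + 1"] conjI allI impI)
      show "2 * C + 1 > 0" using C(1) by simp
      fix u :: "real^'n \<Rightarrow> real^'n" and p g
      assume a: "u \<in> holder_space \<theta> \<and> zero_average_solution \<theta> u p \<and> has_divergence u g \<and> g \<in> Lq_space q"
      define W where "W = (holder_norm \<theta> u)\<^sup>2 + (Lq_norm q g)\<^sup>2"
      have W: "W \<ge> 0" by (simp add: W_def)
      have bd: "holder_bd (2 * \<theta>) (C * W) p"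
        unfolding W_def sol[OF conjunct1[OF a] conjunct1[OF conjunct2[OF a]]]
        by (rule C(2)) (use holder_space_imp_bd a in blast)
      show "p \<in> holder_space (2 * \<theta>)" by (rule holder_bd_imp_space[OF bd])
      have "holder_norm (2 * \<theta>) p \<le> 2 * (C * W)" by (rule holder_bd_imp_norm_le[OF bd])
      also have "\<dots> \<le> (2 * C + 1) * W" using W by (simp add: algebra_simps)
      finally show "holder_norm (2 * \<theta>) p \<le> (2 * C + 1) * ((holder_norm \<theta> u)\<^sup>2 + (Lq_norm q g)\<^sup>2)" by (simp only: W_def)
    qed
  qed
  show "\<exists>C>0. \<forall>(u :: real^'n \<Rightarrow> real^'n) p g.
          u \<in> holder_space \<theta> \<and> zero_average_solution \<theta> u p \<and> has_divergence u g \<and>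
          g \<in> holder_space (2 * \<theta> - 1) \<longrightarrow>
          p \<in> C1_holder_space (2 * \<theta> - 1) \<and>
          C1_holder_norm (2 * \<theta> - 1) p
            \<le> C * ((holder_norm \<theta> u)\<^sup>2 + (holder_norm (2 * \<theta> - 1) g)\<^sup>2)"
    if high: "1/2 < \<theta>"
  proof -
    have high': "1 < 2 * \<theta>" using high by simp
    obtain C where C: "C \<ge> 0" "\<And>N (u :: real^'n \<Rightarrow> real^'n) G. holder_bd \<theta> N u \<and> (\<exists>g. has_divergence u g \<and> holder_bd (2 * \<theta> - 1) G g)
      \<Longrightarrow> (\<forall>x. \<bar>pressure u x\<bar> \<le> C * (N\<^sup>2 + G\<^sup>2)) \<and> pressure u differentiable_on UNIV \<and>
        (\<forall>k. holder_bd (2 * \<theta> - 1) (C * (N\<^sup>2 + G\<^sup>2)) (partial k (pressure u)))"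
      using divergence_control.pressure_double_high[OF divergence_control_Hoelder[OF high \<theta>(2)] high'] by blast
    define d where "d = real CARD('n)"
    show ?thesis
    \<comment> \<open>One sup norm of \<open>p\<close>, \<open>d\<close> sup norms and
      \<open>d\<close> seminorms of its derivatives, each at most \<open>C * W\<close>; again
      \<open>+ 1\<close> for positivity.\<close>
    proof (intro exI[of _ "(1 + 2 * d) * C + 1"] conjI allI impI)
      show "(1 + 2 * d) * C + 1 > 0" using C(1) by (simp add: d_def add_nonneg_pos)
      fix u :: "real^'n \<Rightarrow> real^'n" and p g
      assume a: "u \<in> holder_space \<theta> \<and> zero_average_solution \<theta> u p \<and> has_divergence u g \<and> g \<in> holder_space (2 * \<theta> - 1)"
      define W where "W = (holder_norm \<theta> u)\<^sup>2 + (holder_norm (2 * \<theta> - 1) g)\<^sup>2"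
      have W: "W \<ge> 0" by (simp add: W_def)
      have "holder_bd \<theta> (holder_norm \<theta> u) u \<and> (\<exists>g'. has_divergence u g' \<and> holder_bd (2 * \<theta> - 1) (holder_norm (2 * \<theta> - 1) g) g')"
        using a holder_space_imp_bd[of u \<theta>] holder_space_imp_bd[of g "2 * \<theta> - 1"] by blast
      from C(2)[OF this] have b: "\<And>x. \<bar>p x\<bar> \<le> C * W" "p differentiable_on UNIV" "\<And>k. holder_bd (2 * \<theta> - 1) (C * W) (partial k p)"
        unfolding W_def sol[OF conjunct1[OF a] conjunct1[OF conjunct2[OF a]], symmetric] by blast+
      have per: "periodic p" using a by (simp add: zero_average_solution_def holder_space_def)
      show "p \<in> C1_holder_space (2 * \<theta> - 1)"
        using per b(2) holder_bd_imp_space[OF b(3)] by (simp add: C1_holder_space_def)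
      have "sup_norm p \<le> C * W" by (rule sup_norm_le) (use b(1) in simp)
      moreover have "(\<Sum>i\<in>UNIV. sup_norm (partial i p)) \<le> (\<Sum>i\<in>(UNIV :: 'n set). C * W)"
        by (intro sum_mono sup_norm_le holder_bdD(2)[OF b(3)])
      moreover have "(\<Sum>i\<in>UNIV. holder_seminorm (2 * \<theta> - 1) (partial i p)) \<le> (\<Sum>i\<in>(UNIV :: 'n set). C * W)"
        by (intro sum_mono holder_seminorm_le holder_bdD(3)[OF b(3)])
      ultimately have "C1_holder_norm (2 * \<theta> - 1) p \<le> C * W + d * (C * W) + d * (C * W)"
        unfolding C1_holder_norm_def d_def sum_constant by linarith
      also have "\<dots> \<le> ((1 + 2 * d) * C + 1) * W" using W by (simp add: algebra_simps)
      finally show "C1_holder_norm (2 * \<theta> - 1) p \<le> ((1 + 2 * d) * C + 1) * ((holder_norm \<theta> u)\<^sup>2 + (holder_norm (2 * \<theta> - 1) g)\<^sup>2)"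
        by (simp only: W_def)
    qed
  qed
qed

end
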